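(* Let $q\in(1,\infty)$ and $t\in\mathbb R$, and let $s\mapsto p(s,t)$, $s\le t$, be the solution of $$p'(s)=-\frac{p(s)}{c(p(s),s)},\quad s\le t;\qquad p(t)=q,$$ where $c(p,s)=\frac{p}{p-1}\|Q^{1/2}(s,-\infty)B^*(s)^{-1}\|^2$. Then for $s<t$, $P_{s,t}$ maps $L^q(\mathbb R^n,\nu_t)$ into $L^{p(s,t)}(\mathbb R^n,\nu_s)$ and $$\|P_{s,t}\varphi\|_{L^{p(s,t)}(\mathbb R^n,\nu_s)}\le\|\varphi\|_{L^q(\mathbb R^n,\nu_t)},\qquad\varphi\in L^q(\mathbb R^n,\nu_t).$$
   Context: Let $n\ge 1$ and let $A,B:\mathbb R\to\mathcal L(\mathbb R^n)$, $f:\mathbb R\to\mathbb R^n$ be continuous and bounded (not necessarily periodic), with $\|B(t)x\|\ge \mu_0\|x\|$ for all $t,x$ and some $\mu_0>0$. Let $U(t,s)$ be the evolution operator of $\xi'=A(t)\xi$, and assume $\omega_0(U):=\inf\{\omega:\exists M,\ \|U(t,s)\|\le Me^{\omega(t-s)}\ \forall s\le t\}<0$. For $-\infty\le s<t$ let $Q(t,s)=\int_s^tU(t,r)B(r)B^*(r)U^*(t,r)dr$ ($Q^{1/2}$ its positive square root), $g(t,s)=\int_s^tU(t,r)f(r)dr$, and $\nu_t=\mathcal N_{g(t,-\infty),Q(t,-\infty)}$ (Gaussian measure on $\mathbb R^n$). For $s<t$, $P_{s,t}\varphi(x)=\int_{\mathbb R^n}\varphi(y)\,\mathcal N_{U(t,s)x+g(t,s),Q(t,s)}(dy)$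 for bounded continuous $\varphi$, extended by density to $L^q(\mathbb R^n,\nu_t)$. *)

theory Defs
  imports "HOL-Probability.Probability"
begin

definition mat_opnorm :: "real^'n^'m \<Rightarrow> real" where
  "mat_opnorm M = onorm (\<lambda>x. M *v x)"

definition msqrt :: "real^'n^'n \<Rightarrow> real^'n^'n" where
  "msqrt Q = (THE S. transpose S = S \<and> (\<forall>x. 0 \<le> x \<bullet> (S *v x)) \<and> S ** S = Q)"

definition std_gaussian :: "(real^'n) measure" where
  "std_gaussian = density lborel (\<lambda>x. ennreal (\<Prod>i\<in>UNIV. std_normal_density (x $ i)))"

definition gaussian_measure :: "real^'n \<Rightarrow> real^'n^'n \<Rightarrow> (real^'n) measure" where
  "gaussian_measure m Q = distr std_gaussian borel (\<lambda>x. m + msqrt Q *v x)"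

definition covQ :: "(real \<Rightarrow> real \<Rightarrow> real^'n^'n) \<Rightarrow> (real \<Rightarrow> real^'k^'n) \<Rightarrow> real \<Rightarrow> real \<Rightarrow> real^'n^'n" where
  "covQ U B t s = integral {s..t} (\<lambda>r. U t r ** B r ** transpose (B r) ** transpose (U t r))"

definition covQinf :: "(real \<Rightarrow> real \<Rightarrow> real^'n^'n) \<Rightarrow> (real \<Rightarrow> real^'k^'n) \<Rightarrow> real \<Rightarrow> real^'n^'n" where
  "covQinf U B t = integral {..t} (\<lambda>r. U t r ** B r ** transpose (B r) ** transpose (U t r))"

definition meanG :: "(real \<Rightarrow> real \<Rightarrow> real^'n^'n) \<Rightarrow> (real \<Rightarrow> real^'n) \<Rightarrow> real \<Rightarrow> real \<Rightarrow> real^'n" where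
  "meanG U f t s = integral {s..t} (\<lambda>r. U t r *v f r)"

definition meanGinf :: "(real \<Rightarrow> real \<Rightarrow> real^'n^'n) \<Rightarrow> (real \<Rightarrow> real^'n) \<Rightarrow> real \<Rightarrow> real^'n" where
  "meanGinf U f t = integral {..t} (\<lambda>r. U t r *v f r)"

definition nu :: "(real \<Rightarrow> real \<Rightarrow> real^'n^'n) \<Rightarrow> (real \<Rightarrow> real^'n^'n) \<Rightarrow> (real \<Rightarrow> real^'n) \<Rightarrow> real \<Rightarrow> (real^'n) measure" where
  "nu U B f t = gaussian_measure (meanGinf U f t) (covQinf U B t)"

definition Pst :: "(real \<Rightarrow> real \<Rightarrow> real^'n^'n) \<Rightarrow> (real \<Rightarrow> real^'n^'n) \<Rightarrow> (real \<Rightarrow> real^'n) \<Rightarrow> real \<Rightarrow> real \<Rightarrow> (real^'n \<Rightarrow> real) \<Rightarrow> real^'n \<Rightarrow> real" where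
  "Pst U B f s t \<phi> x = (\<integral>y. \<phi> y \<partial>gaussian_measure (U t s *v x + meanG U f t s) (covQ U B t s))"

definition cfun :: "(real \<Rightarrow> real \<Rightarrow> real^'n^'n) \<Rightarrow> (real \<Rightarrow> real^'n^'n) \<Rightarrow> real \<Rightarrow> real \<Rightarrow> real" where
  "cfun U B p s = p / (p - 1) * (mat_opnorm (msqrt (covQinf U B s) ** matrix_inv (transpose (B s))))\<^sup>2"

end

theory Submission
  imports Defs
begin

text \<open>
  Let \<open>(X, Y)\<close> be centred jointly Gaussian with \<open>X\<close> distributed as \<open>\<nu>\<^sub>s\<close> and \<open>Y = U(t,s) X + Z\<close>, where \<open>Z\<close> is
  independent of \<open>X\<close> with covariance \<open>Q(t,s)\<close>; then \<open>Y\<close> is distributed as \<open>\<nu>\<^sub>t\<close> (up to the means) and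
  \<open>P\<^sub>s\<^sub>,\<^sub>t \<phi>(X) = E[\<phi>(Y) | X]\<close>. Testing with \<open>(P \<phi>)\<^sup>p\<^sup>-\<^sup>1\<close>, the contraction property follows from
  \<open>E[F(X)\<^sup>\<alpha> G(Y)\<^sup>\<beta>] \<le> (E F(X))\<^sup>\<alpha> (E G(Y))\<^sup>\<beta>\<close> with \<open>\<alpha> = 1 - 1/p\<close> and \<open>\<beta> = 1/q\<close>.

  For smooth \<open>F\<close>, \<open>G\<close> bounded away from zero, split \<open>(X, Y)\<close> into \<open>N\<close> independent copies of \<open>N\<^sup>-\<^sup>1\<^sup>/\<^sup>2 (X, Y)\<close> and
  average them out one at a time. By Taylor expansion each average costs only \<open>O(N\<^sup>-\<^sup>3\<^sup>/\<^sup>2)\<close>, because the second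
  order term is nonpositive as soon as \<open>(p - 1) \<langle>Q\<^sub>s U\<^sup>* y, U\<^sup>* y\<rangle> \<le> (q - 1) \<langle>Q\<^sub>t y, y\<rangle>\<close>. The latter holds since
  \<open>r \<mapsto> (p(r) - 1) \<langle>Q\<^sub>r U(t,r)\<^sup>* y, U(t,r)\<^sup>* y\<rangle>\<close> is nondecreasing by the differential equation for \<open>p\<close>.
\<close>

section \<open>Square roots of positive semidefinite matrices\<close>

lemma inner_matrix_vector_left:
  fixes A :: "real^'n^'m"
  shows "(A *v x) \<bullet> y = x \<bullet> (transpose A *v y)"
  by (metis dot_lmul_matrix inner_commute vector_transpose_matrix)

lemma bounded_linear_transpose: "bounded_linear (transpose :: real^'n^'m \<Rightarrow> real^'m^'n)"
  unfolding linear_conv_bounded_linear[symmetric]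
  by (rule linearI) (simp_all add: transpose_def vec_eq_iff)

lemma psd_form_zero_imp_kernel:
  fixes R :: "'a::real_inner \<Rightarrow> 'a"
  assumes R: "linear R" and sym: "\<And>x y. R x \<bullet> y = x \<bullet> R y"
    and V: "subspace V" "R ` V \<subseteq> V" and psd: "\<And>x. x \<in> V \<Longrightarrow> 0 \<le> x \<bullet> R x"
    and v: "v \<in> V" "v \<bullet> R v = 0"
  shows "R v = 0"
proof -
  let ?a = "R v \<bullet> R v" and ?c = "R v \<bullet> R (R v)"
  have "R v \<in> V" using V v by blast
  then have c: "0 \<le> ?c" by (rule psd)
  define e where "e = ?a / (?c + 1)"
  have "v - e *\<^sub>R R v \<in> V" using V(1) v(1) \<open>R v \<in> V\<close> by (intro subspace_diff subspace_mul)
  then have "0 \<le> (v - e *\<^sub>R R v) \<bullet> R (v - e *\<^sub>R R v)" by (rule psd)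
  also have "\<dots> = - (2 * e * ?a) + e\<^sup>2 * ?c"
    using v(2) sym[of v "R v"]
    by (simp add: linear_diff[OF R] linear_scale[OF R] inner_diff_left inner_diff_right
        power2_eq_square algebra_simps)
  also have "e\<^sup>2 * ?c \<le> e * ?a"
  proof -
    have "e * ?c \<le> ?a" using c by (simp add: e_def divide_le_eq algebra_simps)
    then have "e * (e * ?c) \<le> e * ?a" using c by (intro mult_left_mono) (simp_all add: e_def)
    then show ?thesis by (simp add: power2_eq_square)
  qed
  finally have "e * ?a \<le> 0" by simp
  then have "?a * ?a \<le> 0" using c by (simp add: e_def divide_le_0_iff)
  then show ?thesis
    using inner_ge_zero[of "R v"] by (simp only: mult_le_0_iff inner_eq_zero_iff order_antisym_conv) auto
qed

lemma selfadjoint_eigenvector: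
  fixes T :: "'a::euclidean_space \<Rightarrow> 'a"
  assumes T: "linear T" and sym: "\<And>x y. T x \<bullet> y = x \<bullet> T y"
    and V: "subspace V" "T ` V \<subseteq> V" "V \<noteq> {0}"
  obtains v where "v \<in> V" "norm v = 1" "T v = (v \<bullet> T v) *\<^sub>R v"
proof -
  obtain w where "w \<in> V" "w \<noteq> 0" using V(1,3) subspace_0 by blast
  then have "(1 / norm w) *\<^sub>R w \<in> V \<inter> sphere 0 1" using V(1) by (simp add: subspace_mul)
  then have "V \<inter> sphere 0 1 \<noteq> {}" by blast
  moreover have "compact (V \<inter> sphere 0 1)"
    using V(1) by (simp add: closed_subspace closed_Int_compact)
  moreover have "continuous_on (V \<inter> sphere 0 1) (\<lambda>x. x \<bullet> T x)"
    using T by (intro continuous_intros linear_continuous_on) (simp add: linear_conv_bounded_linear)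
  ultimately obtain v where "v \<in> V \<inter> sphere 0 1" and "\<forall>x\<in>V \<inter> sphere 0 1. x \<bullet> T x \<le> v \<bullet> T v"
    using continuous_attains_sup[of "V \<inter> sphere 0 1" "\<lambda>x. x \<bullet> T x"] by blast
  then have v: "v \<in> V" "norm v = 1" and max: "\<And>x. x \<in> V \<Longrightarrow> norm x = 1 \<Longrightarrow> x \<bullet> T x \<le> v \<bullet> T v"
    by auto
  let ?R = "\<lambda>x. (v \<bullet> T v) *\<^sub>R x - T x"
  have "?R v = 0"
  proof (rule psd_form_zero_imp_kernel[where R = ?R, OF _ _ V(1) _ _ v(1)])
    show "linear ?R"
      by (intro linear_compose_sub[OF _ T] linear_compose_scale_right linear_id[unfolded id_def])
    show "?R x \<bullet> y = x \<bullet> ?R y" for x y by (simp add: inner_diff_left inner_diff_right sym)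
    show "?R ` V \<subseteq> V" using V by (auto intro!: subspace_diff subspace_mul)
    show "v \<bullet> ?R v = 0" using v(2) by (simp add: inner_diff_right dot_square_norm)
    fix x assume x: "x \<in> V"
    show "0 \<le> x \<bullet> ?R x"
    proof (cases "x = 0")
      case False
      have "(1 / norm x) *\<^sub>R x \<bullet> T ((1 / norm x) *\<^sub>R x) \<le> v \<bullet> T v"
        using x V(1) False by (intro max subspace_mul) auto
      then show ?thesis using False
        by (simp add: linear_scale[OF T] inner_diff_right dot_square_norm power2_eq_square field_simps)
    qed simp
  qed
  then show ?thesis using that v by simp
qed

definition orthonormal_eigensystem :: "('a::euclidean_space \<Rightarrow> 'a) \<Rightarrow> 'a set \<Rightarrow> bool" where
  "orthonormal_eigensystem T B \<longleftrightarrow> pairwise orthogonal B \<and> (\<forall>b\<in>B. norm b = 1 \<and> T b = (b \<bullet> T b) *\<^sub>R b)"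

lemma orthonormal_eigensystem_finite:
  fixes B :: "'a::euclidean_space set"
  assumes "orthonormal_eigensystem T B"
  shows "finite B" "card B \<le> DIM('a)"
proof -
  have "0 \<notin> B" using assms by (auto simp: orthonormal_eigensystem_def)
  then show "finite B" "card B \<le> DIM('a)"
    using assms independent_bound[OF pairwise_orthogonal_independent, of B]
    by (simp_all add: orthonormal_eigensystem_def)
qed

lemma orthonormal_eigensystem_extend:
  assumes T: "linear T" and sym: "\<And>x y. T x \<bullet> y = x \<bullet> T y"
    and B: "orthonormal_eigensystem T B" "span B \<noteq> UNIV"
  obtains v where "v \<notin> B" "orthonormal_eigensystem T (insert v B)"
proof -
  define V where "V = {x. \<forall>b\<in>B. orthogonal b x}"
  obtain a where "a \<noteq> 0" "\<forall>x\<in>span B. a \<bullet> x = 0" using span_not_UNIV_orthogonal[OF B(2)] by auto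
  then have "a \<in> V" by (auto simp: V_def orthogonal_def inner_commute span_base)
  have "subspace V" unfolding V_def by (rule subspace_orthogonal_to_vectors)
  moreover have "T x \<in> V" if "x \<in> V" for x
    unfolding V_def orthogonal_def
  proof (intro CollectI ballI)
    fix b assume b: "b \<in> B"
    then have "b \<bullet> T x = (b \<bullet> T b) * (b \<bullet> x)"
      using B(1) sym[of b x] by (metis orthonormal_eigensystem_def inner_scaleR_left)
    then show "b \<bullet> T x = 0" using b that by (simp add: V_def orthogonal_def)
  qed
  ultimately obtain v where v: "v \<in> V" "norm v = 1" "T v = (v \<bullet> T v) *\<^sub>R v"
    using selfadjoint_eigenvector[OF T sym, of V] \<open>a \<in> V\<close> \<open>a \<noteq> 0\<close> by blast
  have "v \<notin> B" using v(1,2) by (auto simp: V_def orthogonal_def)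
  moreover have "orthonormal_eigensystem T (insert v B)"
    using B(1) v by (auto simp: orthonormal_eigensystem_def V_def pairwise_insert orthogonal_commute)
  ultimately show ?thesis by (rule that)
qed

lemma selfadjoint_orthonormal_eigenbasis:
  fixes T :: "'a::euclidean_space \<Rightarrow> 'a"
  assumes T: "linear T" and sym: "\<And>x y. T x \<bullet> y = x \<bullet> T y"
  obtains B where "finite B" "pairwise orthogonal B" "\<And>b. b \<in> B \<Longrightarrow> norm b = 1" "span B = UNIV"
    "\<And>b. b \<in> B \<Longrightarrow> T b = (b \<bullet> T b) *\<^sub>R b"
proof -
  have "orthonormal_eigensystem T {}" by (simp add: orthonormal_eigensystem_def)
  moreover have "\<forall>B. orthonormal_eigensystem T B \<longrightarrow> card B < Suc DIM('a)"
    using orthonormal_eigensystem_finite by (auto simp: less_Suc_eq_le)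
  ultimately obtain B where B: "orthonormal_eigensystem T B"
    and maximal: "\<And>C. orthonormal_eigensystem T C \<Longrightarrow> card C \<le> card B"
    using ex_has_greatest_nat[of "orthonormal_eigensystem T" "{}" card "Suc DIM('a)"] by blast
  note finite = orthonormal_eigensystem_finite(1)[OF B]
  have "span B = UNIV"
  proof (rule ccontr)
    assume "span B \<noteq> UNIV"
    then obtain v where "v \<notin> B" "orthonormal_eigensystem T (insert v B)"
      using orthonormal_eigensystem_extend[OF T sym B] by blast
    with maximal[of "insert v B"] finite show False by simp
  qed
  then show ?thesis using that B finite by (auto simp: orthonormal_eigensystem_def)
qed

definition pos_semidef :: "real^'n^'n \<Rightarrow> bool" where
  "pos_semidef Q \<longleftrightarrow> transpose Q = Q \<and> (\<forall>x. 0 \<le> x \<bullet> (Q *v x))"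

lemma selfadjoint_matrix_eigenbasis:
  fixes Q :: "real^'n^'n"
  assumes "transpose Q = Q"
  obtains B where "finite B" "pairwise orthogonal B" "\<And>b. b \<in> B \<Longrightarrow> norm b = 1" "span B = UNIV"
    "\<And>b. b \<in> B \<Longrightarrow> Q *v b = (b \<bullet> (Q *v b)) *\<^sub>R b"
  using selfadjoint_orthonormal_eigenbasis[of "(*v) Q"] inner_matrix_vector_left[of Q] assms by auto

lemma matrix_eq_on_spanning:
  fixes P Q :: "real^'n^'m"
  assumes "span B = UNIV" "\<And>b. b \<in> B \<Longrightarrow> P *v b = Q *v b"
  shows "P = Q"
  using assms linear_eq_on_span[of "(*v) P" "(*v) Q" B] by (simp add: matrix_eq)

lemma pos_semidef_sqrt_exists:
  fixes Q :: "real^'n^'n"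
  assumes Q: "pos_semidef Q"
  shows "\<exists>S. pos_semidef S \<and> S ** S = Q"
proof -
  obtain B where B: "finite B" "pairwise orthogonal B" "\<And>b. b \<in> B \<Longrightarrow> norm b = 1" "span B = UNIV"
    and eigen: "\<And>b. b \<in> B \<Longrightarrow> Q *v b = (b \<bullet> (Q *v b)) *\<^sub>R b"
    using selfadjoint_matrix_eigenbasis[of Q] Q by (auto simp: pos_semidef_def)
  define r where "r b = sqrt (b \<bullet> (Q *v b))" for b
  have r: "0 \<le> r b" "r b * r b = b \<bullet> (Q *v b)" for b
    using Q by (simp_all add: r_def pos_semidef_def)
  define S where "S = matrix (\<lambda>x. \<Sum>b\<in>B. (r b * (b \<bullet> x)) *\<^sub>R b)"
  have S: "S *v x = (\<Sum>b\<in>B. (r b * (b \<bullet> x)) *\<^sub>R b)" for x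
    unfolding S_def
    by (intro fun_cong[OF matrix_vector_mul(2)] linear_compose_sum ballI linearI)
      (simp_all add: inner_add_right distrib_left scaleR_add_left mult.left_commute)
  have form: "x \<bullet> (S *v y) = (\<Sum>b\<in>B. r b * (b \<bullet> x) * (b \<bullet> y))" for x y
    unfolding S inner_sum_right by (intro sum.cong) (simp_all add: inner_commute mult_ac)
  have "x \<bullet> (transpose S *v y) = x \<bullet> (S *v y)" for x y
    unfolding inner_matrix_vector_left[symmetric] by (subst inner_commute) (simp add: form mult_ac)
  then have "transpose S *v y = S *v y" for y
    using vector_eq_ldot by blast
  then have "transpose S = S" by (simp add: matrix_eq)
  moreover have "0 \<le> x \<bullet> (S *v x)" for x
    unfolding form by (intro sum_nonneg) (simp add: r mult.assoc)
  moreover have "S ** S = Q"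
  proof (rule matrix_eq_on_spanning[OF B(4)])
    fix b assume b: "b \<in> B"
    have "(r c * (c \<bullet> b)) *\<^sub>R c = (if c = b then r b *\<^sub>R b else 0)" if "c \<in> B" for c
      using b that B(2,3) by (auto simp: pairwise_def orthogonal_def dot_square_norm)
    then have "S *v b = (\<Sum>c\<in>B. if c = b then r b *\<^sub>R b else 0)"
      unfolding S by (intro sum.cong refl)
    then have "S *v b = r b *\<^sub>R b" using b B(1) by simp
    then have "(S ** S) *v b = (b \<bullet> (Q *v b)) *\<^sub>R b"
      by (simp add: matrix_vector_mul_assoc[symmetric] matrix_vector_mult_scaleR r(2))
    then show "(S ** S) *v b = Q *v b" unfolding eigen[OF b, symmetric] .
  qed
  ultimately show ?thesis by (auto simp: pos_semidef_def)
qed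

lemma pos_semidef_form_zero:
  fixes S :: "real^'n^'n"
  assumes "pos_semidef S" "x \<bullet> (S *v x) = 0"
  shows "S *v x = 0"
  using assms psd_form_zero_imp_kernel[of "(*v) S" UNIV x] inner_matrix_vector_left[of S]
  by (simp add: pos_semidef_def)

lemma pos_semidef_sqrt_unique:
  fixes S T :: "real^'n^'n"
  assumes S: "pos_semidef S" and T: "pos_semidef T" and eq: "S ** S = T ** T"
  shows "S = T"
proof -
  define D where "D = S - T"
  have "transpose D = D"
    using S T linear_diff[OF bounded_linear.linear[OF bounded_linear_transpose], of S T] by (simp add: D_def pos_semidef_def)
  then obtain B where B: "span B = UNIV" and eigen: "\<And>b. b \<in> B \<Longrightarrow> D *v b = (b \<bullet> (D *v b)) *\<^sub>R b"
    by (rule selfadjoint_matrix_eigenbasis) blast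
  have "D *v b = 0" if "b \<in> B" for b
  proof -
    define d where "d = b \<bullet> (D *v b)"
    have Db: "D *v b = d *\<^sub>R b" unfolding d_def by (rule eigen[OF that])
    have "S ** D + D ** T = 0"
      using eq by (simp add: D_def matrix_matrix_mult_def vec_eq_iff sum_subtractf algebra_simps)
    then have "b \<bullet> ((S ** D + D ** T) *v b) = 0" by simp
    also have "b \<bullet> ((S ** D + D ** T) *v b) = b \<bullet> (S *v (D *v b)) + (D *v b) \<bullet> (T *v b)"
      using inner_matrix_vector_left[of D b "T *v b"] \<open>transpose D = D\<close>
      by (simp add: matrix_vector_mult_add_rdistrib inner_add_right matrix_vector_mul_assoc)
    also have "\<dots> = d * (b \<bullet> (S *v b)) + d * (b \<bullet> (T *v b))"
      by (simp add: Db matrix_vector_mult_scaleR)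
    finally consider "d = 0" | "b \<bullet> (S *v b) + b \<bullet> (T *v b) = 0" by (auto simp: distrib_left[symmetric])
    then show ?thesis
    proof cases
      case 2
      moreover have "0 \<le> b \<bullet> (S *v b)" "0 \<le> b \<bullet> (T *v b)" using S T by (auto simp: pos_semidef_def)
      ultimately have "S *v b = 0" "T *v b = 0"
        using S T by (auto intro!: pos_semidef_form_zero)
      then show ?thesis by (simp add: D_def matrix_vector_mult_diff_rdistrib)
    qed (simp add: Db)
  qed
  then have "D = 0" by (intro matrix_eq_on_spanning[OF B]) simp
  then show ?thesis by (simp add: D_def)
qed

lemma
  fixes Q :: "real^'n^'n"
  assumes Q: "pos_semidef Q"
  shows transpose_msqrt: "transpose (msqrt Q) = msqrt Q"
    and msqrt_mult_self: "msqrt Q ** msqrt Q = Q"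
proof -
  have "\<exists>!S. pos_semidef S \<and> S ** S = Q"
    using pos_semidef_sqrt_exists[OF Q] pos_semidef_sqrt_unique by blast
  from theI'[OF this] show "transpose (msqrt Q) = msqrt Q" "msqrt Q ** msqrt Q = Q"
    by (simp_all add: msqrt_def pos_semidef_def conj_assoc)
qed

lemma norm_msqrt_mult:
  fixes Q :: "real^'n^'n"
  assumes "pos_semidef Q"
  shows "(norm (msqrt Q *v x))\<^sup>2 = x \<bullet> (Q *v x)"
  using inner_matrix_vector_left[of "msqrt Q" x "msqrt Q *v x"]
  by (simp add: power2_norm_eq_inner transpose_msqrt[OF assms] matrix_vector_mul_assoc
      msqrt_mult_self[OF assms])

definition pos_def :: "real^'n^'n \<Rightarrow> bool" where
  "pos_def Q \<longleftrightarrow> transpose Q = Q \<and> (\<forall>x. x \<noteq> 0 \<longrightarrow> 0 < x \<bullet> (Q *v x))"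

lemma pos_def_imp_pos_semidef: "pos_def Q \<Longrightarrow> pos_semidef Q"
  unfolding pos_def_def pos_semidef_def by (metis inner_zero_left less_eq_real_def)

lemma quadratic_form_conjugate:
  fixes V Q :: "real^'n^'n"
  shows "y \<bullet> ((V ** Q ** transpose V) *v y) = (transpose V *v y) \<bullet> (Q *v (transpose V *v y))"
  by (metis inner_commute inner_matrix_vector_left matrix_vector_mul_assoc)

lemma pos_def_conjugate_add:
  fixes V Q R :: "real^'n^'n"
  assumes Q: "pos_semidef Q" and R: "pos_def R"
  shows "pos_def (V ** Q ** transpose V + R)"
  unfolding pos_def_def
proof (intro conjI allI impI)
  have "transpose (V ** Q ** transpose V) = V ** Q ** transpose V"
    using Q by (simp add: pos_semidef_def matrix_transpose_mul matrix_mul_assoc)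
  then show "transpose (V ** Q ** transpose V + R) = V ** Q ** transpose V + R"
    using R linear_add[OF bounded_linear.linear[OF bounded_linear_transpose], of "V ** Q ** transpose V" R]
    by (simp add: pos_def_def)
  fix x :: "real^'n" assume "x \<noteq> 0"
  then show "0 < x \<bullet> ((V ** Q ** transpose V + R) *v x)"
    unfolding matrix_vector_mult_add_rdistrib inner_add_right quadratic_form_conjugate
    using Q R by (simp add: pos_semidef_def pos_def_def add_nonneg_pos)
qed

lemma matrix_inv_invertible:
  fixes A :: "real^'n^'n"
  assumes "invertible A"
  shows "A ** matrix_inv A = mat 1" "matrix_inv A ** A = mat 1"
  using someI_ex[OF assms[unfolded invertible_def]] by (auto simp: matrix_inv_def)

lemma invertible_iff_ker:
  fixes A :: "real^'n^'n"
  shows "invertible A \<longleftrightarrow> (\<forall>x. A *v x = 0 \<longrightarrow> x = 0)"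
  by (simp add: invertible_left_inverse matrix_left_invertible_ker)

lemma invertible_msqrt:
  assumes "pos_def Q"
  shows "invertible (msqrt Q)"
  unfolding invertible_iff_ker
proof safe
  fix x assume "msqrt Q *v x = 0"
  then have "x \<bullet> (Q *v x) = 0"
    using norm_msqrt_mult[OF pos_def_imp_pos_semidef[OF assms], of x] by simp
  then show "x = 0" using assms by (auto simp: pos_def_def)
qed

section \<open>The standard Gaussian measure\<close>

definition gauss_density :: "'a::euclidean_space \<Rightarrow> real" where
  "gauss_density x = (\<Prod>b\<in>Basis. std_normal_density (x \<bullet> b))"

definition std_gauss :: "'a::euclidean_space measure" where
  "std_gauss = density lborel (\<lambda>x. ennreal (gauss_density x))"

lemma gauss_density_eq:
  "gauss_density (x::'a::euclidean_space) = (1 / sqrt (2 * pi)) ^ DIM('a) * exp (- (norm x)\<^sup>2 / 2)"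
proof -
  have "gauss_density x = (\<Prod>b\<in>(Basis::'a set). (1 / sqrt (2 * pi)) * exp (- (x \<bullet> b)\<^sup>2 / 2))"
    by (simp add: gauss_density_def std_normal_density_def)
  also have "\<dots> = (1 / sqrt (2 * pi)) ^ DIM('a) * exp (\<Sum>b\<in>Basis. - (x \<bullet> b)\<^sup>2 / 2)"
    by (simp only: prod.distrib prod_constant exp_sum[OF finite_Basis])
  also have "(\<Sum>b\<in>Basis. - (x \<bullet> b)\<^sup>2 / 2) = - (norm x)\<^sup>2 / 2"
    unfolding power2_norm_eq_inner euclidean_inner[of x x] sum_divide_distrib sum_negf[symmetric]
    by (simp add: power2_eq_square)
  finally show ?thesis .
qed

lemma gauss_density_nonneg [simp]: "0 \<le> gauss_density x"
  by (simp add: gauss_density_eq)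

lemma borel_measurable_gauss_density [measurable]: "gauss_density \<in> borel_measurable borel"
  unfolding gauss_density_eq by measurable

lemma gauss_density_cong: "norm x = norm y \<Longrightarrow> gauss_density x = gauss_density y"
  for x y :: "'a::euclidean_space"
  by (simp add: gauss_density_eq)

lemma nn_integral_gauss_density: "(\<integral>\<^sup>+x. gauss_density (x::'a::euclidean_space) \<partial>lborel) = 1"
proof -
  have "(\<integral>\<^sup>+x. std_normal_density x \<partial>lborel) = 1"
    by (subst nn_integral_eq_integral) (auto simp: integral_normal_density)
  then show ?thesis
    using nn_integral_lborel_prod[of "\<lambda>(_::'a) x. ennreal (std_normal_density x)"]
    by (simp add: gauss_density_def prod_ennreal)
qed

lemma sets_std_gauss [measurable_cong, simp]: "sets std_gauss = sets borel"
  by (simp add: std_gauss_def)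

lemma space_std_gauss [simp]: "space std_gauss = UNIV"
  by (simp add: std_gauss_def)

lemma prob_space_std_gauss: "prob_space (std_gauss :: 'a::euclidean_space measure)"
  by (rule prob_spaceI) (simp add: std_gauss_def emeasure_density nn_integral_gauss_density)

interpretation std_gauss: prob_space "std_gauss :: 'a::euclidean_space measure"
  by (rule prob_space_std_gauss)

interpretation std_gauss_pair: pair_sigma_finite "std_gauss :: 'a::euclidean_space measure"
  "std_gauss :: 'b::euclidean_space measure" ..

lemma measure_std_gauss_UNIV [simp]: "measure (std_gauss :: 'a::euclidean_space measure) UNIV = 1"
  using std_gauss.prob_space by simp

lemma nn_integral_std_gauss:
  assumes [measurable]: "f \<in> borel_measurable borel"
  shows "(\<integral>\<^sup>+x. f x \<partial>std_gauss) = (\<integral>\<^sup>+x. ennreal (gauss_density x) * f x \<partial>lborel)"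
  unfolding std_gauss_def by (subst nn_integral_density) auto

lemma std_gaussian_eq: "std_gaussian = (std_gauss :: (real^'n) measure)"
proof -
  have "(\<Prod>i\<in>UNIV. std_normal_density (x $ i)) = gauss_density x" for x :: "real^'n"
    unfolding gauss_density_def Basis_vec_def
    by (simp add: UNION_singleton_eq_range prod.reindex axis_eq_axis inj_on_def inner_axis)
  then show ?thesis by (simp add: std_gaussian_def std_gauss_def)
qed

lemma std_gauss_prod:
  "std_gauss \<Otimes>\<^sub>M std_gauss = (std_gauss :: ('a::euclidean_space \<times> 'b::euclidean_space) measure)"
proof -
  have dens: "ennreal (gauss_density x) * ennreal (gauss_density y) = ennreal (gauss_density (x, y))"
    for x :: 'a and y :: 'b
    by (simp add: gauss_density_eq norm_prod_def ennreal_mult[symmetric] power_add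
        exp_add[symmetric] field_simps)
  have "std_gauss \<Otimes>\<^sub>M std_gauss =
      density (lborel \<Otimes>\<^sub>M lborel) (\<lambda>(x::'a, y::'b). ennreal (gauss_density x) * ennreal (gauss_density y))"
    unfolding std_gauss_def
    by (rule pair_measure_density)
      (auto simp: std_gauss.sigma_finite_measure_axioms[unfolded std_gauss_def] lborel.sigma_finite_measure_axioms)
  also have "\<dots> = std_gauss"
    by (simp add: std_gauss_def lborel_prod dens case_prod_unfold)
  finally show ?thesis .
qed

lemma linear_borel_measurable:
  fixes T :: "'a::euclidean_space \<Rightarrow> 'b::euclidean_space"
  assumes "linear T" shows "T \<in> borel_measurable borel"
  using assms by (intro borel_measurable_continuous_onI linear_continuous_on) (simp add: linear_conv_bounded_linear)

lemma borel_measurable_fst_snd [measurable]: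
  "fst \<in> borel_measurable (borel :: ('a::euclidean_space \<times> 'b::euclidean_space) measure)"
  "snd \<in> borel_measurable (borel :: ('a::euclidean_space \<times> 'b::euclidean_space) measure)"
  by (simp_all add: linear_borel_measurable linear_fst linear_snd)

lemma distr_std_gauss_snd:
  "distr (std_gauss :: ('a::euclidean_space \<times> 'b::euclidean_space) measure) borel snd = std_gauss"
proof (rule measure_eqI)
  fix A :: "'b set" assume A: "A \<in> sets (distr (std_gauss :: ('a \<times> 'b) measure) borel snd)"
  then have "emeasure (distr (std_gauss :: ('a \<times> 'b) measure) borel snd) A =
      emeasure (std_gauss \<Otimes>\<^sub>M std_gauss :: ('a \<times> 'b) measure) (UNIV \<times> A)"
    unfolding std_gauss_prod
    by (subst emeasure_distr) (auto intro!: arg_cong2[where f = emeasure])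
  also have "\<dots> = emeasure std_gauss A"
    using A std_gauss.emeasure_space_1[where 'a = 'a]
    by (subst std_gauss.emeasure_pair_measure_Times) simp_all
  finally show "emeasure (distr (std_gauss :: ('a \<times> 'b) measure) borel snd) A = emeasure std_gauss A" .
qed simp

lemma nn_integral_lborel_shift:
  fixes c :: "'a::euclidean_space"
  assumes [measurable]: "f \<in> borel_measurable borel"
  shows "(\<integral>\<^sup>+x. f (c + x) \<partial>lborel) = (\<integral>\<^sup>+x. f x \<partial>lborel)"
  by (subst (2) lborel_distr_plus[symmetric, of c]) (subst nn_integral_distr; simp)

text \<open>The factor is not needed explicitly, so translation invariance of \<^const>\<open>lborel\<close> suffices and no
  determinant appears.\<close>

lemma nn_integral_lborel_linear:
  fixes T :: "'a::euclidean_space \<Rightarrow> 'a"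
  assumes T: "linear T" "surj T" and [measurable]: "h \<in> borel_measurable borel"
  shows "(\<integral>\<^sup>+x. h (T x) \<partial>lborel) = (\<integral>\<^sup>+x. gauss_density (T x) \<partial>lborel) * (\<integral>\<^sup>+x. h x \<partial>lborel)"
proof -
  note [measurable] = linear_borel_measurable[OF T(1)]
  define R where "R = inv T"
  have [simp]: "T (R y) = y" for y unfolding R_def by (rule surj_f_inv_f[OF T(2)])
  note [simp] = linear_add[OF T(1)]
  let ?k = "\<lambda>x::'a. ennreal (gauss_density x)"
  have "(\<integral>\<^sup>+x. h (T x) \<partial>lborel) = (\<integral>\<^sup>+x. (\<integral>\<^sup>+y. h (T x) * ?k y \<partial>lborel) \<partial>lborel)"
    by (simp add: nn_integral_cmult nn_integral_gauss_density)
  also have "\<dots> = (\<integral>\<^sup>+x. (\<integral>\<^sup>+y. h (T x) * ?k (- T x + y) \<partial>lborel) \<partial>lborel)"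
    by (intro nn_integral_cong nn_integral_lborel_shift[symmetric]) simp
  also have "\<dots> = (\<integral>\<^sup>+y. (\<integral>\<^sup>+x. h (T x) * ?k (- T x + y) \<partial>lborel) \<partial>lborel)"
    by (rule lborel_pair.Fubini'[symmetric]) measurable
  also have "\<dots> = (\<integral>\<^sup>+y. (\<integral>\<^sup>+x. h (T (R y + x)) * ?k (- T (R y + x) + y) \<partial>lborel) \<partial>lborel)"
    by (intro nn_integral_cong nn_integral_lborel_shift[symmetric]) simp
  also have "\<dots> = (\<integral>\<^sup>+y. (\<integral>\<^sup>+x. h (T x + y) * ?k (T x) \<partial>lborel) \<partial>lborel)"
    by (intro nn_integral_cong) (simp add: add.commute gauss_density_cong[of "- T x" "T x" for x])
  also have "\<dots> = (\<integral>\<^sup>+x. (\<integral>\<^sup>+y. h (T x + y) * ?k (T x) \<partial>lborel) \<partial>lborel)"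
    by (rule lborel_pair.Fubini') measurable
  also have "\<dots> = (\<integral>\<^sup>+x. (\<integral>\<^sup>+y. h y \<partial>lborel) * ?k (T x) \<partial>lborel)"
    by (intro nn_integral_cong) (simp add: nn_integral_multc nn_integral_lborel_shift)
  finally show ?thesis by (simp add: nn_integral_cmult mult.commute)
qed

lemma distr_std_gauss_orthogonal:
  fixes T :: "'a::euclidean_space \<Rightarrow> 'a"
  assumes T: "orthogonal_transformation T"
  shows "distr std_gauss borel T = std_gauss"
proof (rule measure_eqI)
  have lin: "linear T" "surj T"
    using T orthogonal_transformation_surj by (auto intro: orthogonal_transformation_linear)
  note [measurable] = linear_borel_measurable[OF lin(1)]
  have dens: "gauss_density (T x) = gauss_density x" for x
    using T by (intro gauss_density_cong) (simp add: orthogonal_transformation)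
  fix A assume "A \<in> sets (distr std_gauss borel T)"
  then have [measurable]: "A \<in> sets borel" by simp
  have "emeasure (distr std_gauss borel T) A = (\<integral>\<^sup>+x. indicator A (T x) \<partial>std_gauss)"
    by (subst nn_integral_indicator[symmetric], simp) (subst nn_integral_distr; simp)
  also have "\<dots> = (\<integral>\<^sup>+x. ennreal (gauss_density (T x)) * indicator A (T x) \<partial>lborel)"
    by (subst nn_integral_std_gauss) (simp_all add: dens)
  also have "\<dots> = (\<integral>\<^sup>+x. ennreal (gauss_density x) * indicator A x \<partial>lborel)"
    using nn_integral_lborel_linear[OF lin, of "\<lambda>x. ennreal (gauss_density x) * indicator A x"]
    by (simp add: dens nn_integral_gauss_density)
  also have "\<dots> = emeasure std_gauss A"
    by (simp add: std_gauss_def emeasure_density)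
  finally show "emeasure (distr std_gauss borel T) A = emeasure std_gauss A" .
qed simp

text \<open>A coisometry is the second component of a rotation of the product space.\<close>

lemma distr_std_gauss_coisometry:
  fixes T :: "'a::euclidean_space \<Rightarrow> 'b::euclidean_space"
  assumes T: "linear T" and coiso: "\<And>y. T (adjoint T y) = y"
  shows "distr std_gauss borel T = std_gauss"
proof -
  define R where "R p = (fst p - adjoint T (T (fst p)) + adjoint T (snd p), T (fst p))" for p
  note lin = linear_add[OF T] linear_scale[OF T] linear_add[OF adjoint_linear[OF T]]
    linear_scale[OF adjoint_linear[OF T]]
  have adj: "adjoint T y \<bullet> x = y \<bullet> T x" "x \<bullet> adjoint T y = T x \<bullet> y" for x y
    using adjoint_works[OF T, of x y] by (simp_all add: inner_commute)
  have "linear R"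
    by (rule linearI) (simp_all add: R_def lin algebra_simps)
  moreover have "norm (R p) = norm p" for p
    by (simp add: norm_eq R_def inner_prod_def inner_add_left inner_add_right inner_diff_left
        inner_diff_right adj coiso inner_commute)
  ultimately have R: "orthogonal_transformation R" by (simp add: orthogonal_transformation)
  note [measurable] = linear_borel_measurable[OF T] linear_borel_measurable[OF \<open>linear R\<close>]
  have "std_gauss = distr (distr std_gauss borel R) borel snd"
    by (simp add: distr_std_gauss_orthogonal[OF R] distr_std_gauss_snd)
  also have "\<dots> = distr std_gauss borel (\<lambda>p :: 'a \<times> 'b. T (fst p))"
    by (subst distr_distr) (simp_all add: o_def R_def)
  also have "\<dots> = distr (distr (std_gauss \<Otimes>\<^sub>M (std_gauss :: 'b measure)) std_gauss fst) borel T"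
    by (subst distr_distr) (simp_all add: std_gauss_prod o_def cong: measurable_cong_sets)
  also have "\<dots> = distr std_gauss borel T" by (simp only: std_gauss.distr_pair_fst)
  finally show ?thesis by simp
qed

lemma gaussian_measure_eq:
  "gaussian_measure m Q = distr std_gauss borel (\<lambda>x. m + msqrt Q *v x)"
  by (simp add: gaussian_measure_def std_gaussian_eq)

lemma borel_measurable_matrix_vector_mult [measurable]: "(*v) M \<in> borel_measurable borel" for M :: "real^'n^'n"
  by (rule linear_borel_measurable) (simp add: matrix_vector_mul_linear)

lemma distr_std_gauss_eq_gaussian_measure:
  fixes T :: "'w::euclidean_space \<Rightarrow> real^'n"
  assumes Q: "pos_def Q" and T: "linear T" and cov: "\<And>b. T (adjoint T b) = Q *v b"
  shows "distr std_gauss borel (\<lambda>w. m + T w) = gaussian_measure m Q"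
proof -
  note psd = pos_def_imp_pos_semidef[OF Q]
  define S where "S = msqrt Q"
  define R where "R = matrix_inv S"
  have SR: "S ** R = mat 1" "R ** S = mat 1"
    unfolding R_def S_def by (rule matrix_inv_invertible[OF invertible_msqrt[OF Q]])+
  have QS: "Q = S ** S" by (simp add: S_def msqrt_mult_self[OF psd])
  have "S ** transpose R = mat 1"
    using arg_cong[OF SR(2), of transpose] by (simp add: matrix_transpose_mul S_def transpose_msqrt[OF psd])
  note [measurable] = linear_borel_measurable[OF T]
  have "adjoint (\<lambda>w. R *v T w) = (\<lambda>b. adjoint T (transpose R *v b))"
    by (rule adjoint_unique) (simp add: inner_matrix_vector_left adjoint_works[OF T])
  moreover have "R *v (Q *v (transpose R *v b)) = (R ** S) *v ((S ** transpose R) *v b)" for b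
    by (simp only: QS matrix_vector_mul_assoc matrix_mul_assoc)
  ultimately have "distr std_gauss borel (\<lambda>w. R *v T w) = std_gauss"
    using linear_compose[OF T matrix_vector_mul_linear, of R]
    by (intro distr_std_gauss_coisometry) (simp_all add: cov o_def SR \<open>S ** transpose R = mat 1\<close>)
  then have "gaussian_measure m Q = distr (distr std_gauss borel (\<lambda>w. R *v T w)) borel (\<lambda>x. m + S *v x)"
    by (simp add: gaussian_measure_eq S_def)
  also have "\<dots> = distr std_gauss borel (\<lambda>w. m + T w)"
    by (subst distr_distr) (auto simp: o_def matrix_vector_mul_assoc SR)
  finally show ?thesis ..
qed

lemma absolutely_continuous_gaussian_measure:
  fixes Q :: "real^'n^'n"
  assumes Q: "pos_def Q"
  shows "absolutely_continuous lborel (gaussian_measure m Q)"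
  unfolding absolutely_continuous_def
proof safe
  fix N :: "(real^'n) set" assume N: "N \<in> null_sets lborel"
  then have [measurable]: "N \<in> sets borel" by auto
  have "surj ((*v) (msqrt Q))"
    using invertible_msqrt[OF Q] by (simp add: invertible_right_inverse matrix_right_invertible_surjective)
  then have "(\<integral>\<^sup>+x. indicator N (m + msqrt Q *v x) \<partial>lborel) =
      (\<integral>\<^sup>+x. gauss_density (msqrt Q *v x) \<partial>lborel) * (\<integral>\<^sup>+x. indicator N (m + x) \<partial>lborel)"
    by (intro nn_integral_lborel_linear[where h = "\<lambda>x. indicator N (m + x)"]) (simp_all add: matrix_vector_mul_linear)
  also have "(\<integral>\<^sup>+x. indicator N (m + x) \<partial>lborel) = 0"
    using null_setsD1[OF N] by (subst nn_integral_lborel_shift) simp_all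
  finally have "AE x in lborel. m + msqrt Q *v x \<notin> N"
    by (subst (asm) mult_zero_right, subst (asm) nn_integral_0_iff_AE) (auto simp: indicator_def)
  then have "AE x in std_gauss. m + msqrt Q *v x \<notin> N"
    unfolding std_gauss_def by (subst AE_density) auto
  then show "N \<in> null_sets (gaussian_measure m Q)"
    unfolding gaussian_measure_eq by (subst null_sets_distr_iff) (auto simp: AE_iff_null_sets vimage_def)
qed

lemma integrable_std_gauss_exp_square: "integrable std_gauss (\<lambda>x::'a::euclidean_space. exp ((norm x)\<^sup>2 / 4))"
proof (rule integrableI_nonneg)
  let ?c = "1 / sqrt 2"
  have "(\<integral>\<^sup>+x. ennreal (exp ((norm x)\<^sup>2 / 4)) \<partial>(std_gauss::'a measure)) =
      (\<integral>\<^sup>+x. ennreal (gauss_density (?c *\<^sub>R x :: 'a)) \<partial>lborel)"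
    by (subst nn_integral_std_gauss, simp, intro nn_integral_cong)
      (simp add: gauss_density_eq ennreal_mult[symmetric] exp_add[symmetric] power_mult_distrib mult.assoc power_divide)
  also have "\<dots> < \<infinity>"
  proof -
    have "ennreal (\<bar>?c\<bar> ^ DIM('a)) * (\<integral>\<^sup>+x. ennreal (gauss_density (?c *\<^sub>R x :: 'a)) \<partial>lborel) = 1"
      unfolding nn_integral_gauss_density[where 'a = 'a, symmetric]
      by (subst (2) lborel_affine[of ?c "0::'a"])
        (simp_all add: nn_integral_density nn_integral_distr nn_integral_cmult)
    then show ?thesis by (cases "(\<integral>\<^sup>+x. ennreal (gauss_density (?c *\<^sub>R x :: 'a)) \<partial>lborel) = \<top>")
        (simp_all add: ennreal_mult_top less_top)
  qed
  finally show "(\<integral>\<^sup>+x. ennreal (exp ((norm x)\<^sup>2 / 4)) \<partial>(std_gauss::'a measure)) < \<infinity>" .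
qed auto

lemma integrable_std_gauss_exp: "integrable std_gauss (\<lambda>x::'a::euclidean_space. exp (c * norm x))"
proof (rule Bochner_Integration.integrable_bound)
  show "integrable std_gauss (\<lambda>x::'a. exp (c\<^sup>2) * exp ((norm x)\<^sup>2 / 4))"
    by (intro integrable_mult_right integrable_std_gauss_exp_square)
  have "c * t \<le> c\<^sup>2 + t\<^sup>2 / 4" for t
    using zero_le_power2[of "c - t / 2"] by (simp add: power2_eq_square algebra_simps)
  then show "AE x in std_gauss. norm (exp (c * norm (x::'a))) \<le> norm (exp (c\<^sup>2) * exp ((norm x)\<^sup>2 / 4))"
    by (simp add: exp_add[symmetric])
qed simp

lemma power_le_fact_exp:
  fixes y :: real assumes "0 \<le> y" shows "y ^ n \<le> fact n * exp y"
proof -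
  have "y ^ n / fact n \<le> exp y"
    using sum_le_suminf[OF sums_summable[OF exp_converges[of y]], of "{n}"] assms
    by (simp add: exp_def divide_inverse mult.commute)
  then show ?thesis by (simp add: field_simps)
qed

lemma integrable_std_gauss_power_exp:
  "integrable std_gauss (\<lambda>x::'a::euclidean_space. (1 + norm x) ^ n * exp (c * norm x))"
proof (rule Bochner_Integration.integrable_bound)
  show "integrable std_gauss (\<lambda>x::'a. fact n * exp 1 * exp ((1 + c) * norm x))"
    by (intro integrable_mult_right integrable_std_gauss_exp)
  have "(1 + r) ^ n * exp (c * r) \<le> fact n * exp 1 * exp ((1 + c) * r)" if "0 \<le> r" for r
    using mult_right_mono[OF power_le_fact_exp[of "1 + r" n], of "exp (c * r)"] that
    by (simp add: exp_add[symmetric] mult.assoc algebra_simps)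
  then show "AE x in std_gauss. norm ((1 + norm (x::'a)) ^ n * exp (c * norm x))
      \<le> norm (fact n * exp 1 * exp ((1 + c) * norm x))"
    by simp
qed simp

lemma integrable_std_gauss_power: "integrable std_gauss (\<lambda>x::'a::euclidean_space. (1 + norm x) ^ n)"
  using integrable_std_gauss_power_exp[of n 0] by simp

lemma integrable_std_gauss_inner: "integrable std_gauss (\<lambda>x::'a::euclidean_space. c \<bullet> x)"
proof (rule Bochner_Integration.integrable_bound)
  show "integrable std_gauss (\<lambda>x::'a. norm c * (1 + norm x) ^ 1)"
    by (intro integrable_mult_right integrable_std_gauss_power)
  have "norm (c \<bullet> x) \<le> norm (norm c * (1 + norm x) ^ 1)" for x
    using Cauchy_Schwarz_ineq2[of c x] by (simp add: distrib_left add_increasing)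
  then show "AE x in std_gauss. norm (c \<bullet> x) \<le> norm (norm c * (1 + norm x) ^ 1)" by simp
qed simp

lemma integral_std_gauss_inner: "(\<integral>x. c \<bullet> x \<partial>std_gauss) = 0" for c :: "'a::euclidean_space"
proof -
  have "distr std_gauss borel (\<lambda>x::'a. - x) = std_gauss"
    by (rule distr_std_gauss_orthogonal) (simp add: orthogonal_transformation linear_uminus)
  then have "(\<integral>x. c \<bullet> x \<partial>std_gauss) = (\<integral>x. c \<bullet> x \<partial>distr std_gauss borel (\<lambda>x::'a. - x))" by simp
  also have "\<dots> = (\<integral>x. c \<bullet> (- x) \<partial>std_gauss)" by (rule integral_distr) simp_all
  finally show ?thesis by simp
qed

lemma has_bochner_integral_std_gauss_inner_square:
  "has_bochner_integral std_gauss (\<lambda>x. (c \<bullet> x)\<^sup>2) ((norm c)\<^sup>2)" for c :: "'a::euclidean_space"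
proof (cases "c = 0")
  case False
  define u where "u = (1 / norm c) *\<^sub>R c"
  have u: "u \<bullet> u = 1" "c \<bullet> x = norm c * (u \<bullet> x)" for x
    using False by (simp_all add: u_def power2_norm_eq_inner[symmetric] power2_eq_square)
  have "adjoint (\<lambda>x. u \<bullet> x) = (\<lambda>r. r *\<^sub>R u)"
    by (rule adjoint_unique) (simp add: inner_commute)
  then have law: "distr std_gauss borel (\<lambda>x. u \<bullet> x) = std_gauss"
    using u(1) by (intro distr_std_gauss_coisometry) (simp_all add: bounded_linear.linear bounded_linear_inner_right)
  have "has_bochner_integral (density lborel std_normal_density) (\<lambda>y. y\<^sup>2) 1"
    using std_normal_moment_even[of 1] by (intro has_bochner_integral_density) (simp_all add: fact_2)
  then have "has_bochner_integral (distr std_gauss borel (\<lambda>x. u \<bullet> x)) (\<lambda>y. y\<^sup>2) 1"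
    unfolding law by (simp add: std_gauss_def gauss_density_def)
  then have "has_bochner_integral std_gauss (\<lambda>x. (u \<bullet> x)\<^sup>2) 1"
    by (simp add: has_bochner_integral_iff integrable_distr_eq integral_distr)
  then have "has_bochner_integral std_gauss (\<lambda>x. (norm c)\<^sup>2 * (u \<bullet> x)\<^sup>2) ((norm c)\<^sup>2 * 1)"
    by (rule has_bochner_integral_mult_right)
  then show ?thesis by (simp add: u(2) power_mult_distrib)
qed (simp add: has_bochner_integral_zero)

section \<open>Gaussian averages\<close>

definition borel_between :: "real \<Rightarrow> real \<Rightarrow> ('a::topological_space \<Rightarrow> real) \<Rightarrow> bool" where
  "borel_between e M F \<longleftrightarrow> F \<in> borel_measurable borel \<and> (\<forall>x. e \<le> F x \<and> F x \<le> M)"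

lemma borel_betweenD:
  assumes "borel_between e M F"
  shows "F \<in> borel_measurable borel" "e \<le> F x" "F x \<le> M" "\<bar>F x\<bar> \<le> \<bar>e\<bar> + \<bar>M\<bar>"
proof -
  show "F \<in> borel_measurable borel" "e \<le> F x" "F x \<le> M" using assms by (auto simp: borel_between_def)
  then show "\<bar>F x\<bar> \<le> \<bar>e\<bar> + \<bar>M\<bar>" by linarith
qed

definition gauss_avg :: "('w::euclidean_space \<Rightarrow> 'a::euclidean_space) \<Rightarrow> real \<Rightarrow>
    ('a \<Rightarrow> 'b::{banach, second_countable_topology}) \<Rightarrow> 'a \<Rightarrow> 'b" where
  "gauss_avg T h F x = (\<integral>w. F (x + h *\<^sub>R T w) \<partial>std_gauss)"

lemma integrable_std_gauss_bounded:
  fixes f :: "'a::euclidean_space \<Rightarrow> 'b::{banach, second_countable_topology}"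
  assumes "f \<in> borel_measurable borel" "\<And>x. norm (f x) \<le> K"
  shows "integrable std_gauss f"
  using assms by (intro std_gauss.integrable_const_bound[of _ K]) auto

lemma integrable_gauss_avg:
  fixes F :: "'a::euclidean_space \<Rightarrow> 'b::{banach, second_countable_topology}"
  assumes [measurable]: "F \<in> borel_measurable borel" "T \<in> borel_measurable borel"
    and F: "\<And>x. norm (F x) \<le> K"
  shows "integrable std_gauss (\<lambda>w. F (x + h *\<^sub>R T w))"
  using F by (intro integrable_std_gauss_bounded) auto

lemma integrable_borel_between:
  fixes F :: "'a::euclidean_space \<Rightarrow> real"
  assumes "borel_between e M F" "T \<in> borel_measurable borel"
  shows "integrable std_gauss (\<lambda>w. F (x + h *\<^sub>R T w))"
  using borel_betweenD[OF assms(1)] assms(2)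
  by (intro integrable_gauss_avg[where K = "\<bar>e\<bar> + \<bar>M\<bar>"]) auto

lemma borel_measurable_integral_std_gauss:
  fixes f :: "'a::euclidean_space \<Rightarrow> 'b::euclidean_space \<Rightarrow> 'c::{banach, second_countable_topology}"
  assumes "(\<lambda>(x, y). f x y) \<in> borel_measurable (borel \<Otimes>\<^sub>M borel)"
  shows "(\<lambda>x. \<integral>y. f x y \<partial>std_gauss) \<in> borel_measurable borel"
  using assms by (intro std_gauss.borel_measurable_lebesgue_integral) simp

lemma borel_measurable_gauss_avg [measurable]:
  assumes [measurable]: "F \<in> borel_measurable borel" "T \<in> borel_measurable borel"
  shows "gauss_avg T h F \<in> borel_measurable borel"
  unfolding gauss_avg_def[abs_def] by (rule borel_measurable_integral_std_gauss) measurable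

lemma borel_between_gauss_avg:
  assumes F: "borel_between e M F" and T: "T \<in> borel_measurable borel"
  shows "borel_between e M (gauss_avg T h F)"
  using borel_betweenD[OF F] T integrable_borel_between[OF F T] unfolding borel_between_def gauss_avg_def
  by (auto intro!: borel_measurable_gauss_avg[unfolded gauss_avg_def[abs_def]]
      std_gauss.integral_ge_const std_gauss.integral_le_const)

lemma gauss_avg_scale_zero: "gauss_avg T 0 F x = F x"
  by (simp add: gauss_avg_def)

text \<open>A Gaussian vector with variance \<open>c\<^sup>2 = a\<^sup>2 + b\<^sup>2\<close> is the sum of independent ones with variances
  \<open>a\<^sup>2\<close> and \<open>b\<^sup>2\<close>.\<close>

lemma gauss_avg_semigroup:
  fixes T :: "'w::euclidean_space \<Rightarrow> 'a::euclidean_space"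
  assumes F: "borel_between e M F" and T: "linear T" and c: "c\<^sup>2 = a\<^sup>2 + b\<^sup>2" "0 < c"
  shows "gauss_avg T c F x = gauss_avg T a (gauss_avg T b F) x"
proof -
  note [measurable] = linear_borel_measurable[OF T] borel_betweenD(1)[OF F]
  define R where "R p = (a / c) *\<^sub>R fst p + (b / c) *\<^sub>R snd p" for p :: "'w \<times> 'w"
  have lin: "linear R" by (rule linearI) (simp_all add: R_def algebra_simps)
  note [measurable] = linear_borel_measurable[OF lin]
  have "adjoint R = (\<lambda>w. ((a / c) *\<^sub>R w, (b / c) *\<^sub>R w))"
    by (rule adjoint_unique) (simp add: R_def inner_prod_def inner_add_left inner_add_right)
  moreover have "(a / c) * (a / c) + (b / c) * (b / c) = 1"
    using c(2) by (simp add: power2_eq_square[symmetric] power_divide add_divide_distrib[symmetric] c(1)[symmetric])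
  ultimately have "distr std_gauss borel R = std_gauss"
    using lin by (intro distr_std_gauss_coisometry) (simp_all add: R_def scaleR_add_left[symmetric])
  then have "gauss_avg T c F x = (\<integral>w. F (x + c *\<^sub>R T w) \<partial>distr std_gauss borel R)"
    by (simp add: gauss_avg_def)
  also have "\<dots> = (\<integral>p. F (x + c *\<^sub>R T (R p)) \<partial>std_gauss)"
    by (rule integral_distr) simp_all
  also have "(\<lambda>p. F (x + c *\<^sub>R T (R p))) = (\<lambda>(w, w'). F ((x + a *\<^sub>R T w) + b *\<^sub>R T w'))"
    using c(2) by (auto simp: fun_eq_iff R_def linear_add[OF T] linear_scale[OF T] scaleR_add_right add.assoc)
  also have "integral\<^sup>L std_gauss \<dots> = gauss_avg T a (gauss_avg T b F) x"
    unfolding gauss_avg_def std_gauss_prod[symmetric]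
  proof (rule std_gauss_pair.integral_fst[symmetric])
    show "integrable (std_gauss \<Otimes>\<^sub>M std_gauss) (\<lambda>(w, w'). F ((x + a *\<^sub>R T w) + b *\<^sub>R T w'))"
      unfolding std_gauss_prod using borel_betweenD(4)[OF F]
      by (intro integrable_std_gauss_bounded[where K = "\<bar>e\<bar> + \<bar>M\<bar>"]) (auto simp: case_prod_unfold)
  qed
  finally show ?thesis .
qed

lemma gauss_avg_tendsto:
  fixes Fs :: "nat \<Rightarrow> 'a::euclidean_space \<Rightarrow> real"
  assumes Fs: "\<And>n. borel_between e M (Fs n)" and [measurable]: "F \<in> borel_measurable borel" "T \<in> borel_measurable borel"
    and lim: "AE w in std_gauss. (\<lambda>n. Fs n (x + h *\<^sub>R T w)) \<longlonglongrightarrow> F (x + h *\<^sub>R T w)"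
  shows "(\<lambda>n. gauss_avg T h (Fs n) x) \<longlonglongrightarrow> gauss_avg T h F x"
  unfolding gauss_avg_def
proof (rule integral_dominated_convergence[where w = "\<lambda>_. \<bar>e\<bar> + \<bar>M\<bar>"])
  note [measurable] = borel_betweenD(1)[OF Fs]
  show "(\<lambda>w. Fs n (x + h *\<^sub>R T w)) \<in> borel_measurable std_gauss" for n by measurable
qed (use lim borel_betweenD(4)[OF Fs] in auto)

text \<open>\<open>a\<close> plays the role of the gradient of \<open>F\<close>; keeping it as data makes the class stable under averaging
  without differentiating under the integral.\<close>

definition C11_bounded :: "real \<Rightarrow> real \<Rightarrow> real \<Rightarrow> ('a::euclidean_space \<Rightarrow> real) \<Rightarrow> ('a \<Rightarrow> 'a) \<Rightarrow> bool" where
  "C11_bounded e M L F a \<longleftrightarrow> borel_between e M F \<and> a \<in> borel_measurable borel \<and>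
     (\<forall>x z. \<bar>F (x + z) - F x - a x \<bullet> z\<bar> \<le> L * (norm z)\<^sup>2)"

lemma C11_boundedD:
  assumes "C11_bounded e M L F a"
  shows "borel_between e M F" "a \<in> borel_measurable borel"
    "\<bar>F (x + z) - F x - a x \<bullet> z\<bar> \<le> L * (norm z)\<^sup>2"
  using assms by (auto simp: C11_bounded_def)

lemma C11_bounded_mono:
  assumes "C11_bounded e M L F a" "L \<le> L'"
  shows "C11_bounded e M L' F a"
  unfolding C11_bounded_def
  using C11_boundedD[OF assms(1)] assms(2) by (meson mult_right_mono order_trans zero_le_power2)

lemma C11_bounded_nonneg:
  assumes "C11_bounded e M L (F :: 'a::euclidean_space \<Rightarrow> real) a"
  shows "0 \<le> L"
proof -
  obtain z :: 'a where "norm z = 1" using vector_choose_size[of 1] by auto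
  then show ?thesis using C11_boundedD(3)[OF assms, of 0 z] by simp
qed

lemma C11_bounded_norm_gradient_le:
  assumes C: "C11_bounded e M L F a"
  shows "norm (a x) \<le> M - e + L"
proof (cases "a x = 0")
  case True
  then show ?thesis
    using C11_bounded_nonneg[OF C] borel_betweenD(2,3)[OF C11_boundedD(1)[OF C], of x] by simp
next
  case False
  define z where "z = (1 / norm (a x)) *\<^sub>R a x"
  have "a x \<bullet> z = norm (a x)" "norm z = 1"
    using False by (simp_all add: z_def dot_square_norm power2_eq_square)
  then have "\<bar>F (x + z) - F x - norm (a x)\<bar> \<le> L" using C11_boundedD(3)[OF C, of x z] by simp
  moreover have "F (x + z) - F x \<le> M - e"
    using borel_betweenD(2,3)[OF C11_boundedD(1)[OF C]] by (intro diff_mono)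
  ultimately show ?thesis by linarith
qed

lemma C11_bounded_gauss_avg:
  fixes T :: "'w::euclidean_space \<Rightarrow> 'a::euclidean_space"
  assumes C: "C11_bounded e M L F a" and T [measurable]: "T \<in> borel_measurable borel"
  shows "C11_bounded e M L (gauss_avg T h F) (gauss_avg T h a)"
proof -
  note F = C11_boundedD[OF C]
  note [measurable] = F(2) borel_betweenD(1)[OF F(1)]
  have iF [simp]: "integrable std_gauss (\<lambda>w. F (x + h *\<^sub>R T w))" for x
    using F(1) by (rule integrable_borel_between) simp
  have ia [simp]: "integrable std_gauss (\<lambda>w. a (x + h *\<^sub>R T w))" for x
    by (rule integrable_gauss_avg) (auto intro: C11_bounded_norm_gradient_le[OF C])
  have "\<bar>gauss_avg T h F (x + z) - gauss_avg T h F x - gauss_avg T h a x \<bullet> z\<bar> \<le> L * (norm z)\<^sup>2" for x z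
  proof -
    let ?r = "\<lambda>w. F (x + z + h *\<^sub>R T w) - F (x + h *\<^sub>R T w) - a (x + h *\<^sub>R T w) \<bullet> z"
    have "\<bar>?r w\<bar> \<le> L * (norm z)\<^sup>2" for w
      using F(3)[of "x + h *\<^sub>R T w" z] by (simp add: add_ac)
    then have "(\<integral>w. \<bar>?r w\<bar> \<partial>std_gauss) \<le> L * (norm z)\<^sup>2"
      by (intro std_gauss.integral_le_const) auto
    moreover have "gauss_avg T h F (x + z) - gauss_avg T h F x - gauss_avg T h a x \<bullet> z = (\<integral>w. ?r w \<partial>std_gauss)"
      by (simp add: gauss_avg_def)
    ultimately show ?thesis using integral_abs_bound[of std_gauss ?r] by simp
  qed
  then show ?thesis
    using borel_between_gauss_avg[OF F(1) T] by (simp add: C11_bounded_def)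
qed

section \<open>A Hoelder-type inequality for Gaussian pairs\<close>

definition hoelder_form :: "real \<Rightarrow> real \<Rightarrow> real \<Rightarrow> real \<Rightarrow> real" where
  "hoelder_form \<alpha> \<beta> s t = (\<alpha> * s + \<beta> * t)\<^sup>2 - \<alpha> * s\<^sup>2 - \<beta> * t\<^sup>2"

definition quotient_power_sum :: "real \<Rightarrow> real \<Rightarrow> real \<Rightarrow> real \<Rightarrow> nat \<Rightarrow> real \<Rightarrow> real" where
  "quotient_power_sum \<alpha> \<beta> s t j \<tau> = \<alpha> * (s / (1 + \<tau> * s)) ^ j + \<beta> * (t / (1 + \<tau> * t)) ^ j"

lemma has_real_derivative_quotient_power_sum:
  assumes "0 < 1 + \<tau> * s" "0 < 1 + \<tau> * t"
  shows "(quotient_power_sum \<alpha> \<beta> s t j has_real_derivative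
    - (real j * quotient_power_sum \<alpha> \<beta> s t (Suc j) \<tau>)) (at \<tau>)"
proof -
  have power: "((\<lambda>\<tau>. (x / (1 + \<tau> * x)) ^ j) has_real_derivative - (real j * (x / (1 + \<tau> * x)) ^ Suc j)) (at \<tau>)"
    if "0 < 1 + \<tau> * x" for x
  proof -
    have "((\<lambda>\<tau>. x / (1 + \<tau> * x)) has_real_derivative - (x / (1 + \<tau> * x))\<^sup>2) (at \<tau>)"
      using that by (auto intro!: derivative_eq_intros simp: power2_eq_square)
    from DERIV_power[OF this, of j] show ?thesis
      by (cases j) (simp_all add: power2_eq_square mult_ac)
  qed
  have "((\<lambda>\<tau>. \<alpha> * (s / (1 + \<tau> * s)) ^ j + \<beta> * (t / (1 + \<tau> * t)) ^ j) has_real_derivative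
      \<alpha> * (- (real j * (s / (1 + \<tau> * s)) ^ Suc j)) + \<beta> * (- (real j * (t / (1 + \<tau> * t)) ^ Suc j))) (at \<tau>)"
    using assms by (intro DERIV_add DERIV_cmult power)
  then show ?thesis by (simp add: quotient_power_sum_def[abs_def] algebra_simps)
qed

lemma abs_quotient_power_sum_le:
  assumes "0 \<le> \<alpha>" "0 \<le> \<beta>" and "\<bar>s / (1 + \<tau> * s)\<bar> \<le> d" "\<bar>t / (1 + \<tau> * t)\<bar> \<le> d"
  shows "\<bar>quotient_power_sum \<alpha> \<beta> s t j \<tau>\<bar> \<le> (\<alpha> + \<beta>) * d ^ j"
proof -
  have "\<bar>quotient_power_sum \<alpha> \<beta> s t j \<tau>\<bar> \<le> \<alpha> * \<bar>s / (1 + \<tau> * s)\<bar> ^ j + \<beta> * \<bar>t / (1 + \<tau> * t)\<bar> ^ j"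
    unfolding quotient_power_sum_def using assms(1,2)
    by (intro order_trans[OF abs_triangle_ineq]) (simp add: abs_mult power_abs)
  also have "\<dots> \<le> \<alpha> * d ^ j + \<beta> * d ^ j"
    using assms by (intro add_mono mult_left_mono power_mono) auto
  finally show ?thesis by (simp add: algebra_simps)
qed

definition third_derivative_factor :: "(nat \<Rightarrow> real) \<Rightarrow> real" where
  "third_derivative_factor S = S 1 ^ 3 - 3 * S 1 * S 2 + 2 * S 3"

lemma abs_third_derivative_factor_le:
  assumes S: "\<And>j. \<bar>S j\<bar> \<le> k * d ^ j" and "0 \<le> k" "0 \<le> d"
  shows "\<bar>third_derivative_factor S\<bar> \<le> (k ^ 3 + 3 * k\<^sup>2 + 2 * k) * d ^ 3"
proof -
  have "\<bar>third_derivative_factor S\<bar> \<le> \<bar>S 1\<bar> ^ 3 + 3 * (\<bar>S 1\<bar> * \<bar>S 2\<bar>) + 2 * \<bar>S 3\<bar>"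
    unfolding third_derivative_factor_def power_abs[symmetric] abs_mult[symmetric] by linarith
  also have "\<dots> \<le> (k * d ^ 1) ^ 3 + 3 * ((k * d ^ 1) * (k * d ^ 2)) + 2 * (k * d ^ 3)"
    using S[of 1] S[of 2] S[of 3] assms(2,3) by (intro add_mono mult_left_mono mult_mono power_mono) auto
  also have "\<dots> = (k ^ 3 + 3 * k\<^sup>2 + 2 * k) * d ^ 3"
    by (simp add: power_mult_distrib power2_eq_square power3_eq_cube algebra_simps)
  finally show ?thesis .
qed

definition segment_powr_prod :: "real \<Rightarrow> real \<Rightarrow> real \<Rightarrow> real \<Rightarrow> real \<Rightarrow> real" where
  "segment_powr_prod \<alpha> \<beta> s t \<tau> = (1 + \<tau> * s) powr \<alpha> * (1 + \<tau> * t) powr \<beta>"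

lemma segment_powr_prod_derivatives:
  fixes \<alpha> \<beta> s t :: real
  defines "\<phi> \<equiv> segment_powr_prod \<alpha> \<beta> s t" and "S \<equiv> quotient_power_sum \<alpha> \<beta> s t"
  assumes pos: "0 < 1 + \<tau> * s" "0 < 1 + \<tau> * t"
  shows "(\<phi> has_real_derivative \<phi> \<tau> * S 1 \<tau>) (at \<tau>)"
    and "((\<lambda>\<tau>. \<phi> \<tau> * S 1 \<tau>) has_real_derivative \<phi> \<tau> * ((S 1 \<tau>)\<^sup>2 - S 2 \<tau>)) (at \<tau>)"
    and "((\<lambda>\<tau>. \<phi> \<tau> * ((S 1 \<tau>)\<^sup>2 - S 2 \<tau>)) has_real_derivative
      \<phi> \<tau> * third_derivative_factor (\<lambda>j. S j \<tau>)) (at \<tau>)"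
proof -
  note [derivative_intros] = has_real_derivative_quotient_power_sum[OF pos, of \<alpha> \<beta>, folded S_def]
  show [derivative_intros]: "(\<phi> has_real_derivative \<phi> \<tau> * S 1 \<tau>) (at \<tau>)"
    unfolding \<phi>_def S_def segment_powr_prod_def[abs_def] quotient_power_sum_def using pos
    by (auto intro!: derivative_eq_intros simp: algebra_simps powr_diff)
  show "((\<lambda>\<tau>. \<phi> \<tau> * S 1 \<tau>) has_real_derivative \<phi> \<tau> * ((S 1 \<tau>)\<^sup>2 - S 2 \<tau>)) (at \<tau>)"
    by (auto intro!: derivative_eq_intros simp: numeral_2_eq_2 algebra_simps)
  show "((\<lambda>\<tau>. \<phi> \<tau> * ((S 1 \<tau>)\<^sup>2 - S 2 \<tau>)) has_real_derivative
      \<phi> \<tau> * third_derivative_factor (\<lambda>j. S j \<tau>)) (at \<tau>)"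
    by (auto intro!: derivative_eq_intros
        simp: third_derivative_factor_def numeral_2_eq_2 numeral_3_eq_3 algebra_simps)
qed

lemma one_plus_mult_between:
  fixes \<tau> :: real
  assumes "m \<le> 1" "1 \<le> R" and "m \<le> 1 + x" "1 + x \<le> R" and "0 \<le> \<tau>" "\<tau> \<le> 1"
  shows "m \<le> 1 + \<tau> * x" "1 + \<tau> * x \<le> R"
  using convex_bound_le[of 1 R "1 + x" "1 - \<tau>" \<tau>] convex_bound_le[of "- 1" "- m" "- (1 + x)" "1 - \<tau>" \<tau>] assms
  by (simp_all add: algebra_simps)

lemma powr_prod_third_order:
  assumes s: "- 1 < s" and t: "- 1 < t"
  obtains \<tau> where "0 < \<tau>" "\<tau> < 1"
    "(1 + s) powr \<alpha> * (1 + t) powr \<beta> = 1 + (\<alpha> * s + \<beta> * t) + hoelder_form \<alpha> \<beta> s t / 2 +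
      segment_powr_prod \<alpha> \<beta> s t \<tau> * third_derivative_factor (\<lambda>j. quotient_power_sum \<alpha> \<beta> s t j \<tau>) / 6"
proof -
  define \<phi> where "\<phi> = segment_powr_prod \<alpha> \<beta> s t"
  define S where "S = quotient_power_sum \<alpha> \<beta> s t"
  have pos: "0 < 1 + \<tau> * x" if "- 1 < x" "0 \<le> \<tau>" "\<tau> \<le> 1" for x \<tau> :: real
    using one_plus_mult_between(1)[of "min 1 (1 + x)" "max 1 (1 + x)" x \<tau>] that
    by (auto intro: less_le_trans)
  define D where "D = (!) [\<phi>, \<lambda>\<tau>. \<phi> \<tau> * S 1 \<tau>, \<lambda>\<tau>. \<phi> \<tau> * ((S 1 \<tau>)\<^sup>2 - S 2 \<tau>),
    \<lambda>\<tau>. \<phi> \<tau> * third_derivative_factor (\<lambda>j. S j \<tau>)]"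
  have "DERIV (D m) \<tau> :> D (Suc m) \<tau>" if "m < 3" and \<tau>: "0 \<le> \<tau>" "\<tau> \<le> 1" for m \<tau>
  proof -
    have "m = 0 \<or> m = 1 \<or> m = 2" using \<open>m < 3\<close> by linarith
    then show ?thesis
      using segment_powr_prod_derivatives[OF pos[OF s \<tau>] pos[OF t \<tau>], of \<alpha> \<beta>]
      by (elim disjE) (simp_all add: D_def \<phi>_def S_def numeral_2_eq_2)
  qed
  then obtain \<tau> where \<tau>: "0 < \<tau>" "\<tau> < 1" and
    taylor: "\<phi> 1 = (\<Sum>m<3. D m 0 / fact m * 1 ^ m) + D 3 \<tau> / fact 3 * 1 ^ 3"
    using Maclaurin[of 1 3 D \<phi>] by (auto simp: D_def)
  have "D 0 0 = 1" "D 1 0 = \<alpha> * s + \<beta> * t" "D 2 0 = hoelder_form \<alpha> \<beta> s t"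
    by (simp_all add: D_def \<phi>_def segment_powr_prod_def S_def quotient_power_sum_def hoelder_form_def)
  moreover have "D 3 \<tau> = \<phi> \<tau> * third_derivative_factor (\<lambda>j. S j \<tau>)"
    by (simp add: D_def)
  moreover have "(\<Sum>m<3. D m 0 / fact m * 1 ^ m) = D 0 0 + D 1 0 + D 2 0 / 2" "fact 3 = (6::real)"
    by (simp_all add: eval_nat_numeral)
  ultimately have "\<phi> 1 = 1 + (\<alpha> * s + \<beta> * t) + hoelder_form \<alpha> \<beta> s t / 2 +
      \<phi> \<tau> * third_derivative_factor (\<lambda>j. S j \<tau>) / 6"
    using taylor by simp
  then show ?thesis by (intro that[OF \<tau>]) (simp add: \<phi>_def segment_powr_prod_def S_def)
qed

lemma third_derivative_segment_powr_prod_le: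
  fixes \<alpha> \<beta> m R :: real
  defines "C \<equiv> R powr \<alpha> * R powr \<beta> * ((\<alpha> + \<beta>) ^ 3 + 3 * (\<alpha> + \<beta>)\<^sup>2 + 2 * (\<alpha> + \<beta>)) / m ^ 3"
  assumes \<alpha>: "0 \<le> \<alpha>" and \<beta>: "0 \<le> \<beta>" and m: "0 < m" "m \<le> 1" "1 \<le> R"
    and s: "m \<le> 1 + s" "1 + s \<le> R" and t: "m \<le> 1 + t" "1 + t \<le> R" and \<tau>: "0 \<le> \<tau>" "\<tau> \<le> 1"
  shows "segment_powr_prod \<alpha> \<beta> s t \<tau> * third_derivative_factor (\<lambda>j. quotient_power_sum \<alpha> \<beta> s t j \<tau>)
    \<le> C * (\<bar>s\<bar> + \<bar>t\<bar>) ^ 3"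
proof -
  define d where "d = (\<bar>s\<bar> + \<bar>t\<bar>) / m"
  let ?T = "third_derivative_factor (\<lambda>j. quotient_power_sum \<alpha> \<beta> s t j \<tau>)"
  note between = one_plus_mult_between[OF m(2,3) _ _ \<tau>]
  have "\<bar>x / (1 + \<tau> * x)\<bar> \<le> d" if "\<bar>x\<bar> \<le> \<bar>s\<bar> + \<bar>t\<bar>" "m \<le> 1 + x" "1 + x \<le> R" for x
    unfolding abs_divide d_def using between[OF that(2,3)] that(1) m by (intro frac_le) auto
  then have "\<bar>quotient_power_sum \<alpha> \<beta> s t j \<tau>\<bar> \<le> (\<alpha> + \<beta>) * d ^ j" for j
    using s t \<alpha> \<beta> by (intro abs_quotient_power_sum_le) auto
  then have "\<bar>?T\<bar> \<le> ((\<alpha> + \<beta>) ^ 3 + 3 * (\<alpha> + \<beta>)\<^sup>2 + 2 * (\<alpha> + \<beta>)) * d ^ 3"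
    using \<alpha> \<beta> m by (intro abs_third_derivative_factor_le) (auto simp: d_def)
  moreover have "segment_powr_prod \<alpha> \<beta> s t \<tau> \<le> R powr \<alpha> * R powr \<beta>"
    unfolding segment_powr_prod_def
    using between[OF s] between[OF t] \<alpha> \<beta> m by (intro mult_mono powr_mono2) auto
  ultimately have "segment_powr_prod \<alpha> \<beta> s t \<tau> * \<bar>?T\<bar> \<le>
      R powr \<alpha> * R powr \<beta> * (((\<alpha> + \<beta>) ^ 3 + 3 * (\<alpha> + \<beta>)\<^sup>2 + 2 * (\<alpha> + \<beta>)) * d ^ 3)"
    by (intro mult_mono) auto
  also have "\<dots> = C * (\<bar>s\<bar> + \<bar>t\<bar>) ^ 3" by (simp add: C_def d_def power_divide)
  finally show ?thesis
    by (rule order_trans[rotated]) (simp add: segment_powr_prod_def mult_left_mono)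
qed

lemma powr_prod_le_quadratic:
  fixes \<alpha> \<beta> m R :: real
  assumes \<alpha>: "0 \<le> \<alpha>" and \<beta>: "0 \<le> \<beta>" and m: "0 < m" "m \<le> 1" "1 \<le> R"
  obtains C where "0 \<le> C" and "\<And>s t. \<lbrakk>m \<le> 1 + s; 1 + s \<le> R; m \<le> 1 + t; 1 + t \<le> R\<rbrakk> \<Longrightarrow>
      (1 + s) powr \<alpha> * (1 + t) powr \<beta> \<le>
        1 + (\<alpha> * s + \<beta> * t) + hoelder_form \<alpha> \<beta> s t / 2 + C * (\<bar>s\<bar> + \<bar>t\<bar>) ^ 3"
proof -
  define C where "C = R powr \<alpha> * R powr \<beta> * ((\<alpha> + \<beta>) ^ 3 + 3 * (\<alpha> + \<beta>)\<^sup>2 + 2 * (\<alpha> + \<beta>)) / m ^ 3"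
  show ?thesis
  proof (rule that[of "C / 6"])
    show "0 \<le> C / 6" using \<alpha> \<beta> m by (simp add: C_def)
    fix s t :: real
    assume s: "m \<le> 1 + s" "1 + s \<le> R" and t: "m \<le> 1 + t" "1 + t \<le> R"
    have "- 1 < s" "- 1 < t" using s t m by auto
    then obtain \<tau> where \<tau>: "0 < \<tau>" "\<tau> < 1" and
      "(1 + s) powr \<alpha> * (1 + t) powr \<beta> = 1 + (\<alpha> * s + \<beta> * t) + hoelder_form \<alpha> \<beta> s t / 2 +
        segment_powr_prod \<alpha> \<beta> s t \<tau> * third_derivative_factor (\<lambda>j. quotient_power_sum \<alpha> \<beta> s t j \<tau>) / 6"
      by (rule powr_prod_third_order)
    with third_derivative_segment_powr_prod_le[OF \<alpha> \<beta> m s t less_imp_le[OF \<tau>(1)] less_imp_le[OF \<tau>(2)]]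
    show "(1 + s) powr \<alpha> * (1 + t) powr \<beta> \<le>
        1 + (\<alpha> * s + \<beta> * t) + hoelder_form \<alpha> \<beta> s t / 2 + C / 6 * (\<bar>s\<bar> + \<bar>t\<bar>) ^ 3"
      unfolding C_def by simp
  qed
qed

lemma hoelder_form_perturb:
  fixes \<alpha> \<beta> c \<zeta> :: real
  assumes \<alpha>: "0 \<le> \<alpha>" and \<beta>: "0 \<le> \<beta>"
    and s: "\<bar>s\<bar> \<le> c * \<zeta>" "\<bar>\<sigma>\<bar> \<le> c * \<zeta>" "\<bar>s - \<sigma>\<bar> \<le> c * \<zeta>\<^sup>2"
    and t: "\<bar>t\<bar> \<le> c * \<zeta>" "\<bar>\<tau>\<bar> \<le> c * \<zeta>" "\<bar>t - \<tau>\<bar> \<le> c * \<zeta>\<^sup>2"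
  shows "hoelder_form \<alpha> \<beta> s t \<le> hoelder_form \<alpha> \<beta> \<sigma> \<tau> + 2 * (((\<alpha> + \<beta>)\<^sup>2 + (\<alpha> + \<beta>)) * c\<^sup>2 * \<zeta> ^ 3)"
proof -
  have square_diff: "\<bar>x\<^sup>2 - y\<^sup>2\<bar> \<le> k\<^sup>2 * (2 * c\<^sup>2 * \<zeta> ^ 3)"
    if "\<bar>x\<bar> \<le> k * (c * \<zeta>)" "\<bar>y\<bar> \<le> k * (c * \<zeta>)" "\<bar>x - y\<bar> \<le> k * (c * \<zeta>\<^sup>2)" for x y k
  proof -
    have "\<bar>x\<^sup>2 - y\<^sup>2\<bar> = \<bar>x - y\<bar> * \<bar>x + y\<bar>" by (simp add: abs_mult[symmetric] power2_eq_square algebra_simps)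
    also have "\<dots> \<le> (k * (c * \<zeta>\<^sup>2)) * (2 * (k * (c * \<zeta>)))"
      using that by (intro mult_mono) auto
    finally show ?thesis by (simp add: power2_eq_square power3_eq_cube mult_ac)
  qed
  have lin: "\<bar>\<alpha> * x + \<beta> * y\<bar> \<le> (\<alpha> + \<beta>) * b" if "\<bar>x\<bar> \<le> b" "\<bar>y\<bar> \<le> b" for x y b
  proof -
    have "\<bar>\<alpha> * x + \<beta> * y\<bar> \<le> \<alpha> * \<bar>x\<bar> + \<beta> * \<bar>y\<bar>"
      using abs_triangle_ineq[of "\<alpha> * x" "\<beta> * y"] \<alpha> \<beta> by (simp add: abs_mult)
    also have "\<dots> \<le> \<alpha> * b + \<beta> * b" using that \<alpha> \<beta> by (intro add_mono mult_left_mono)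
    finally show ?thesis by (simp add: algebra_simps)
  qed
  have "\<bar>\<alpha> * (s - \<sigma>) + \<beta> * (t - \<tau>)\<bar> \<le> (\<alpha> + \<beta>) * (c * \<zeta>\<^sup>2)" by (rule lin[OF s(3) t(3)])
  then have "\<bar>(\<alpha> * s + \<beta> * t)\<^sup>2 - (\<alpha> * \<sigma> + \<beta> * \<tau>)\<^sup>2\<bar> \<le> (\<alpha> + \<beta>)\<^sup>2 * (2 * c\<^sup>2 * \<zeta> ^ 3)"
    using lin[OF s(1) t(1)] lin[OF s(2) t(2)] by (intro square_diff) (simp_all add: algebra_simps)
  moreover have "\<alpha> * (\<sigma>\<^sup>2 - s\<^sup>2) \<le> \<alpha> * (2 * c\<^sup>2 * \<zeta> ^ 3)" "\<beta> * (\<tau>\<^sup>2 - t\<^sup>2) \<le> \<beta> * (2 * c\<^sup>2 * \<zeta> ^ 3)"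
    using square_diff[of s 1 \<sigma>] square_diff[of t 1 \<tau>] s t \<alpha> \<beta> by (auto intro!: mult_left_mono)
  ultimately show ?thesis
    unfolding hoelder_form_def by (simp add: algebra_simps)
qed

lemma powr_prod_le_perturbed_quadratic:
  fixes \<alpha> \<beta> c m R :: real
  assumes \<alpha>: "0 \<le> \<alpha>" and \<beta>: "0 \<le> \<beta>" and c: "0 \<le> c" and m: "0 < m" "m \<le> 1" "1 \<le> R"
  obtains D where "0 \<le> D" and "\<And>s t \<sigma> \<tau> \<zeta>. \<lbrakk>m \<le> 1 + s; 1 + s \<le> R; m \<le> 1 + t; 1 + t \<le> R;
      \<bar>s\<bar> \<le> c * \<zeta>; \<bar>\<sigma>\<bar> \<le> c * \<zeta>; \<bar>s - \<sigma>\<bar> \<le> c * \<zeta>\<^sup>2; \<bar>t\<bar> \<le> c * \<zeta>; \<bar>\<tau>\<bar> \<le> c * \<zeta>; \<bar>t - \<tau>\<bar> \<le> c * \<zeta>\<^sup>2\<rbrakk> \<Longrightarrow>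
      (1 + s) powr \<alpha> * (1 + t) powr \<beta> \<le> 1 + (\<alpha> * s + \<beta> * t) + hoelder_form \<alpha> \<beta> \<sigma> \<tau> / 2 + D * \<zeta> ^ 3"
proof -
  obtain C where C: "0 \<le> C" "\<And>s t. \<lbrakk>m \<le> 1 + s; 1 + s \<le> R; m \<le> 1 + t; 1 + t \<le> R\<rbrakk> \<Longrightarrow>
      (1 + s) powr \<alpha> * (1 + t) powr \<beta> \<le>
        1 + (\<alpha> * s + \<beta> * t) + hoelder_form \<alpha> \<beta> s t / 2 + C * (\<bar>s\<bar> + \<bar>t\<bar>) ^ 3"
    using powr_prod_le_quadratic[OF \<alpha> \<beta> m] by blast
  define D where "D = ((\<alpha> + \<beta>)\<^sup>2 + (\<alpha> + \<beta>)) * c\<^sup>2 + C * (2 * c) ^ 3"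
  show ?thesis
  proof (rule that[of D])
    show "0 \<le> D" using c C(1) \<alpha> \<beta> by (simp add: D_def)
    fix s t \<sigma> \<tau> \<zeta>
    assume between: "m \<le> 1 + s" "1 + s \<le> R" "m \<le> 1 + t" "1 + t \<le> R"
      and s: "\<bar>s\<bar> \<le> c * \<zeta>" "\<bar>\<sigma>\<bar> \<le> c * \<zeta>" "\<bar>s - \<sigma>\<bar> \<le> c * \<zeta>\<^sup>2"
      and t: "\<bar>t\<bar> \<le> c * \<zeta>" "\<bar>\<tau>\<bar> \<le> c * \<zeta>" "\<bar>t - \<tau>\<bar> \<le> c * \<zeta>\<^sup>2"
    have "(\<bar>s\<bar> + \<bar>t\<bar>) ^ 3 \<le> (2 * c * \<zeta>) ^ 3"
      using s(1) t(1) by (intro power_mono) auto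
    then have "C * (\<bar>s\<bar> + \<bar>t\<bar>) ^ 3 \<le> C * (2 * c) ^ 3 * \<zeta> ^ 3"
      using C(1) by (simp add: mult_left_mono power_mult_distrib mult.assoc)
    moreover have "D * \<zeta> ^ 3 = ((\<alpha> + \<beta>)\<^sup>2 + (\<alpha> + \<beta>)) * c\<^sup>2 * \<zeta> ^ 3 + C * (2 * c) ^ 3 * \<zeta> ^ 3"
      unfolding D_def by (rule distrib_right)
    ultimately show "(1 + s) powr \<alpha> * (1 + t) powr \<beta> \<le>
        1 + (\<alpha> * s + \<beta> * t) + hoelder_form \<alpha> \<beta> \<sigma> \<tau> / 2 + D * \<zeta> ^ 3"
      using C(2)[OF between] hoelder_form_perturb[OF \<alpha> \<beta> s t] by linarith
  qed
qed

lemma has_bochner_integral_hoelder_form: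
  fixes p r :: "'a::euclidean_space"
  shows "has_bochner_integral std_gauss (\<lambda>w. hoelder_form \<alpha> \<beta> (p \<bullet> w) (r \<bullet> w))
    ((norm (\<alpha> *\<^sub>R p + \<beta> *\<^sub>R r))\<^sup>2 - \<alpha> * (norm p)\<^sup>2 - \<beta> * (norm r)\<^sup>2)"
proof -
  have "hoelder_form \<alpha> \<beta> (p \<bullet> w) (r \<bullet> w) =
      ((\<alpha> *\<^sub>R p + \<beta> *\<^sub>R r) \<bullet> w)\<^sup>2 - \<alpha> * (p \<bullet> w)\<^sup>2 - \<beta> * (r \<bullet> w)\<^sup>2" for w
    by (simp add: hoelder_form_def inner_add_left)
  then show ?thesis
    by (simp only:) (intro has_bochner_integral_diff has_bochner_integral_mult_right
        has_bochner_integral_std_gauss_inner_square)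
qed

definition rel_fluct :: "('w::euclidean_space \<Rightarrow> 'a::euclidean_space) \<Rightarrow> real \<Rightarrow> ('a \<Rightarrow> real) \<Rightarrow> 'a \<Rightarrow> 'w \<Rightarrow> real" where
  "rel_fluct T h F x w = F (x + h *\<^sub>R T w) / gauss_avg T h F x - 1"

definition lin_fluct :: "('w::euclidean_space \<Rightarrow> 'a::euclidean_space) \<Rightarrow> real \<Rightarrow> ('a \<Rightarrow> real) \<Rightarrow> ('a \<Rightarrow> 'a) \<Rightarrow> 'a \<Rightarrow> 'w" where
  "lin_fluct T h F a x = adjoint T ((h / gauss_avg T h F x) *\<^sub>R a x)"

lemma rel_fluct_bounds:
  assumes F: "borel_between e M F" and T: "T \<in> borel_measurable borel" and e: "0 < e"
  shows "F (x + h *\<^sub>R T w) = gauss_avg T h F x * (1 + rel_fluct T h F x w)"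
    and "e / M \<le> 1 + rel_fluct T h F x w" "1 + rel_fluct T h F x w \<le> M / e"
proof -
  note avg = borel_betweenD(2,3)[OF borel_between_gauss_avg[OF F T, of h], of x]
  note b = borel_betweenD(2,3)[OF F, of "x + h *\<^sub>R T w"]
  show "F (x + h *\<^sub>R T w) = gauss_avg T h F x * (1 + rel_fluct T h F x w)"
    using avg e by (simp add: rel_fluct_def)
  show "e / M \<le> 1 + rel_fluct T h F x w" "1 + rel_fluct T h F x w \<le> M / e"
    using avg b e by (auto simp: rel_fluct_def intro!: frac_le)
qed

lemma has_bochner_integral_rel_fluct:
  assumes F: "borel_between e M F" and T: "T \<in> borel_measurable borel" and e: "0 < e"
  shows "has_bochner_integral std_gauss (rel_fluct T h F x) 0"
proof -
  have "0 < gauss_avg T h F x"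
    using borel_betweenD(2)[OF borel_between_gauss_avg[OF F T, of h], of x] e by simp
  moreover have "has_bochner_integral std_gauss (\<lambda>w. F (x + h *\<^sub>R T w)) (gauss_avg T h F x)"
    unfolding gauss_avg_def by (intro has_bochner_integral_integrable integrable_borel_between[OF F T])
  ultimately show ?thesis
    by (simp add: rel_fluct_def[abs_def] has_bochner_integral_iff)
qed

lemma C11_bounded_taylor_linear:
  assumes C: "C11_bounded e M L F a" and K: "norm (T w) \<le> K * norm w"
  shows "\<bar>F (x + h *\<^sub>R T w) - F x - a x \<bullet> (h *\<^sub>R T w)\<bar> \<le> L * K\<^sup>2 * h\<^sup>2 * (1 + norm w)\<^sup>2"
proof -
  have "(norm (T w))\<^sup>2 \<le> (K * norm w)\<^sup>2" using K by (intro power_mono) auto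
  also have "\<dots> \<le> K\<^sup>2 * (1 + norm w)\<^sup>2"
    unfolding power_mult_distrib by (intro mult_left_mono power_mono) auto
  finally have "L * (norm (h *\<^sub>R T w))\<^sup>2 \<le> L * (h\<^sup>2 * (K\<^sup>2 * (1 + norm w)\<^sup>2))"
    using C11_bounded_nonneg[OF C] by (simp add: power_mult_distrib mult_left_mono)
  then show ?thesis using C11_boundedD(3)[OF C, of x "h *\<^sub>R T w"] by (simp add: mult_ac)
qed

lemma gauss_avg_taylor:
  fixes T :: "'w::euclidean_space \<Rightarrow> 'a::euclidean_space"
  assumes C: "C11_bounded e M L F a" and T: "linear T" and K: "\<And>w. norm (T w) \<le> K * norm w"
  shows "\<bar>F (x + h *\<^sub>R T w) - gauss_avg T h F x - a x \<bullet> (h *\<^sub>R T w)\<bar>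
    \<le> L * K\<^sup>2 * (1 + (\<integral>w. (1 + norm w)\<^sup>2 \<partial>(std_gauss :: 'w measure))) * h\<^sup>2 * (1 + norm w)\<^sup>2"
proof -
  define r where "r w = F (x + h *\<^sub>R T w) - F x - a x \<bullet> (h *\<^sub>R T w)" for w
  define m where "m = (\<integral>w. (1 + norm w)\<^sup>2 \<partial>(std_gauss :: 'w measure))"
  have L: "0 \<le> L" by (rule C11_bounded_nonneg[OF C])
  have m: "0 \<le> m" unfolding m_def by (rule Bochner_Integration.integral_nonneg) simp
  have r: "\<bar>r w\<bar> \<le> L * K\<^sup>2 * h\<^sup>2 * (1 + norm w)\<^sup>2" for w
    unfolding r_def by (rule C11_bounded_taylor_linear[OF C K])
  have lin: "a x \<bullet> (h *\<^sub>R T w) = (h *\<^sub>R adjoint T (a x)) \<bullet> w" for w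
    using adjoint_works[OF T, of w "a x"] by (simp add: inner_commute)
  have int: "integrable std_gauss (\<lambda>w. F (x + h *\<^sub>R T w))" "integrable std_gauss (\<lambda>w. a x \<bullet> (h *\<^sub>R T w))"
    unfolding lin using integrable_borel_between[OF C11_boundedD(1)[OF C] linear_borel_measurable[OF T]]
    by (simp_all add: integrable_std_gauss_inner del: inner_scaleR_left)
  have "gauss_avg T h F x - F x = (\<integral>w. r w \<partial>std_gauss)"
    using int unfolding r_def gauss_avg_def
    by (simp add: lin integral_std_gauss_inner del: inner_scaleR_left inner_scaleR_right)
  also have "\<bar>\<dots>\<bar> \<le> (\<integral>w. \<bar>r w\<bar> \<partial>std_gauss)" by (rule integral_abs_bound)
  also have "\<dots> \<le> (\<integral>w. L * K\<^sup>2 * h\<^sup>2 * (1 + norm w) ^ 2 \<partial>(std_gauss :: 'w measure))"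
    using r int by (intro integral_mono integrable_mult_right integrable_std_gauss_power integrable_abs)
      (auto simp: r_def[abs_def])
  also have "\<dots> = L * K\<^sup>2 * h\<^sup>2 * m * 1" by (simp add: m_def)
  also have "\<dots> \<le> L * K\<^sup>2 * h\<^sup>2 * m * (1 + norm w)\<^sup>2"
    using L m by (intro mult_left_mono) (auto intro: one_le_power)
  finally have "\<bar>gauss_avg T h F x - F x\<bar> \<le> L * K\<^sup>2 * h\<^sup>2 * m * (1 + norm w)\<^sup>2" .
  moreover have "F (x + h *\<^sub>R T w) - gauss_avg T h F x - a x \<bullet> (h *\<^sub>R T w) = r w - (gauss_avg T h F x - F x)"
    by (simp add: r_def)
  ultimately show ?thesis
    using r[of w] unfolding m_def[symmetric] by (simp only: distrib_left distrib_right mult_1_right) (simp add: mult_ac)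
qed

lemma inner_lin_fluct:
  assumes "linear T"
  shows "lin_fluct T h F a x \<bullet> w = a x \<bullet> (h *\<^sub>R T w) / gauss_avg T h F x"
  using adjoint_works[OF assms, of w "(h / gauss_avg T h F x) *\<^sub>R a x"]
  by (simp add: lin_fluct_def inner_commute)

lemma abs_divide_gauss_avg_le:
  assumes F: "borel_between e M F" and T: "T \<in> borel_measurable borel" and e: "0 < e" and z: "\<bar>z\<bar> \<le> b"
  shows "\<bar>z / gauss_avg T h F x\<bar> \<le> b / e"
  unfolding abs_divide
  using borel_betweenD(2)[OF borel_between_gauss_avg[OF F T, of h], of x] e z by (intro frac_le) auto

lemma abs_inner_lin_fluct_le:
  assumes C: "C11_bounded e M L F a" and T: "linear T" and e: "0 < e" and h: "0 \<le> h"
    and K: "0 \<le> K" "norm (T w) \<le> K * norm w"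
  shows "\<bar>lin_fluct T h F a x \<bullet> w\<bar> \<le> (M - e + L) * K / e * (h * (1 + norm w)\<^sup>2)"
proof -
  have "\<bar>a x \<bullet> (h *\<^sub>R T w)\<bar> \<le> norm (a x) * norm (h *\<^sub>R T w)" by (rule Cauchy_Schwarz_ineq2)
  also have "\<dots> \<le> (M - e + L) * (h * (K * (1 + norm w)\<^sup>2))"
  proof (rule mult_mono)
    have "norm w \<le> (1 + norm w)\<^sup>2" by (simp add: power2_eq_square algebra_simps)
    with K have "norm (T w) \<le> K * (1 + norm w)\<^sup>2" by (meson mult_left_mono order_trans)
    then show "norm (h *\<^sub>R T w) \<le> h * (K * (1 + norm w)\<^sup>2)" using h by (simp add: mult_left_mono)
    show "norm (a x) \<le> M - e + L" by (rule C11_bounded_norm_gradient_le[OF C])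
    then show "0 \<le> M - e + L" by (rule order_trans[OF norm_ge_zero])
  qed simp
  finally have "\<bar>a x \<bullet> (h *\<^sub>R T w)\<bar> \<le> (M - e + L) * (h * (K * (1 + norm w)\<^sup>2))" .
  from abs_divide_gauss_avg_le[OF C11_boundedD(1)[OF C] linear_borel_measurable[OF T] e this, of h x]
  show ?thesis by (simp add: inner_lin_fluct[OF T] mult_ac)
qed

lemma abs_rel_fluct_minus_lin_fluct_le:
  fixes T :: "'w::euclidean_space \<Rightarrow> 'a::euclidean_space"
  assumes C: "C11_bounded e M L F a" and T: "linear T" and K: "\<And>w. norm (T w) \<le> K * norm w" and e: "0 < e"
  shows "\<bar>rel_fluct T h F x w - lin_fluct T h F a x \<bullet> w\<bar>
    \<le> L * K\<^sup>2 * (1 + (\<integral>w. (1 + norm w)\<^sup>2 \<partial>(std_gauss :: 'w measure))) / e * (h\<^sup>2 * (1 + norm w)\<^sup>2)"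
proof -
  note T_meas = linear_borel_measurable[OF T]
  have "rel_fluct T h F x w - lin_fluct T h F a x \<bullet> w =
      (F (x + h *\<^sub>R T w) - gauss_avg T h F x - a x \<bullet> (h *\<^sub>R T w)) / gauss_avg T h F x"
    using borel_betweenD(2)[OF borel_between_gauss_avg[OF C11_boundedD(1)[OF C] T_meas, of h], of x] e
    by (simp add: rel_fluct_def inner_lin_fluct[OF T] diff_divide_distrib)
  with abs_divide_gauss_avg_le[OF C11_boundedD(1)[OF C] T_meas e gauss_avg_taylor[OF C T K, of x h w], of h x]
  show ?thesis by (simp add: mult_ac)
qed

definition fluct_linearized :: "real \<Rightarrow> ('w::euclidean_space \<Rightarrow> 'a::euclidean_space) \<Rightarrow> real \<Rightarrow>
    ('a \<Rightarrow> real) \<Rightarrow> ('a \<Rightarrow> 'a) \<Rightarrow> 'a \<Rightarrow> 'w \<Rightarrow> bool" where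
  "fluct_linearized c T h F a x w \<longleftrightarrow>
    \<bar>rel_fluct T h F x w\<bar> \<le> c * (h * (1 + norm w)\<^sup>2) \<and>
    \<bar>lin_fluct T h F a x \<bullet> w\<bar> \<le> c * (h * (1 + norm w)\<^sup>2) \<and>
    \<bar>rel_fluct T h F x w - lin_fluct T h F a x \<bullet> w\<bar> \<le> c * (h * (1 + norm w)\<^sup>2)\<^sup>2"

lemma fluct_linearized_mono:
  assumes "fluct_linearized c T h F a x w" "c \<le> c'" "0 \<le> h"
  shows "fluct_linearized c' T h F a x w"
  using assms mult_right_mono[OF assms(2), of "h * (1 + norm w)\<^sup>2"]
    mult_right_mono[OF assms(2), of "(h * (1 + norm w)\<^sup>2)\<^sup>2"]
  unfolding fluct_linearized_def by (auto intro: order_trans)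

lemma rel_fluct_linearization:
  fixes T :: "'w::euclidean_space \<Rightarrow> 'a::euclidean_space"
  assumes T: "linear T" and e: "0 < e"
  obtains c where "0 \<le> c"
    and "\<And>F a x h w. C11_bounded e M L F a \<Longrightarrow> 0 \<le> h \<Longrightarrow> h \<le> 1 \<Longrightarrow> fluct_linearized c T h F a x w"
proof -
  obtain K where K: "0 < K" "\<And>w. norm (T w) \<le> K * norm w"
    using linear_bounded_pos[OF T] by blast
  define k where "k = (M - e + L) * K / e"
  define l where "l = L * K\<^sup>2 * (1 + (\<integral>w. (1 + norm w)\<^sup>2 \<partial>(std_gauss :: 'w measure))) / e"
  show ?thesis
  proof (rule that[of "\<bar>k\<bar> + \<bar>l\<bar>"])
    fix F :: "'a \<Rightarrow> real" and a x and h :: real and w :: 'w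
    assume C: "C11_bounded e M L F a" and h: "0 \<le> h" "h \<le> 1"
    define y where "y = (1 + norm w)\<^sup>2"
    let ?s = "rel_fluct T h F x w" and ?p = "lin_fluct T h F a x \<bullet> w"
    have "1 \<le> y" by (simp add: y_def one_le_power)
    then have "y \<le> y\<^sup>2" by (simp add: self_le_power)
    then have hy: "h\<^sup>2 * y \<le> h * y" "h\<^sup>2 * y \<le> (h * y)\<^sup>2" "0 \<le> h * y" "0 \<le> h\<^sup>2 * y"
      using h \<open>1 \<le> y\<close> power_decreasing[of 1 2 h] by (auto simp: power_mult_distrib intro!: mult_right_mono mult_left_mono)
    have "\<bar>?p\<bar> \<le> k * (h * y)"
      using abs_inner_lin_fluct_le[OF C T e h(1) less_imp_le[OF K(1)] K(2)] by (simp add: k_def y_def)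
    also have "\<dots> \<le> \<bar>k\<bar> * (h * y)" using hy(3) by (intro mult_right_mono) auto
    finally have p: "\<bar>?p\<bar> \<le> \<bar>k\<bar> * (h * y)" .
    have "\<bar>?s - ?p\<bar> \<le> l * (h\<^sup>2 * y)"
      using abs_rel_fluct_minus_lin_fluct_le[OF C T K(2) e] by (simp add: l_def y_def)
    also have "\<dots> \<le> \<bar>l\<bar> * (h\<^sup>2 * y)" using hy(4) by (intro mult_right_mono) auto
    finally have sp: "\<bar>?s - ?p\<bar> \<le> \<bar>l\<bar> * (h\<^sup>2 * y)" .
    have "\<bar>?s\<bar> \<le> (\<bar>k\<bar> + \<bar>l\<bar>) * (h * y)"
      using p sp mult_left_mono[OF hy(1) abs_ge_zero[of l]] unfolding distrib_right by linarith
    moreover have "\<bar>?p\<bar> \<le> (\<bar>k\<bar> + \<bar>l\<bar>) * (h * y)"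
      using p mult_nonneg_nonneg[OF abs_ge_zero[of l] hy(3)] unfolding distrib_right by linarith
    moreover have "\<bar>?s - ?p\<bar> \<le> (\<bar>k\<bar> + \<bar>l\<bar>) * (h * y)\<^sup>2"
      using sp mult_left_mono[OF hy(2) abs_ge_zero[of l]]
        mult_nonneg_nonneg[OF abs_ge_zero[of k] zero_le_power2[of "h * y"]]
      unfolding distrib_right by linarith
    ultimately show "fluct_linearized (\<bar>k\<bar> + \<bar>l\<bar>) T h F a x w"
      unfolding fluct_linearized_def y_def by blast
  qed simp
qed

definition powr_prod :: "real \<Rightarrow> real \<Rightarrow> ('a \<Rightarrow> real) \<Rightarrow> ('b \<Rightarrow> real) \<Rightarrow> 'a \<times> 'b \<Rightarrow> real" where
  "powr_prod \<alpha> \<beta> F G z = F (fst z) powr \<alpha> * G (snd z) powr \<beta>"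

lemma borel_between_powr_prod:
  fixes F :: "'a::euclidean_space \<Rightarrow> real" and G :: "'b::euclidean_space \<Rightarrow> real"
  assumes F: "borel_between e M F" and G: "borel_between e M G" and "0 < e" "0 \<le> \<alpha>" "0 \<le> \<beta>"
  shows "borel_between (e powr \<alpha> * e powr \<beta>) (M powr \<alpha> * M powr \<beta>) (powr_prod \<alpha> \<beta> F G)"
  unfolding borel_between_def
proof (intro conjI allI)
  note [measurable] = borel_betweenD(1)[OF F] borel_betweenD(1)[OF G]
  show "powr_prod \<alpha> \<beta> F G \<in> borel_measurable borel" unfolding powr_prod_def[abs_def] by measurable
  fix z
  have "e powr \<alpha> \<le> F (fst z) powr \<alpha>" "e powr \<beta> \<le> G (snd z) powr \<beta>"
    "F (fst z) powr \<alpha> \<le> M powr \<alpha>" "G (snd z) powr \<beta> \<le> M powr \<beta>"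
    using borel_betweenD(2,3)[OF F, of "fst z"] borel_betweenD(2,3)[OF G, of "snd z"] assms(3-5)
    by (auto intro!: powr_mono2)
  then show "e powr \<alpha> * e powr \<beta> \<le> powr_prod \<alpha> \<beta> F G z" "powr_prod \<alpha> \<beta> F G z \<le> M powr \<alpha> * M powr \<beta>"
    unfolding powr_prod_def by (auto intro!: mult_mono)
qed

text \<open>Under the standard Gaussian law of \<open>w\<close> the assumption \<open>corr\<close> says that
  \<open>hoelder_form \<alpha> \<beta> (a \<bullet> X w) (b \<bullet> Y w)\<close> has nonpositive expectation.\<close>

locale gauss_pair =
  fixes X :: "'w::euclidean_space \<Rightarrow> 'a::euclidean_space" and Y :: "'w \<Rightarrow> 'b::euclidean_space"
    and \<alpha> \<beta> :: real
  assumes linear_X: "linear X" and linear_Y: "linear Y" and \<alpha>: "0 < \<alpha>" and \<beta>: "0 < \<beta>"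
    and corr: "\<And>a b. (norm (\<alpha> *\<^sub>R adjoint X a + \<beta> *\<^sub>R adjoint Y b))\<^sup>2
        \<le> \<alpha> * (norm (adjoint X a))\<^sup>2 + \<beta> * (norm (adjoint Y b))\<^sup>2"
begin

definition XY :: "'w \<Rightarrow> 'a \<times> 'b" where
  "XY w = (X w, Y w)"

lemma linear_XY: "linear XY"
  unfolding XY_def[abs_def]
  by (rule linearI) (simp_all add: linear_add linear_scale linear_X linear_Y)

lemmas borel_measurable_X [measurable] = linear_borel_measurable[OF linear_X]
  and borel_measurable_Y [measurable] = linear_borel_measurable[OF linear_Y]
  and borel_measurable_XY [measurable] = linear_borel_measurable[OF linear_XY]

abbreviation "FG_avg h F G \<equiv> gauss_avg XY h (powr_prod \<alpha> \<beta> F G)"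

abbreviation "avg_FG h F G \<equiv> powr_prod \<alpha> \<beta> (gauss_avg X h F) (gauss_avg Y h G)"

text \<open>Second-order Taylor polynomial in the relative fluctuations plus remainder; the quadratic part is
  evaluated at the linearized fluctuations, so that its mean is explicit.\<close>

definition fluct_majorant :: "real \<Rightarrow> real \<Rightarrow> ('a \<Rightarrow> real) \<Rightarrow> ('a \<Rightarrow> 'a) \<Rightarrow> ('b \<Rightarrow> real) \<Rightarrow> ('b \<Rightarrow> 'b) \<Rightarrow>
    'a \<times> 'b \<Rightarrow> 'w \<Rightarrow> real" where
  "fluct_majorant D h F a G b z w =
    1 + (\<alpha> * rel_fluct X h F (fst z) w + \<beta> * rel_fluct Y h G (snd z) w) +
    hoelder_form \<alpha> \<beta> (lin_fluct X h F a (fst z) \<bullet> w) (lin_fluct Y h G b (snd z) \<bullet> w) / 2 +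
    D * (h * (1 + norm w)\<^sup>2) ^ 3"

lemma powr_prod_le_fluct_majorant:
  assumes e: "0 < e" "e \<le> M"
  obtains D where "0 \<le> D"
    and "\<And>F a G b z h w. C11_bounded e M L F a \<Longrightarrow> C11_bounded e M L G b \<Longrightarrow> 0 \<le> h \<Longrightarrow> h \<le> 1 \<Longrightarrow>
      powr_prod \<alpha> \<beta> F G (z + h *\<^sub>R XY w) \<le> avg_FG h F G z * fluct_majorant D h F a G b z w"
proof -
  obtain c1 where c1: "0 \<le> c1"
    "\<And>F a x h w. C11_bounded e M L F a \<Longrightarrow> 0 \<le> h \<Longrightarrow> h \<le> 1 \<Longrightarrow> fluct_linearized c1 X h F a x w"
    using rel_fluct_linearization[OF linear_X e(1)] by blast
  obtain c2 where c2: "0 \<le> c2"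
    "\<And>G b y h w. C11_bounded e M L G b \<Longrightarrow> 0 \<le> h \<Longrightarrow> h \<le> 1 \<Longrightarrow> fluct_linearized c2 Y h G b y w"
    using rel_fluct_linearization[OF linear_Y e(1)] by blast
  define c where "c = max c1 c2"
  have c: "0 \<le> c" "c1 \<le> c" "c2 \<le> c" using c1 by (simp_all add: c_def)
  obtain D where D: "0 \<le> D" "\<And>s t \<sigma> \<tau> \<zeta>. \<lbrakk>e / M \<le> 1 + s; 1 + s \<le> M / e; e / M \<le> 1 + t; 1 + t \<le> M / e;
      \<bar>s\<bar> \<le> c * \<zeta>; \<bar>\<sigma>\<bar> \<le> c * \<zeta>; \<bar>s - \<sigma>\<bar> \<le> c * \<zeta>\<^sup>2; \<bar>t\<bar> \<le> c * \<zeta>; \<bar>\<tau>\<bar> \<le> c * \<zeta>; \<bar>t - \<tau>\<bar> \<le> c * \<zeta>\<^sup>2\<rbrakk> \<Longrightarrow>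
      (1 + s) powr \<alpha> * (1 + t) powr \<beta> \<le> 1 + (\<alpha> * s + \<beta> * t) + hoelder_form \<alpha> \<beta> \<sigma> \<tau> / 2 + D * \<zeta> ^ 3"
    using powr_prod_le_perturbed_quadratic[of \<alpha> \<beta> c "e / M" "M / e"] \<alpha> \<beta> c(1) e by (auto simp: less_imp_le)
  show ?thesis
  proof (rule that[OF D(1)])
    fix F :: "'a \<Rightarrow> real" and a and G :: "'b \<Rightarrow> real" and b and z :: "'a \<times> 'b" and w :: 'w and h :: real
    assume F: "C11_bounded e M L F a" and G: "C11_bounded e M L G b" and h: "0 \<le> h" "h \<le> 1"
    define s where "s = rel_fluct X h F (fst z) w"
    define t where "t = rel_fluct Y h G (snd z) w"
    note s = rel_fluct_bounds[OF C11_boundedD(1)[OF F] borel_measurable_X e(1), where x = "fst z" and h = h and w = w, folded s_def]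
    note t = rel_fluct_bounds[OF C11_boundedD(1)[OF G] borel_measurable_Y e(1), where x = "snd z" and h = h and w = w, folded t_def]
    have "fluct_linearized c X h F a (fst z) w" "fluct_linearized c Y h G b (snd z) w"
      using c1(2)[OF F h] c2(2)[OF G h] c(2,3) h(1) by (blast intro: fluct_linearized_mono)+
    then have "(1 + s) powr \<alpha> * (1 + t) powr \<beta> \<le> fluct_majorant D h F a G b z w"
      unfolding fluct_linearized_def fluct_majorant_def s_def[symmetric] t_def[symmetric]
      by (intro D(2) s(2,3) t(2,3)) simp_all
    moreover have "powr_prod \<alpha> \<beta> F G (z + h *\<^sub>R XY w) = avg_FG h F G z * ((1 + s) powr \<alpha> * (1 + t) powr \<beta>)"
      by (simp add: powr_prod_def XY_def s(1) t(1) powr_mult mult_ac)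
    ultimately show "powr_prod \<alpha> \<beta> F G (z + h *\<^sub>R XY w) \<le> avg_FG h F G z * fluct_majorant D h F a G b z w"
      by (simp add: mult_left_mono powr_prod_def)
  qed
qed

text \<open>The linear terms are centred and, by \<open>corr\<close>, the quadratic form has nonpositive mean.\<close>

lemma integral_fluct_majorant_le:
  assumes e: "0 < e" and F: "borel_between e M F" and G: "borel_between e M G"
  shows "integrable std_gauss (fluct_majorant D h F a G b z)"
    and "(\<integral>w. fluct_majorant D h F a G b z w \<partial>std_gauss) \<le>
      1 + D * (\<integral>w. (1 + norm w) ^ 6 \<partial>(std_gauss :: 'w measure)) * h ^ 3"
proof -
  define m where "m = (\<integral>w. (1 + norm w) ^ 6 \<partial>(std_gauss :: 'w measure))"
  define p where "p = lin_fluct X h F a (fst z)"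
  define r where "r = lin_fluct Y h G b (snd z)"
  define k where "k = (norm (\<alpha> *\<^sub>R p + \<beta> *\<^sub>R r))\<^sup>2 - \<alpha> * (norm p)\<^sup>2 - \<beta> * (norm r)\<^sup>2"
  have "has_bochner_integral std_gauss (\<lambda>w. (h * (1 + norm (w :: 'w))\<^sup>2) ^ 3) (h ^ 3 * m)"
    unfolding power_mult_distrib power_mult[symmetric] m_def
    using integrable_std_gauss_power[of 6, where 'a = 'w]
    by (intro has_bochner_integral_mult_right) (simp add: has_bochner_integral_iff)
  moreover have "has_bochner_integral std_gauss (\<lambda>w :: 'w. 1 :: real) 1"
    by (simp add: has_bochner_integral_iff)
  ultimately have "has_bochner_integral std_gauss (fluct_majorant D h F a G b z)
      (1 + (\<alpha> * 0 + \<beta> * 0) + k / 2 + D * (h ^ 3 * m))"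
    unfolding fluct_majorant_def[abs_def] k_def p_def r_def
    by (intro has_bochner_integral_add has_bochner_integral_mult_right has_bochner_integral_divide
      has_bochner_integral_hoelder_form has_bochner_integral_rel_fluct[OF F borel_measurable_X e]
      has_bochner_integral_rel_fluct[OF G borel_measurable_Y e])
  moreover have "k \<le> 0"
    unfolding k_def p_def r_def lin_fluct_def by (simp add: corr add.commute diff_le_eq)
  ultimately show "integrable std_gauss (fluct_majorant D h F a G b z)"
    and "(\<integral>w. fluct_majorant D h F a G b z w \<partial>std_gauss) \<le>
      1 + D * (\<integral>w. (1 + norm w) ^ 6 \<partial>(std_gauss :: 'w measure)) * h ^ 3"
    by (simp_all add: has_bochner_integral_iff m_def mult_ac)
qed

lemma borel_between_powr_prod_pair:
  fixes F :: "'a \<Rightarrow> real" and G :: "'b \<Rightarrow> real"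
  assumes "borel_between e M F" "borel_between e M G" "0 < e"
  shows "borel_between (e powr \<alpha> * e powr \<beta>) (M powr \<alpha> * M powr \<beta>) (powr_prod \<alpha> \<beta> F G)"
  using assms \<alpha> \<beta> by (intro borel_between_powr_prod) auto

lemma hoelder_up_to_cube:
  assumes e: "0 < e" "e \<le> M"
  obtains C where "\<And>F a G b z h. C11_bounded e M L F a \<Longrightarrow> C11_bounded e M L G b \<Longrightarrow> 0 \<le> h \<Longrightarrow> h \<le> 1 \<Longrightarrow>
     FG_avg h F G z \<le> avg_FG h F G z + C * h ^ 3"
proof -
  obtain D where D: "0 \<le> D"
    and majorant: "\<And>F a G b z h w. C11_bounded e M L F a \<Longrightarrow> C11_bounded e M L G b \<Longrightarrow> 0 \<le> h \<Longrightarrow> h \<le> 1 \<Longrightarrow>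
      powr_prod \<alpha> \<beta> F G (z + h *\<^sub>R XY w) \<le> avg_FG h F G z * fluct_majorant D h F a G b z w"
    using powr_prod_le_fluct_majorant[OF e] by blast
  define m where "m = D * (\<integral>w. (1 + norm w) ^ 6 \<partial>(std_gauss :: 'w measure))"
  have m: "0 \<le> m" unfolding m_def by (intro mult_nonneg_nonneg D Bochner_Integration.integral_nonneg) simp
  have "FG_avg h F G z \<le> avg_FG h F G z + (M powr \<alpha> * M powr \<beta> * m) * h ^ 3"
    if F: "C11_bounded e M L F a" and G: "C11_bounded e M L G b" and h: "0 \<le> h" "h \<le> 1" for F a G b z h
  proof -
    note bF = C11_boundedD(1)[OF F] and bG = C11_boundedD(1)[OF G]
    note int = integral_fluct_majorant_le[OF e(1) bF bG, of D h a b z]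
    have avg: "0 \<le> avg_FG h F G z" "avg_FG h F G z \<le> M powr \<alpha> * M powr \<beta>"
      using borel_betweenD(3)[OF borel_between_powr_prod_pair[OF borel_between_gauss_avg[OF bF borel_measurable_X]
        borel_between_gauss_avg[OF bG borel_measurable_Y] e(1)]] by (simp_all add: powr_prod_def)
    have "FG_avg h F G z \<le> (\<integral>w. avg_FG h F G z * fluct_majorant D h F a G b z w \<partial>std_gauss)"
      unfolding gauss_avg_def[of XY]
    proof (rule integral_mono)
      show "integrable std_gauss (\<lambda>w. powr_prod \<alpha> \<beta> F G (z + h *\<^sub>R XY w))"
        by (rule integrable_borel_between[OF borel_between_powr_prod_pair[OF bF bG e(1)] borel_measurable_XY])
    qed (use int(1) majorant[OF F G h] in simp_all)
    also have "\<dots> \<le> avg_FG h F G z * (1 + m * h ^ 3)"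
      using mult_left_mono[OF int(2) avg(1)] by (simp add: m_def)
    also have "\<dots> \<le> avg_FG h F G z + M powr \<alpha> * M powr \<beta> * (m * h ^ 3)"
      using mult_right_mono[OF avg(2), of "m * h ^ 3"] m h by (simp add: distrib_left)
    finally show ?thesis by (simp add: mult_ac)
  qed
  then show ?thesis using that by blast
qed

lemma FG_avg_semigroup_le:
  assumes e: "0 < e" and F: "borel_between e M F" and G: "borel_between e M G"
    and c: "c\<^sup>2 = d\<^sup>2 + h\<^sup>2" "0 < c" and step: "\<And>z. FG_avg h F G z \<le> avg_FG h F G z + D"
  shows "FG_avg c F G z \<le> FG_avg d (gauss_avg X h F) (gauss_avg Y h G) z + D"
proof -
  note FG = borel_between_powr_prod_pair[OF F G e]
  have "borel_between e M (gauss_avg X h F)" "borel_between e M (gauss_avg Y h G)"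
    by (intro borel_between_gauss_avg F G; measurable)+
  note int = integrable_borel_between[OF borel_between_powr_prod_pair[OF this e] borel_measurable_XY]
  have "FG_avg c F G z = gauss_avg XY d (FG_avg h F G) z"
    by (rule gauss_avg_semigroup[OF FG linear_XY c])
  also have "\<dots> \<le> (\<integral>w. avg_FG h F G (z + d *\<^sub>R XY w) + D \<partial>std_gauss)"
    unfolding gauss_avg_def[of XY d]
  proof (rule integral_mono)
    show "integrable std_gauss (\<lambda>w. FG_avg h F G (z + d *\<^sub>R XY w))"
      by (intro integrable_borel_between[OF borel_between_gauss_avg[OF FG]] borel_measurable_XY)
    show "integrable std_gauss (\<lambda>w. avg_FG h F G (z + d *\<^sub>R XY w) + D)"
      by (intro Bochner_Integration.integrable_add int) simp
  qed (rule step)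
  also have "\<dots> = FG_avg d (gauss_avg X h F) (gauss_avg Y h G) z + D"
    using int by (simp add: gauss_avg_def[of XY])
  finally show ?thesis .
qed

lemma hoelder_iterate:
  assumes e: "0 < e" and h: "0 < h"
    and step: "\<And>F a G b z. C11_bounded e M L F a \<Longrightarrow> C11_bounded e M L G b \<Longrightarrow> FG_avg h F G z \<le> avg_FG h F G z + D"
    and F: "C11_bounded e M L F a" and G: "C11_bounded e M L G b"
  shows "FG_avg (h * sqrt k) F G z \<le> avg_FG (h * sqrt k) F G z + real k * D"
  using F G
proof (induction k arbitrary: F a G b)
  case 0
  then show ?case by (simp add: gauss_avg_scale_zero powr_prod_def)
next
  case (Suc k)
  define c where "c = h * sqrt (real (Suc k))"
  define d where "d = h * sqrt (real k)"
  have c: "c\<^sup>2 = d\<^sup>2 + h\<^sup>2" "0 < c"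
    using h by (auto simp: c_def d_def power_mult_distrib algebra_simps)
  note bF = C11_boundedD(1)[OF Suc.prems(1)] and bG = C11_boundedD(1)[OF Suc.prems(2)]
  define F' where "F' = gauss_avg X h F"
  define G' where "G' = gauss_avg Y h G"
  have "C11_bounded e M L F' (gauss_avg X h a)" "C11_bounded e M L G' (gauss_avg Y h b)"
    unfolding F'_def G'_def by (intro C11_bounded_gauss_avg Suc.prems; measurable)+
  from Suc.IH[OF this] have "FG_avg d F' G' z \<le> avg_FG d F' G' z + real k * D"
    by (simp add: d_def)
  moreover have "avg_FG d F' G' z = avg_FG c F G z"
    unfolding powr_prod_def F'_def G'_def
    by (simp add: gauss_avg_semigroup[OF bF linear_X c] gauss_avg_semigroup[OF bG linear_Y c])
  moreover have "FG_avg c F G z \<le> FG_avg d F' G' z + D"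
    unfolding F'_def G'_def by (rule FG_avg_semigroup_le[OF e bF bG c step[OF Suc.prems]])
  ultimately show ?case by (simp add: c_def algebra_simps)
qed

lemma C11_hoelder:
  assumes e: "0 < e" and F: "C11_bounded e M L F a" and G: "C11_bounded e M L G b"
  shows "FG_avg 1 F G z \<le> avg_FG 1 F G z"
proof -
  have "e \<le> M" using borel_betweenD(2,3)[OF C11_boundedD(1)[OF F]] order_trans by blast
  then obtain C where C: "\<And>F a G b z h. C11_bounded e M L F a \<Longrightarrow> C11_bounded e M L G b \<Longrightarrow> 0 \<le> h \<Longrightarrow> h \<le> 1 \<Longrightarrow>
     FG_avg h F G z \<le> avg_FG h F G z + C * h ^ 3"
    using hoelder_up_to_cube[OF e] by blast
  have "FG_avg 1 F G z \<le> avg_FG 1 F G z + C * inverse (real (Suc n))" for n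
  proof -
    define h where "h = inverse (real (Suc n))"
    have "N\<^sup>2 * (C * inverse N ^ 3) = C * inverse N" if "0 < N" for N :: real
      using that by (simp add: power2_eq_square power3_eq_cube field_simps)
    from this[of "real (Suc n)"]
    have h: "0 < h" "h \<le> 1" "h * sqrt (real ((Suc n)\<^sup>2)) = 1" "real ((Suc n)\<^sup>2) * (C * h ^ 3) = C * h"
      by (simp_all add: h_def inverse_le_1_iff)
    have "FG_avg (h * sqrt (real ((Suc n)\<^sup>2))) F G z \<le>
        avg_FG (h * sqrt (real ((Suc n)\<^sup>2))) F G z + real ((Suc n)\<^sup>2) * (C * h ^ 3)"
      using C h(1,2) by (intro hoelder_iterate[OF e h(1) _ F G]) simp
    then show ?thesis unfolding h(3,4) by (simp add: h_def)
  qed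
  moreover have "(\<lambda>n. avg_FG 1 F G z + C * inverse (real (Suc n))) \<longlonglongrightarrow> avg_FG 1 F G z + C * 0"
    by (intro tendsto_intros LIMSEQ_inverse_real_of_nat)
  ultimately show ?thesis by (intro LIMSEQ_le_const[of _ "avg_FG 1 F G z"]) auto
qed

lemma hoelder_limit:
  fixes Fs :: "nat \<Rightarrow> 'a \<Rightarrow> real" and Gs :: "nat \<Rightarrow> 'b \<Rightarrow> real"
  assumes e: "0 < e" and Fs: "\<And>n. borel_between e M (Fs n)" and Gs: "\<And>n. borel_between e M (Gs n)"
    and F: "borel_between e M F" and G: "borel_between e M G"
    and limF: "AE w in std_gauss. (\<lambda>n. Fs n (x + X w)) \<longlonglongrightarrow> F (x + X w)"
    and limG: "AE w in std_gauss. (\<lambda>n. Gs n (y + Y w)) \<longlonglongrightarrow> G (y + Y w)"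
    and ineq: "\<And>n. FG_avg 1 (Fs n) (Gs n) (x, y) \<le> avg_FG 1 (Fs n) (Gs n) (x, y)"
  shows "FG_avg 1 F G (x, y) \<le> avg_FG 1 F G (x, y)"
proof (rule LIMSEQ_le)
  note [measurable] = borel_betweenD(1)[OF F] borel_betweenD(1)[OF G]
  note between = borel_between_powr_prod_pair[OF _ _ e]
  show "(\<lambda>n. FG_avg 1 (Fs n) (Gs n) (x, y)) \<longlonglongrightarrow> FG_avg 1 F G (x, y)"
  proof (rule gauss_avg_tendsto[OF between[OF Fs Gs] borel_betweenD(1)[OF between[OF F G]] borel_measurable_XY])
    show "AE w in std_gauss. (\<lambda>n. powr_prod \<alpha> \<beta> (Fs n) (Gs n) ((x, y) + 1 *\<^sub>R XY w))
        \<longlonglongrightarrow> powr_prod \<alpha> \<beta> F G ((x, y) + 1 *\<^sub>R XY w)"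
      using limF limG
    proof eventually_elim
      case (elim w)
      then show ?case
        using borel_betweenD(2)[OF F, of "x + X w"] borel_betweenD(2)[OF G, of "y + Y w"] e
        unfolding powr_prod_def XY_def by (auto intro!: tendsto_intros)
    qed
  qed
  have "(\<lambda>n. gauss_avg X 1 (Fs n) x) \<longlonglongrightarrow> gauss_avg X 1 F x" "(\<lambda>n. gauss_avg Y 1 (Gs n) y) \<longlonglongrightarrow> gauss_avg Y 1 G y"
    using limF limG by (auto intro!: gauss_avg_tendsto[OF Fs] gauss_avg_tendsto[OF Gs])
  moreover have "0 < gauss_avg X 1 F x" "0 < gauss_avg Y 1 G y"
    using borel_betweenD(2)[OF borel_between_gauss_avg[OF F borel_measurable_X, of 1], of x]
      borel_betweenD(2)[OF borel_between_gauss_avg[OF G borel_measurable_Y, of 1], of y] e by auto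
  ultimately show "(\<lambda>n. avg_FG 1 (Fs n) (Gs n) (x, y)) \<longlonglongrightarrow> avg_FG 1 F G (x, y)"
    unfolding powr_prod_def by (auto intro!: tendsto_intros)
qed (use ineq in blast)

end

definition gauss_tilt :: "'a::euclidean_space \<Rightarrow> 'a \<Rightarrow> real" where
  "gauss_tilt k z = exp (z \<bullet> k - (norm k)\<^sup>2 / 2)"

lemma borel_measurable_gauss_tilt [measurable]: "gauss_tilt k \<in> borel_measurable borel"
  unfolding gauss_tilt_def[abs_def] by measurable

lemma integral_std_gauss_shift:
  fixes f :: "'a::euclidean_space \<Rightarrow> real"
  assumes [measurable]: "f \<in> borel_measurable borel" and nonneg: "\<And>x. 0 \<le> f x"
  shows "(\<integral>z. f (z + k) \<partial>std_gauss) = (\<integral>z. f z * gauss_tilt k z \<partial>std_gauss)"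
proof -
  have dens: "gauss_density (- k + z) = gauss_density z * gauss_tilt k z" for z :: 'a
    unfolding gauss_density_eq gauss_tilt_def mult.assoc exp_add[symmetric] power2_norm_eq_inner
    by (simp add: inner_diff_left inner_diff_right inner_commute add_divide_distrib diff_divide_distrib)
  have tilt: "0 \<le> gauss_tilt k z" for z by (simp add: gauss_tilt_def)
  have "(\<integral>\<^sup>+z. f (z + k) \<partial>std_gauss) = (\<integral>\<^sup>+z. gauss_density (- k + (k + z)) * ennreal (f (k + z)) \<partial>lborel)"
    by (subst nn_integral_std_gauss) (auto simp: add.commute)
  also have "\<dots> = (\<integral>\<^sup>+z. gauss_density (- k + z) * ennreal (f z) \<partial>lborel)"
    by (rule nn_integral_lborel_shift) simp
  also have "\<dots> = (\<integral>\<^sup>+z. f z * gauss_tilt k z \<partial>std_gauss)"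
    by (subst nn_integral_std_gauss, measurable, intro nn_integral_cong)
      (simp only: dens, simp add: ennreal_mult nonneg tilt mult_ac)
  finally show ?thesis
    by (subst (1 2) integral_eq_nn_integral) (auto simp: nonneg tilt)
qed

lemma has_bochner_integral_gauss_tilt:
  "has_bochner_integral std_gauss (gauss_tilt k) 1" for k :: "'a::euclidean_space"
proof -
  have "(\<integral>z. gauss_tilt k z \<partial>std_gauss) = 1"
    using integral_std_gauss_shift[of "\<lambda>_. 1" k] by simp
  moreover from this have "integrable std_gauss (gauss_tilt k)"
    using not_integrable_integral_eq by fastforce
  ultimately show ?thesis by (simp add: has_bochner_integral_iff)
qed

definition gauss_tilt_remainder :: "'a::euclidean_space \<Rightarrow> 'a \<Rightarrow> real" where
  "gauss_tilt_remainder k z = gauss_tilt k z - 1 - z \<bullet> k"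

lemma integrable_gauss_tilt_remainder: "integrable std_gauss (gauss_tilt_remainder k)"
  using has_bochner_integral_gauss_tilt[of k] integrable_std_gauss_inner[of k]
  by (simp add: gauss_tilt_remainder_def[abs_def] has_bochner_integral_iff inner_commute)

lemma abs_gauss_tilt_remainder_le:
  fixes z k :: "'a::euclidean_space"
  assumes k: "norm k \<le> 1"
  shows "\<bar>gauss_tilt_remainder k z\<bar> \<le> (norm k)\<^sup>2 * (2 * exp 1 * ((1 + norm z)\<^sup>2 * exp (norm z)))"
proof -
  define y where "y = z \<bullet> k - (norm k)\<^sup>2 / 2"
  define E where "E = exp 1 * ((1 + norm z)\<^sup>2 * exp (norm z))"
  have "(norm k)\<^sup>2 \<le> norm k" using k by (simp add: power2_eq_square mult_left_le)
  then have y: "\<bar>y\<bar> \<le> norm k * (1 + norm z)"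
    using Cauchy_Schwarz_ineq2[of z k] abs_triangle_ineq4[of "z \<bullet> k" "(norm k)\<^sup>2 / 2"]
      norm_ge_zero[of k] zero_le_power2[of "norm k"]
    unfolding y_def distrib_left mult.commute[of "norm k" "norm z"] by linarith
  also have "\<dots> \<le> 1 + norm z" using mult_right_mono[OF k, of "1 + norm z"] by simp
  finally have exp_y: "exp \<bar>y\<bar> \<le> exp 1 * exp (norm z)" by (simp add: exp_add[symmetric])
  obtain t where t: "\<bar>t\<bar> \<le> \<bar>y\<bar>" "exp y = (\<Sum>m<2. y ^ m / fact m) + exp t / fact 2 * y ^ 2"
    using Maclaurin_exp_le[of y 2] by blast
  have "\<bar>exp y - 1 - y\<bar> = exp t / 2 * y\<^sup>2" using t(2) by (simp add: numeral_2_eq_2)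
  also have "\<dots> \<le> exp 1 * exp (norm z) * (norm k * (1 + norm z))\<^sup>2"
  proof (rule mult_mono)
    have "exp t / 2 \<le> exp t" by simp
    also have "\<dots> \<le> exp \<bar>y\<bar>" using t(1) by simp
    also note exp_y
    finally show "exp t / 2 \<le> exp 1 * exp (norm z)" .
    show "y\<^sup>2 \<le> (norm k * (1 + norm z))\<^sup>2" using power_mono[OF y, of 2] by simp
  qed auto
  also have "\<dots> = (norm k)\<^sup>2 * E" by (simp add: E_def power_mult_distrib mult_ac)
  finally have "\<bar>exp y - 1 - y\<bar> \<le> (norm k)\<^sup>2 * E" .
  moreover have "(norm k)\<^sup>2 / 2 \<le> (norm k)\<^sup>2 * E"
  proof -
    have "1 * (1 * 1) \<le> E" unfolding E_def by (intro mult_mono) (auto simp: one_le_power)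
    from mult_left_mono[OF this zero_le_power2[of "norm k"]] zero_le_power2[of "norm k"] show ?thesis
      unfolding mult_1_right by linarith
  qed
  moreover have "gauss_tilt_remainder k z = (exp y - 1 - y) - (norm k)\<^sup>2 / 2"
    by (simp add: gauss_tilt_remainder_def gauss_tilt_def y_def)
  ultimately have "\<bar>gauss_tilt_remainder k z\<bar> \<le> 2 * ((norm k)\<^sup>2 * E)"
    using zero_le_power2[of "norm k"] by linarith
  then show ?thesis by (simp add: E_def mult_ac)
qed

text \<open>For \<open>|k| > 1\<close> the triangle inequality suffices, since \<^const>\<open>gauss_tilt\<close> has mean one.\<close>

lemma gauss_tilt_remainder_L1:
  obtains c where "\<And>k :: 'a::euclidean_space. (\<integral>z. \<bar>gauss_tilt_remainder k z\<bar> \<partial>std_gauss) \<le> c * (norm k)\<^sup>2"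
proof -
  define a where "a = (\<integral>z. 2 * exp 1 * ((1 + norm z)\<^sup>2 * exp (1 * norm z)) \<partial>(std_gauss :: 'a measure))"
  define b where "b = (\<integral>z. (1 + norm z) ^ 1 \<partial>(std_gauss :: 'a measure))"
  have ab: "0 \<le> a" "0 \<le> b" unfolding a_def b_def by (rule Bochner_Integration.integral_nonneg; simp)+
  have tilt: "integrable std_gauss (gauss_tilt k)" "(\<integral>z. gauss_tilt k z \<partial>std_gauss) = 1" for k :: 'a
    using has_bochner_integral_gauss_tilt[of k] by (simp_all add: has_bochner_integral_iff)
  note int = integrable_gauss_tilt_remainder
  have "(\<integral>z. \<bar>gauss_tilt_remainder k z\<bar> \<partial>std_gauss) \<le> (a + 2 + b) * (norm k)\<^sup>2" for k :: 'a
  proof (cases "norm k \<le> 1")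
    case True
    have "(\<integral>z. \<bar>gauss_tilt_remainder k z\<bar> \<partial>std_gauss) \<le>
        (\<integral>z. (norm k)\<^sup>2 * (2 * exp 1 * ((1 + norm z)\<^sup>2 * exp (1 * norm z))) \<partial>(std_gauss :: 'a measure))"
      using abs_gauss_tilt_remainder_le[OF True] int
      by (intro integral_mono integrable_abs integrable_mult_right integrable_std_gauss_power_exp) simp_all
    also have "\<dots> = a * (norm k)\<^sup>2" unfolding a_def integral_mult_right_zero by (rule mult.commute)
    also have "\<dots> \<le> (a + 2 + b) * (norm k)\<^sup>2" using ab by (intro mult_right_mono) auto
    finally show ?thesis .
  next
    case False
    have "\<bar>gauss_tilt_remainder k z\<bar> \<le> gauss_tilt k z + 1 + norm k * (1 + norm z) ^ 1" for z
      using Cauchy_Schwarz_ineq2[of z k] norm_ge_zero[of k] exp_ge_zero[of "z \<bullet> k - (norm k)\<^sup>2 / 2"]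
      unfolding gauss_tilt_remainder_def gauss_tilt_def power_one_right distrib_left mult.commute[of "norm k" "norm z"]
      by linarith
    then have "(\<integral>z. \<bar>gauss_tilt_remainder k z\<bar> \<partial>std_gauss) \<le>
        (\<integral>z. gauss_tilt k z + 1 + norm k * (1 + norm z) ^ 1 \<partial>std_gauss)"
      using int tilt(1) integrable_std_gauss_power[of 1, where 'a = 'a]
      by (intro integral_mono integrable_abs Bochner_Integration.integrable_add integrable_mult_right) auto
    also have "\<dots> = 2 * 1 + b * norm k"
      using tilt integrable_std_gauss_power[of 1, where 'a = 'a] by (simp add: b_def)
    also have "\<dots> \<le> 2 * (norm k)\<^sup>2 + b * (norm k)\<^sup>2"
      using False ab by (intro add_mono mult_left_mono) (auto intro: self_le_power one_le_power)
    also have "\<dots> \<le> (a + 2 + b) * (norm k)\<^sup>2"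
      using mult_nonneg_nonneg[OF ab(1) zero_le_power2[of "norm k"]] by (simp add: algebra_simps)
    finally show ?thesis .
  qed
  then show ?thesis by (rule that)
qed

abbreviation mollify :: "real \<Rightarrow> ('a::euclidean_space \<Rightarrow> real) \<Rightarrow> 'a \<Rightarrow> real" where
  "mollify \<equiv> gauss_avg (\<lambda>z. z)"

definition mollify_gradient :: "real \<Rightarrow> ('a::euclidean_space \<Rightarrow> real) \<Rightarrow> 'a \<Rightarrow> 'a" where
  "mollify_gradient \<delta> F x = (\<integral>z. (F (x + \<delta> *\<^sub>R z) / \<delta>) *\<^sub>R z \<partial>std_gauss)"

lemma integrable_mollify_gradient:
  fixes F :: "'a::euclidean_space \<Rightarrow> real"
  assumes F: "borel_between e M F" and \<delta>: "0 < \<delta>"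
  shows "integrable std_gauss (\<lambda>z. (F (x + \<delta> *\<^sub>R z) / \<delta>) *\<^sub>R z)"
proof (rule Bochner_Integration.integrable_bound)
  note [measurable] = borel_betweenD(1)[OF F]
  show "(\<lambda>z. (F (x + \<delta> *\<^sub>R z) / \<delta>) *\<^sub>R z) \<in> borel_measurable std_gauss" by measurable
  let ?K = "(\<bar>e\<bar> + \<bar>M\<bar>) / \<delta>"
  show "integrable std_gauss (\<lambda>z::'a. ?K * (1 + norm z) ^ 1)"
    by (intro integrable_mult_right integrable_std_gauss_power)
  show "AE z in std_gauss. norm ((F (x + \<delta> *\<^sub>R z) / \<delta>) *\<^sub>R z) \<le> norm (?K * (1 + norm z) ^ 1)"
    using borel_betweenD(4)[OF F] \<delta>
    by (intro always_eventually allI) (auto simp: abs_mult intro!: mult_mono divide_right_mono)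
qed

lemma mollify_taylor_remainder:
  fixes F :: "'a::euclidean_space \<Rightarrow> real"
  assumes F: "borel_between e M F" and e: "0 \<le> e" and \<delta>: "0 < \<delta>"
  shows "integrable std_gauss (\<lambda>z. F (x + \<delta> *\<^sub>R z) * gauss_tilt_remainder k z)"
    and "mollify \<delta> F (x + \<delta> *\<^sub>R k) - mollify \<delta> F x - mollify_gradient \<delta> F x \<bullet> (\<delta> *\<^sub>R k) =
      (\<integral>z. F (x + \<delta> *\<^sub>R z) * gauss_tilt_remainder k z \<partial>std_gauss)"
proof -
  note [measurable] = borel_betweenD(1)[OF F]
  have F_pos: "0 \<le> F y" and F_abs: "\<bar>F y\<bar> \<le> M" for y
    using borel_betweenD(2,3)[OF F, of y] e by linarith+
  have iF: "integrable std_gauss (\<lambda>z. F (x + \<delta> *\<^sub>R z))"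
    by (rule integrable_borel_between[OF F]) simp
  show iR: "integrable std_gauss (\<lambda>z. F (x + \<delta> *\<^sub>R z) * gauss_tilt_remainder k z)"
  proof (rule Bochner_Integration.integrable_bound[OF integrable_mult_right[OF integrable_gauss_tilt_remainder]])
    show "AE z in std_gauss. norm (F (x + \<delta> *\<^sub>R z) * gauss_tilt_remainder k z) \<le> norm (M * gauss_tilt_remainder k z)"
      unfolding real_norm_def abs_mult
      by (intro always_eventually allI mult_right_mono order_trans[OF F_abs abs_ge_self] abs_ge_zero)
  qed (simp add: gauss_tilt_remainder_def)
  note ia = integrable_mollify_gradient[OF F \<delta>, of x]
  have iFz: "integrable std_gauss (\<lambda>z. F (x + \<delta> *\<^sub>R z) * (z \<bullet> k))"
    using integrable_inner_left[OF ia, of "\<delta> *\<^sub>R k"] \<delta> by simp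
  have iT: "integrable std_gauss (\<lambda>z. F (x + \<delta> *\<^sub>R z) * gauss_tilt k z)"
    using Bochner_Integration.integrable_add[OF Bochner_Integration.integrable_add[OF iR iF] iFz]
    by (simp add: gauss_tilt_remainder_def algebra_simps)
  have "mollify \<delta> F (x + \<delta> *\<^sub>R k) = (\<integral>z. F (x + \<delta> *\<^sub>R (z + k)) \<partial>std_gauss)"
    unfolding gauss_avg_def by (simp add: scaleR_add_right add_ac)
  also have "\<dots> = (\<integral>z. F (x + \<delta> *\<^sub>R z) * gauss_tilt k z \<partial>std_gauss)"
    by (rule integral_std_gauss_shift[of "\<lambda>z. F (x + \<delta> *\<^sub>R z)"]) (use F_pos in auto)
  finally have "mollify \<delta> F (x + \<delta> *\<^sub>R k) = (\<integral>z. F (x + \<delta> *\<^sub>R z) * gauss_tilt k z \<partial>std_gauss)" .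
  moreover have "mollify_gradient \<delta> F x \<bullet> (\<delta> *\<^sub>R k) = (\<integral>z. F (x + \<delta> *\<^sub>R z) * (z \<bullet> k) \<partial>std_gauss)"
    unfolding mollify_gradient_def by (subst integral_inner_left[symmetric]) (use ia \<delta> in auto)
  ultimately show "mollify \<delta> F (x + \<delta> *\<^sub>R k) - mollify \<delta> F x - mollify_gradient \<delta> F x \<bullet> (\<delta> *\<^sub>R k) =
      (\<integral>z. F (x + \<delta> *\<^sub>R z) * gauss_tilt_remainder k z \<partial>std_gauss)"
    using iF iT iFz by (simp add: gauss_avg_def[of _ _ _ x] gauss_tilt_remainder_def right_diff_distrib)
qed

lemma C11_bounded_mollify:
  fixes F :: "'a::euclidean_space \<Rightarrow> real"
  assumes F: "borel_between e M F" and e: "0 \<le> e" and \<delta>: "0 < \<delta>"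
  obtains L where "C11_bounded e M L (mollify \<delta> F) (mollify_gradient \<delta> F)"
proof -
  note [measurable] = borel_betweenD(1)[OF F]
  have F_abs: "\<bar>F x\<bar> \<le> M" for x
    using borel_betweenD(2,3)[OF F, of x] e by linarith
  then have M: "0 \<le> M" by (rule order_trans[OF abs_ge_zero])
  obtain c where c: "(\<integral>z. \<bar>gauss_tilt_remainder k z\<bar> \<partial>std_gauss) \<le> c * (norm k)\<^sup>2" for k :: 'a
    using gauss_tilt_remainder_L1 by blast
  have "\<bar>mollify \<delta> F (x + v) - mollify \<delta> F x - mollify_gradient \<delta> F x \<bullet> v\<bar> \<le> M * c / \<delta>\<^sup>2 * (norm v)\<^sup>2" for x v
  proof -
    define k where "k = (1 / \<delta>) *\<^sub>R v"
    have v: "v = \<delta> *\<^sub>R k" using \<delta> by (simp add: k_def)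
    let ?R = "\<lambda>z. F (x + \<delta> *\<^sub>R z) * gauss_tilt_remainder k z"
    note remainder = mollify_taylor_remainder[OF F e \<delta>, of x k, folded v]
    have "\<bar>\<integral>z. ?R z \<partial>std_gauss\<bar> \<le> (\<integral>z. \<bar>?R z\<bar> \<partial>std_gauss)" by (rule integral_abs_bound)
    also have "\<dots> \<le> (\<integral>z. M * \<bar>gauss_tilt_remainder k z\<bar> \<partial>std_gauss)"
      unfolding abs_mult using remainder(1) F_abs
      by (intro integral_mono integrable_mult_right integrable_abs integrable_gauss_tilt_remainder mult_right_mono)
        (simp_all add: abs_mult[symmetric])
    also have "\<dots> \<le> M * (c * (norm k)\<^sup>2)"
      unfolding integral_mult_right_zero using c M by (rule mult_left_mono)
    also have "\<dots> = M * c / \<delta>\<^sup>2 * (norm v)\<^sup>2" by (simp add: k_def power_divide)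
    finally show ?thesis unfolding remainder(2) .
  qed
  moreover have "mollify_gradient \<delta> F \<in> borel_measurable borel"
    unfolding mollify_gradient_def[abs_def] by (rule borel_measurable_integral_std_gauss) measurable
  moreover have "borel_between e M (mollify \<delta> F)" by (rule borel_between_gauss_avg[OF F]) simp
  ultimately have "C11_bounded e M (M * c / \<delta>\<^sup>2) (mollify \<delta> F) (mollify_gradient \<delta> F)"
    unfolding C11_bounded_def by blast
  then show ?thesis by (rule that)
qed

lemma gauss_avg_tendsto_self:
  fixes F :: "'a::euclidean_space \<Rightarrow> real"
  assumes F: "continuous_on UNIV F" and bF: "borel_between e M F"
  shows "(\<lambda>n. mollify (inverse (real (Suc n))) F x) \<longlonglongrightarrow> F x"
proof -
  note [measurable] = borel_betweenD(1)[OF bF]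
  have "(\<lambda>n. mollify (inverse (real (Suc n))) F x) \<longlonglongrightarrow> (\<integral>z. F x \<partial>(std_gauss :: 'a measure))"
    unfolding gauss_avg_def
  proof (rule integral_dominated_convergence[where w = "\<lambda>_. \<bar>e\<bar> + \<bar>M\<bar>"])
    have "(\<lambda>n. F (x + inverse (real (Suc n)) *\<^sub>R z)) \<longlonglongrightarrow> F x" for z
    proof -
      have "(\<lambda>n. x + inverse (real (Suc n)) *\<^sub>R z) \<longlonglongrightarrow> x + 0 *\<^sub>R z"
        by (intro tendsto_intros LIMSEQ_inverse_real_of_nat)
      moreover have "isCont F x" using F by (simp add: continuous_on_eq_continuous_at)
      ultimately show ?thesis using isCont_tendsto_compose[of x F] by simp
    qed
    then show "AE z in std_gauss. (\<lambda>n. F (x + inverse (real (Suc n)) *\<^sub>R z)) \<longlonglongrightarrow> F x" by simp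
  qed (use borel_betweenD(4)[OF bF] in auto)
  then show ?thesis by simp
qed

lemma borel_between_AE_limit_continuous:
  fixes F :: "'a::euclidean_space \<Rightarrow> real"
  assumes bF: "borel_between e M F"
  obtains Fs where "\<And>n. continuous_on UNIV (Fs n)" "\<And>n. borel_between e M (Fs n)"
    "AE x in lborel. (\<lambda>n. Fs n x) \<longlonglongrightarrow> F x"
proof -
  note F = borel_betweenD(1-3)[OF bF]
  note [measurable] = F(1)
  have "F measurable_on UNIV"
    by (rule lebesgue_measurable_imp_measurable_on_real) (auto intro: measurable_completion)
  then obtain N g where N: "negligible N" and g: "\<And>n. continuous_on UNIV (g n)"
    and lim: "\<And>x. x \<notin> N \<Longrightarrow> (\<lambda>n. g n x) \<longlonglongrightarrow> F x"
    by (auto simp: measurable_on_def)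
  define Fs where "Fs n x = max e (min M (g n x))" for n x
  have cont: "continuous_on UNIV (Fs n)" for n unfolding Fs_def[abs_def] by (intro continuous_intros g)
  have [measurable]: "Fs n \<in> borel_measurable borel" for n using cont by (rule borel_measurable_continuous_onI)
  have "(\<lambda>n. Fs n x) \<longlonglongrightarrow> F x" if "x \<notin> N" for x
  proof -
    have "(\<lambda>n. Fs n x) \<longlonglongrightarrow> max e (min M (F x))"
      unfolding Fs_def by (intro tendsto_intros lim that)
    then show ?thesis using F(2,3)[of x] by simp
  qed
  moreover have "AE x in lebesgue. x \<notin> N"
    using N by (intro AE_not_in) (simp add: negligible_iff_null_sets)
  ultimately have "AE x in lebesgue. (\<lambda>n. Fs n x) \<longlonglongrightarrow> F x" by auto
  then have "AE x in lborel. (\<lambda>n. Fs n x) \<longlonglongrightarrow> F x" by (simp add: AE_completion_iff)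
  moreover have "borel_between e M (Fs n)" for n
    unfolding borel_between_def using F(2,3)[of undefined] by (auto simp: Fs_def)
  ultimately show ?thesis using that cont by blast
qed

context gauss_pair
begin

lemma continuous_hoelder:
  assumes e: "0 < e" and F: "continuous_on UNIV F" "borel_between e M F"
    and G: "continuous_on UNIV G" "borel_between e M G"
  shows "FG_avg 1 F G (x, y) \<le> avg_FG 1 F G (x, y)"
proof (rule hoelder_limit[OF e _ _ F(2) G(2)])
  show "borel_between e M (mollify (inverse (real (Suc n))) F)"
    "borel_between e M (mollify (inverse (real (Suc n))) G)" for n
    by (intro borel_between_gauss_avg F G; simp)+
  show "AE w in std_gauss. (\<lambda>n. mollify (inverse (real (Suc n))) F (x + X w)) \<longlonglongrightarrow> F (x + X w)"
    using gauss_avg_tendsto_self[OF F] by simp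
  show "AE w in std_gauss. (\<lambda>n. mollify (inverse (real (Suc n))) G (y + Y w)) \<longlonglongrightarrow> G (y + Y w)"
    using gauss_avg_tendsto_self[OF G] by simp
  fix n
  let ?F = "mollify (inverse (real (Suc n))) F" and ?G = "mollify (inverse (real (Suc n))) G"
  have \<delta>: "0 < inverse (real (Suc n))" by simp
  let ?a = "mollify_gradient (inverse (real (Suc n))) F"
  let ?b = "mollify_gradient (inverse (real (Suc n))) G"
  obtain L1 where "C11_bounded e M L1 ?F ?a" using C11_bounded_mollify[OF F(2) less_imp_le[OF e] \<delta>] .
  moreover obtain L2 where "C11_bounded e M L2 ?G ?b" using C11_bounded_mollify[OF G(2) less_imp_le[OF e] \<delta>] .
  ultimately have "C11_bounded e M (max L1 L2) ?F ?a" "C11_bounded e M (max L1 L2) ?G ?b"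
    by (auto elim: C11_bounded_mono)
  then show "FG_avg 1 ?F ?G (x, y) \<le> avg_FG 1 ?F ?G (x, y)" by (rule C11_hoelder[OF e])
qed

theorem gauss_hoelder:
  assumes e: "0 < e" and F: "borel_between e M F" and G: "borel_between e M G"
    and acX: "absolutely_continuous lborel (distr std_gauss borel (\<lambda>w. x + X w))"
    and acY: "absolutely_continuous lborel (distr std_gauss borel (\<lambda>w. y + Y w))"
  shows "FG_avg 1 F G (x, y) \<le> avg_FG 1 F G (x, y)"
proof -
  obtain Fs where Fs: "\<And>n. continuous_on UNIV (Fs n)" "\<And>n. borel_between e M (Fs n)"
    and limF: "AE x in lborel. (\<lambda>n. Fs n x) \<longlonglongrightarrow> F x"
    using borel_between_AE_limit_continuous[OF F] by blast
  obtain Gs where Gs: "\<And>n. continuous_on UNIV (Gs n)" "\<And>n. borel_between e M (Gs n)"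
    and limG: "AE x in lborel. (\<lambda>n. Gs n x) \<longlonglongrightarrow> G x"
    using borel_between_AE_limit_continuous[OF G] by blast
  show ?thesis
  proof (rule hoelder_limit[OF e Fs(2) Gs(2) F G])
    show "AE w in std_gauss. (\<lambda>n. Fs n (x + X w)) \<longlonglongrightarrow> F (x + X w)"
      using absolutely_continuous_AE[OF _ acX limF] by (intro AE_distrD[of "\<lambda>w. x + X w"]) auto
    show "AE w in std_gauss. (\<lambda>n. Gs n (y + Y w)) \<longlonglongrightarrow> G (y + Y w)"
      using absolutely_continuous_AE[OF _ acY limG] by (intro AE_distrD[of "\<lambda>w. y + Y w"]) auto
  qed (rule continuous_hoelder[OF e Fs Gs])
qed

end

section \<open>Hypercontractivity of Markov kernels by duality\<close>

lemma le_one_plus_powr: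
  fixes s r :: real assumes "1 \<le> r" "0 \<le> s" shows "s \<le> 1 + s powr r"
proof (cases "s \<le> 1")
  case False
  then have "s powr 1 \<le> s powr r" using assms by (intro powr_mono) auto
  with False show ?thesis by simp
qed (simp add: add_increasing2)

lemma self_le_powr_mult_imp_le:
  fixes I b p :: real
  assumes p: "1 < p" and b: "0 \<le> b" and I: "0 < I" "I \<le> I powr (1 - 1 / p) * b"
  shows "I \<le> b powr p"
proof -
  have "I powr (1 - 1 / p) * I powr (1 / p) = I" using I(1) by (simp add: powr_add[symmetric])
  with I have "I powr (1 - 1 / p) * I powr (1 / p) \<le> I powr (1 - 1 / p) * b" by simp
  then have "I powr (1 / p) \<le> b" using I(1) by simp
  then have "(I powr (1 / p)) powr p \<le> b powr p" using p by (intro powr_mono2) auto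
  then show ?thesis using I(1) p by (simp add: powr_powr)
qed

lemma powr_in_interval:
  fixes \<phi> :: "'a \<Rightarrow> real"
  assumes "\<phi> \<in> A \<rightarrow> {e..M}" "0 \<le> e" "0 \<le> r"
  shows "(\<lambda>x. \<phi> x powr r) \<in> A \<rightarrow> {e powr r..M powr r}"
proof (rule Pi_I)
  fix x assume "x \<in> A"
  then have "e \<le> \<phi> x" "\<phi> x \<le> M" using assms(1) by auto
  then show "\<phi> x powr r \<in> {e powr r..M powr r}" using assms(2,3) by (auto intro!: powr_mono2)
qed

text \<open>For \<open>F = (P \<phi>)\<^sup>p\<close> and \<open>G = \<phi>\<^sup>q\<close> the left-hand side of \<open>hoelder\<close> is the integral of \<open>(P \<phi>)\<^sup>p\<close>.\<close>

locale hoelder_kernel = prob_space \<mu> for \<mu> :: "'a measure" +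
  fixes N :: "'b measure" and K :: "'a \<Rightarrow> 'b measure" and p q :: real
  assumes K: "K \<in> \<mu> \<rightarrow>\<^sub>M prob_algebra N" and p: "1 < p" and q: "1 < q"
    and hoelder: "\<And>F G e M. \<lbrakk>F \<in> borel_measurable \<mu>; G \<in> borel_measurable N; 0 < e;
      F \<in> space \<mu> \<rightarrow> {e..M}; G \<in> space N \<rightarrow> {e..M}\<rbrakk> \<Longrightarrow>
      (\<integral>x. F x powr (1 - 1 / p) * (\<integral>y. G y powr (1 / q) \<partial>K x) \<partial>\<mu>) \<le>
      (\<integral>x. F x \<partial>\<mu>) powr (1 - 1 / p) * (\<integral>y. G y \<partial>(\<mu> \<bind> K)) powr (1 / q)"
begin

lemmas K_subprob [measurable] = measurable_prob_algebraD[OF K]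

abbreviation \<nu> :: "'b measure" where
  "\<nu> \<equiv> \<mu> \<bind> K"

definition P :: "('b \<Rightarrow> real) \<Rightarrow> 'a \<Rightarrow> real" where
  "P \<phi> x = (\<integral>y. \<phi> y \<partial>K x)"

lemma K_space:
  assumes "x \<in> space \<mu>"
  shows "prob_space (K x)" "sets (K x) = sets N" "space (K x) = space N"
  using measurable_space[OF K assms] sets_eq_imp_space_eq[of "K x" N] by (auto simp: space_prob_algebra)

lemma sets_\<nu> [measurable_cong, simp]: "sets \<nu> = sets N"
  using K_space(2) not_empty by (intro sets_bind) auto

lemma space_\<nu> [simp]: "space \<nu> = space N"
  by (rule sets_eq_imp_space_eq) simp

lemma prob_space_\<nu>: "prob_space \<nu>"
  using K_space(1) by (intro prob_space_bind[where S = N] AE_I2) auto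

lemma borel_measurable_P [measurable]:
  assumes [measurable]: "\<phi> \<in> borel_measurable N"
  shows "P \<phi> \<in> borel_measurable \<mu>"
  unfolding P_def[abs_def] by (rule measurable_compose[OF K_subprob]) measurable

lemma integrable_K:
  fixes \<phi> :: "'b \<Rightarrow> real"
  assumes "\<phi> \<in> borel_measurable N" "\<phi> \<in> space N \<rightarrow> {e..M}" "x \<in> space \<mu>"
  shows "integrable (K x) \<phi>"
proof -
  interpret Kx: prob_space "K x" by (rule K_space(1)[OF assms(3)])
  show ?thesis
    using assms K_space[OF assms(3)]
    by (intro Kx.integrable_const_bound[where B = "max \<bar>e\<bar> \<bar>M\<bar>"])
      (force simp: Pi_iff abs_le_iff intro!: AE_I2 cong: measurable_cong_sets)+
qed

lemma P_between:
  assumes \<phi>: "\<phi> \<in> borel_measurable N" "\<phi> \<in> space N \<rightarrow> {e..M}" and x: "x \<in> space \<mu>"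
  shows "e \<le> P \<phi> x" "P \<phi> x \<le> M"
proof -
  interpret Kx: prob_space "K x" by (rule K_space(1)[OF x])
  show "e \<le> P \<phi> x" "P \<phi> x \<le> M"
    unfolding P_def using \<phi>(2) K_space(3)[OF x] integrable_K[OF \<phi> x]
    by (auto intro!: Kx.integral_ge_const Kx.integral_le_const AE_I2)
qed

lemma P_mono:
  assumes "\<phi> \<in> borel_measurable N" "\<phi> \<in> space N \<rightarrow> {e..M}" "\<psi> \<in> borel_measurable N" "\<psi> \<in> space N \<rightarrow> {e'..M'}"
    and "\<And>y. y \<in> space N \<Longrightarrow> \<phi> y \<le> \<psi> y" and x: "x \<in> space \<mu>"
  shows "P \<phi> x \<le> P \<psi> x"
  unfolding P_def using assms K_space(3)[OF x] by (intro integral_mono integrable_K[OF _ _ x]) simp_all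

lemma integrable_P_powr:
  assumes [measurable]: "\<phi> \<in> borel_measurable N" and b: "\<phi> \<in> space N \<rightarrow> {0..M}"
  shows "integrable \<mu> (\<lambda>x. P \<phi> x powr p)"
  using P_between[OF assms] p
  by (intro integrable_const_bound[where B = "M powr p"] AE_I2) (auto intro!: powr_mono2)

lemma P_powr_eq:
  assumes \<phi>: "\<phi> \<in> borel_measurable N" "\<phi> \<in> space N \<rightarrow> {e..M}" and e: "0 < e" and x: "x \<in> space \<mu>"
  shows "(P \<phi> x powr p) powr (1 - 1 / p) * (\<integral>y. (\<phi> y powr q) powr (1 / q) \<partial>K x) = P \<phi> x powr p"
proof -
  have "(\<integral>y. (\<phi> y powr q) powr (1 / q) \<partial>K x) = P \<phi> x"
    unfolding P_def using \<phi>(2) e q K_space(3)[OF x]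
    by (intro Bochner_Integration.integral_cong) (force simp: powr_powr Pi_iff)+
  moreover have "(P \<phi> x powr p) powr (1 - 1 / p) = P \<phi> x powr (p - 1)"
    using p by (simp add: powr_powr right_diff_distrib)
  moreover have "P \<phi> x powr (p - 1) * P \<phi> x = P \<phi> x powr p"
    using P_between(1)[OF \<phi> x] e by (simp add: powr_diff)
  ultimately show ?thesis by simp
qed

lemma hypercontractive_between:
  assumes \<phi> [measurable]: "\<phi> \<in> borel_measurable N" and e: "0 < e"
    and b: "\<phi> \<in> space N \<rightarrow> {e..M}"
  shows "(\<integral>x. P \<phi> x powr p \<partial>\<mu>) \<le> (\<integral>y. \<phi> y powr q \<partial>\<nu>) powr (p / q)"
proof -
  define I where "I = (\<integral>x. P \<phi> x powr p \<partial>\<mu>)"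
  define J where "J = (\<integral>y. \<phi> y powr q \<partial>\<nu>)"
  have P_b: "(\<lambda>x. P \<phi> x powr p) \<in> space \<mu> \<rightarrow> {e powr p..M powr p}"
    using P_between[OF \<phi> b] e p by (intro powr_in_interval) auto
  have \<phi>_b: "(\<lambda>y. \<phi> y powr q) \<in> space N \<rightarrow> {e powr q..M powr q}"
    using b e q by (intro powr_in_interval) auto
  have "I = (\<integral>x. (P \<phi> x powr p) powr (1 - 1 / p) * (\<integral>y. (\<phi> y powr q) powr (1 / q) \<partial>K x) \<partial>\<mu>)"
    unfolding I_def by (intro Bochner_Integration.integral_cong refl P_powr_eq[OF \<phi> b e, symmetric])
  also have "\<dots> \<le> I powr (1 - 1 / p) * J powr (1 / q)"
    unfolding I_def J_def
  proof (rule hoelder[where e = "min (e powr p) (e powr q)" and M = "max (M powr p) (M powr q)"])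
    show "(\<lambda>x. P \<phi> x powr p) \<in> space \<mu> \<rightarrow> {min (e powr p) (e powr q)..max (M powr p) (M powr q)}"
      using P_b by (auto simp: Pi_iff min_le_iff_disj le_max_iff_disj)
    show "(\<lambda>y. \<phi> y powr q) \<in> space N \<rightarrow> {min (e powr p) (e powr q)..max (M powr p) (M powr q)}"
      using \<phi>_b by (auto simp: Pi_iff min_le_iff_disj le_max_iff_disj)
  qed (use e in auto)
  finally have "I \<le> I powr (1 - 1 / p) * J powr (1 / q)" .
  moreover have "0 < I"
  proof -
    have "integrable \<mu> (\<lambda>x. P \<phi> x powr p)" using b e by (intro integrable_P_powr[where M = M]) (force simp: Pi_iff)+
    then have "e powr p \<le> I" unfolding I_def using P_b by (intro integral_ge_const AE_I2) auto
    then show ?thesis using e by (intro less_le_trans[OF _ \<open>e powr p \<le> I\<close>]) simp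
  qed
  ultimately have "I \<le> (J powr (1 / q)) powr p"
    by (intro self_le_powr_mult_imp_le[OF p powr_ge_zero])
  then show ?thesis by (simp add: powr_powr I_def J_def)
qed

lemma tendsto_integral_powr_add_inverse:
  assumes [measurable]: "\<phi> \<in> borel_measurable N" and b: "\<phi> \<in> space N \<rightarrow> {0..M}"
  shows "(\<lambda>n. \<integral>y. (\<phi> y + inverse (real (Suc n))) powr q \<partial>\<nu>) \<longlonglongrightarrow> (\<integral>y. \<phi> y powr q \<partial>\<nu>)"
proof (rule integral_dominated_convergence[where w = "\<lambda>_. (M + 1) powr q"])
  interpret \<nu>: prob_space \<nu> by (rule prob_space_\<nu>)
  show "integrable \<nu> (\<lambda>_. (M + 1) powr q)" by simp
  have bounds: "0 \<le> \<phi> y" "0 \<le> \<phi> y + inverse (real (Suc n))" "\<phi> y + inverse (real (Suc n)) \<le> M + 1"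
    if "y \<in> space \<nu>" for n y
    using b that by (auto simp: Pi_iff inverse_le_1_iff intro!: add_mono add_nonneg_nonneg)
  have "(\<lambda>n. \<phi> y + inverse (real (Suc n))) \<longlonglongrightarrow> \<phi> y + 0" for y
    by (intro tendsto_intros LIMSEQ_inverse_real_of_nat)
  then show "AE y in \<nu>. (\<lambda>n. (\<phi> y + inverse (real (Suc n))) powr q) \<longlonglongrightarrow> \<phi> y powr q"
    using q bounds by (intro AE_I2 tendsto_powr2 always_eventually allI) auto
  show "AE y in \<nu>. norm ((\<phi> y + inverse (real (Suc n))) powr q) \<le> (M + 1) powr q" for n
    using q bounds by (intro AE_I2) (auto intro!: powr_mono2 simp del: of_nat_Suc)
qed measurable

lemma hypercontractive_bounded:
  assumes \<phi> [measurable]: "\<phi> \<in> borel_measurable N" and b: "\<phi> \<in> space N \<rightarrow> {0..M}"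
  shows "(\<integral>x. P \<phi> x powr p \<partial>\<mu>) \<le> (\<integral>y. \<phi> y powr q \<partial>\<nu>) powr (p / q)"
proof (rule LIMSEQ_le_const)
  show "(\<lambda>n. (\<integral>y. (\<phi> y + inverse (real (Suc n))) powr q \<partial>\<nu>) powr (p / q)) \<longlonglongrightarrow>
      (\<integral>y. \<phi> y powr q \<partial>\<nu>) powr (p / q)"
    using p q tendsto_integral_powr_add_inverse[OF assms] by (intro tendsto_powr2 always_eventually) auto
  have "(\<integral>x. P \<phi> x powr p \<partial>\<mu>) \<le> (\<integral>y. (\<phi> y + inverse (real (Suc n))) powr q \<partial>\<nu>) powr (p / q)" for n
  proof -
    define \<epsilon> where "\<epsilon> = inverse (real (Suc n))"
    have \<epsilon>: "0 < \<epsilon>" by (simp add: \<epsilon>_def)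
    let ?\<phi> = "\<lambda>y. \<phi> y + \<epsilon>"
    have b': "?\<phi> \<in> space N \<rightarrow> {\<epsilon>..M + \<epsilon>}" using b by (auto simp: Pi_iff)
    then have b0: "?\<phi> \<in> space N \<rightarrow> {0..M + \<epsilon>}" using \<epsilon> by (auto simp: Pi_iff)
    have "(\<integral>x. P \<phi> x powr p \<partial>\<mu>) \<le> (\<integral>x. P ?\<phi> x powr p \<partial>\<mu>)"
    proof (rule integral_mono)
      fix x assume x: "x \<in> space \<mu>"
      have "P \<phi> x \<le> P ?\<phi> x" using \<epsilon> by (intro P_mono[OF \<phi> b _ b0 _ x]) auto
      then show "P \<phi> x powr p \<le> P ?\<phi> x powr p"
        using P_between(1)[OF \<phi> b x] p by (intro powr_mono2) auto
    qed (use \<phi> b b0 in \<open>auto intro!: integrable_P_powr\<close>)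
    also have "\<dots> \<le> (\<integral>y. ?\<phi> y powr q \<partial>\<nu>) powr (p / q)"
      by (rule hypercontractive_between[OF _ \<epsilon> b']) measurable
    finally show ?thesis unfolding \<epsilon>_def .
  qed
  then show "\<exists>N. \<forall>n\<ge>N. (\<integral>x. P \<phi> x powr p \<partial>\<mu>) \<le>
      (\<integral>y. (\<phi> y + inverse (real (Suc n))) powr q \<partial>\<nu>) powr (p / q)" by blast
qed

lemma AE_integrable_K:
  assumes \<phi> [measurable]: "\<phi> \<in> borel_measurable N" and Lq: "integrable \<nu> (\<lambda>y. \<bar>\<phi> y\<bar> powr q)"
  shows "AE x in \<mu>. integrable (K x) \<phi>"
proof -
  interpret \<nu>: prob_space \<nu> by (rule prob_space_\<nu>)
  have "integrable \<nu> \<phi>"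
  proof (rule Bochner_Integration.integrable_bound)
    show "integrable \<nu> (\<lambda>y. 1 + \<bar>\<phi> y\<bar> powr q)" using Lq by simp
    show "AE y in \<nu>. norm (\<phi> y) \<le> norm (1 + \<bar>\<phi> y\<bar> powr q)"
      using le_one_plus_powr[of q "\<bar>\<phi> y\<bar>" for y] q by (simp add: abs_of_nonneg)
  qed measurable
  then have "(\<integral>\<^sup>+x. (\<integral>\<^sup>+y. norm (\<phi> y) \<partial>K x) \<partial>\<mu>) < \<infinity>"
    by (simp add: integrable_iff_bounded nn_integral_bind[OF _ K_subprob])
  then have "AE x in \<mu>. (\<integral>\<^sup>+y. norm (\<phi> y) \<partial>K x) \<noteq> \<infinity>"
    by (intro nn_integral_PInf_AE) auto
  with AE_space show ?thesis
  proof eventually_elim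
    case (elim x)
    then show ?case
      using K_space(2)[OF elim(1)] by (simp add: integrable_iff_bounded less_top cong: measurable_cong_sets)
  qed
qed

lemma P_truncation_tendsto:
  assumes \<phi> [measurable]: "\<phi> \<in> borel_measurable N" and x: "x \<in> space \<mu>" and int: "integrable (K x) \<phi>"
  shows "(\<lambda>n. P (\<lambda>y. min \<bar>\<phi> y\<bar> (real n)) x) \<longlonglongrightarrow> P (\<lambda>y. \<bar>\<phi> y\<bar>) x"
  unfolding P_def
proof (rule integral_dominated_convergence[where w = "\<lambda>y. \<bar>\<phi> y\<bar>"])
  have [measurable]: "\<phi> \<in> borel_measurable (K x)"
    using \<phi> K_space(2)[OF x] by (simp cong: measurable_cong_sets)
  show "(\<lambda>y. \<bar>\<phi> y\<bar>) \<in> borel_measurable (K x)" "(\<lambda>y. min \<bar>\<phi> y\<bar> (real n)) \<in> borel_measurable (K x)" for n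
    by measurable
  have "(\<lambda>n. min \<bar>\<phi> y\<bar> (real n)) \<longlonglongrightarrow> \<bar>\<phi> y\<bar>" for y
  proof (rule tendsto_eventually)
    obtain m where "\<bar>\<phi> y\<bar> \<le> real m" using real_arch_simple by blast
    then show "\<forall>\<^sub>F n in sequentially. min \<bar>\<phi> y\<bar> (real n) = \<bar>\<phi> y\<bar>"
      by (intro eventually_sequentiallyI[of m]) (auto simp: min_def)
  qed
  then show "AE y in K x. (\<lambda>n. min \<bar>\<phi> y\<bar> (real n)) \<longlonglongrightarrow> \<bar>\<phi> y\<bar>" by simp
qed (use int in auto)

lemma nn_integral_P_truncation_le:
  assumes \<phi> [measurable]: "\<phi> \<in> borel_measurable N" and Lq: "integrable \<nu> (\<lambda>y. \<bar>\<phi> y\<bar> powr q)"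
  shows "(\<integral>\<^sup>+x. ennreal (P (\<lambda>y. min \<bar>\<phi> y\<bar> (real n)) x powr p) \<partial>\<mu>) \<le>
    ennreal ((\<integral>y. \<bar>\<phi> y\<bar> powr q \<partial>\<nu>) powr (p / q))"
proof -
  let ?\<phi> = "\<lambda>y. min \<bar>\<phi> y\<bar> (real n)"
  have b: "?\<phi> \<in> space N \<rightarrow> {0..real n}" by auto
  have "(\<integral>\<^sup>+x. ennreal (P ?\<phi> x powr p) \<partial>\<mu>) = ennreal (\<integral>x. P ?\<phi> x powr p \<partial>\<mu>)"
    by (intro nn_integral_eq_integral integrable_P_powr[OF _ b]) simp_all
  also have "\<dots> \<le> ennreal ((\<integral>y. ?\<phi> y powr q \<partial>\<nu>) powr (p / q))"
    by (intro ennreal_leI hypercontractive_bounded[OF _ b]) simp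
  also have "\<dots> \<le> ennreal ((\<integral>y. \<bar>\<phi> y\<bar> powr q \<partial>\<nu>) powr (p / q))"
    using p q by (intro ennreal_leI powr_mono2 integral_mono' Lq) auto
  finally show ?thesis .
qed

lemma nn_integral_P_abs_le:
  assumes \<phi> [measurable]: "\<phi> \<in> borel_measurable N" and Lq: "integrable \<nu> (\<lambda>y. \<bar>\<phi> y\<bar> powr q)"
  shows "(\<integral>\<^sup>+x. ennreal (P (\<lambda>y. \<bar>\<phi> y\<bar>) x powr p) \<partial>\<mu>) \<le> ennreal ((\<integral>y. \<bar>\<phi> y\<bar> powr q \<partial>\<nu>) powr (p / q))"
proof -
  define P_trunc where "P_trunc n = P (\<lambda>y. min \<bar>\<phi> y\<bar> (real n))" for n
  have [measurable]: "P_trunc n \<in> borel_measurable \<mu>" for n unfolding P_trunc_def by measurable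
  have "(\<integral>\<^sup>+x. ennreal (P (\<lambda>y. \<bar>\<phi> y\<bar>) x powr p) \<partial>\<mu>) \<le> (\<integral>\<^sup>+x. liminf (\<lambda>n. ennreal (P_trunc n x powr p)) \<partial>\<mu>)"
  proof (rule nn_integral_mono_AE)
    show "AE x in \<mu>. ennreal (P (\<lambda>y. \<bar>\<phi> y\<bar>) x powr p) \<le> liminf (\<lambda>n. ennreal (P_trunc n x powr p))"
      using AE_integrable_K[OF \<phi> Lq] AE_space
    proof eventually_elim
      case (elim x)
      have "0 \<le> P_trunc n x" for n
        unfolding P_trunc_def by (rule P_between(1)[where M = "real n", OF _ _ elim(2)]) auto
      then have "(\<lambda>n. ennreal (P_trunc n x powr p)) \<longlonglongrightarrow> ennreal (P (\<lambda>y. \<bar>\<phi> y\<bar>) x powr p)"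
        using p P_truncation_tendsto[OF \<phi> elim(2,1), folded P_trunc_def]
        by (intro tendsto_ennrealI tendsto_powr2 always_eventually) auto
      from lim_imp_Liminf[OF sequentially_bot this] show ?case by simp
    qed
  qed
  also have "\<dots> \<le> liminf (\<lambda>n. \<integral>\<^sup>+x. ennreal (P_trunc n x powr p) \<partial>\<mu>)"
    by (rule nn_integral_liminf) measurable
  also have "\<dots> \<le> liminf (\<lambda>n::nat. ennreal ((\<integral>y. \<bar>\<phi> y\<bar> powr q \<partial>\<nu>) powr (p / q)))"
    unfolding P_trunc_def by (intro Liminf_mono always_eventually allI nn_integral_P_truncation_le[OF \<phi> Lq])
  finally show ?thesis by (simp add: Liminf_const)
qed

theorem hypercontractive:
  assumes \<phi> [measurable]: "\<phi> \<in> borel_measurable N" and Lq: "integrable \<nu> (\<lambda>y. \<bar>\<phi> y\<bar> powr q)"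
  shows "integrable \<mu> (\<lambda>x. \<bar>P \<phi> x\<bar> powr p)"
    and "(\<integral>x. \<bar>P \<phi> x\<bar> powr p \<partial>\<mu>) powr (1 / p) \<le> (\<integral>y. \<bar>\<phi> y\<bar> powr q \<partial>\<nu>) powr (1 / q)"
proof -
  define J where "J = (\<integral>y. \<bar>\<phi> y\<bar> powr q \<partial>\<nu>)"
  have "(\<integral>\<^sup>+x. ennreal (\<bar>P \<phi> x\<bar> powr p) \<partial>\<mu>) \<le> (\<integral>\<^sup>+x. ennreal (P (\<lambda>y. \<bar>\<phi> y\<bar>) x powr p) \<partial>\<mu>)"
    unfolding P_def using p by (intro nn_integral_mono ennreal_leI powr_mono2 integral_abs_bound) auto
  also note nn_integral_P_abs_le[OF assms, folded J_def]
  finally have nn: "(\<integral>\<^sup>+x. ennreal (\<bar>P \<phi> x\<bar> powr p) \<partial>\<mu>) \<le> ennreal (J powr (p / q))" .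
  then show int: "integrable \<mu> (\<lambda>x. \<bar>P \<phi> x\<bar> powr p)"
    by (intro integrableI_nonneg) (auto intro: le_less_trans)
  have "(\<integral>x. \<bar>P \<phi> x\<bar> powr p \<partial>\<mu>) \<le> J powr (p / q)"
    using nn nn_integral_eq_integral[OF int] by (simp add: ennreal_le_iff)
  then have "(\<integral>x. \<bar>P \<phi> x\<bar> powr p \<partial>\<mu>) powr (1 / p) \<le> (J powr (p / q)) powr (1 / p)"
    using p by (intro powr_mono2) auto
  then show "(\<integral>x. \<bar>P \<phi> x\<bar> powr p \<partial>\<mu>) powr (1 / p) \<le> (\<integral>y. \<bar>\<phi> y\<bar> powr q \<partial>\<nu>) powr (1 / q)"
    using p by (simp add: powr_powr J_def)
qed

end

section \<open>Stable evolution families\<close>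

lemma bounded_bilinear_matrix_mult: "bounded_bilinear ((**) :: real^'n^'m \<Rightarrow> real^'k^'n \<Rightarrow> real^'k^'m)"
  unfolding bilinear_conv_bounded_bilinear[symmetric] bilinear_def
  by (intro conjI allI linearI)
    (simp_all add: matrix_add_ldistrib matrix_matrix_mult_def vec_eq_iff sum.distrib sum_distrib_left algebra_simps)

interpretation matmul: bounded_bilinear "(**) :: real^'n^'m \<Rightarrow> real^'k^'n \<Rightarrow> real^'k^'m"
  by (rule bounded_bilinear_matrix_mult)

lemma bounded_bilinear_matrix_vector_mult: "bounded_bilinear ((*v) :: real^'n^'m \<Rightarrow> real^'n \<Rightarrow> real^'m)"
  unfolding bilinear_conv_bounded_bilinear[symmetric] bilinear_def
  by (intro conjI allI linearI)
    (simp_all add: matrix_vector_mult_def vec_eq_iff sum.distrib sum_distrib_left algebra_simps)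

interpretation matvec: bounded_bilinear "(*v) :: real^'n^'m \<Rightarrow> real^'n \<Rightarrow> real^'m"
  by (rule bounded_bilinear_matrix_vector_mult)

lemma norm_le_mat_opnorm:
  fixes M :: "real^'n^'m"
  shows "norm M \<le> real (CARD('m) * CARD('n)) * mat_opnorm M"
proof -
  have "norm M \<le> (\<Sum>i\<in>UNIV. norm (M $ i))" by (simp add: norm_vec_def[of M] L2_set_le_sum)
  also have "\<dots> \<le> (\<Sum>i\<in>(UNIV::'m set). \<Sum>j\<in>(UNIV::'n set). \<bar>M $ i $ j\<bar>)"
    by (intro sum_mono norm_le_l1_cart)
  also have "\<dots> \<le> (\<Sum>i\<in>(UNIV::'m set). \<Sum>j\<in>(UNIV::'n set). mat_opnorm M)"
    unfolding mat_opnorm_def by (intro sum_mono matrix_component_le_onorm)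
  finally show ?thesis by simp
qed

lemma norm_matrix_vector_le_opnorm: "norm (M *v x) \<le> mat_opnorm M * norm x" for M :: "real^'n^'m"
  unfolding mat_opnorm_def by (rule onorm) simp

lemma gronwall_zero:
  fixes u :: "real \<Rightarrow> real"
  assumes u: "\<And>\<tau>. (u has_real_derivative u' \<tau>) (at \<tau>)" and bound: "\<And>\<tau>. \<bar>u' \<tau>\<bar> \<le> c * u \<tau>" and "u r = 0"
  shows "u \<tau> \<le> 0"
proof -
  have weighted: "((\<lambda>\<tau>. exp (k * \<tau>) * u \<tau>) has_real_derivative exp (k * \<tau>) * (k * u \<tau> + u' \<tau>)) (at \<tau>)" for k \<tau>
    using u by (auto intro!: derivative_eq_intros simp: algebra_simps)
  show ?thesis
  proof (cases "r \<le> \<tau>")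
    case True
    have "exp (- c * \<tau>) * u \<tau> \<le> exp (- c * r) * u r"
    proof (rule DERIV_nonpos_imp_nonincreasing[OF True])
      fix x
      have "exp (- c * x) * (- c * u x + u' x) \<le> 0"
        using bound[of x] by (intro mult_nonneg_nonpos) auto
      with weighted[of "- c" x]
      show "\<exists>y. ((\<lambda>\<tau>. exp (- c * \<tau>) * u \<tau>) has_real_derivative y) (at x) \<and> y \<le> 0" by blast
    qed
    then show ?thesis using \<open>u r = 0\<close> by (simp add: mult_le_0_iff)
  next
    case False
    then have "\<tau> \<le> r" by simp
    have "exp (c * \<tau>) * u \<tau> \<le> exp (c * r) * u r"
    proof (rule DERIV_nonneg_imp_nondecreasing[OF \<open>\<tau> \<le> r\<close>])
      fix x
      have "0 \<le> exp (c * x) * (c * u x + u' x)"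
        using bound[of x] by (intro mult_nonneg_nonneg) auto
      with weighted[of c x]
      show "\<exists>y. ((\<lambda>\<tau>. exp (c * \<tau>) * u \<tau>) has_real_derivative y) (at x) \<and> 0 \<le> y" by blast
    qed
    then show ?thesis using \<open>u r = 0\<close> by (simp add: mult_le_0_iff)
  qed
qed

lemma linear_ode_zero:
  fixes A :: "real \<Rightarrow> real^'n^'n" and W :: "real \<Rightarrow> real^'k^'n"
  assumes A: "bounded (range A)" and W: "\<And>\<tau>. (W has_vector_derivative (A \<tau> ** W \<tau>)) (at \<tau>)"
    and "W r = 0"
  shows "W \<tau> = 0"
proof -
  obtain a where a: "\<And>\<tau>. norm (A \<tau>) \<le> a" using A by (auto simp: bounded_iff)
  obtain K where K: "0 < K" "\<And>(M::real^'n^'n) (N::real^'k^'n). norm (M ** N) \<le> norm M * norm N * K"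
    using matmul.pos_bounded by blast
  have "W \<tau> \<bullet> W \<tau> \<le> 0"
  proof (rule gronwall_zero[where u = "\<lambda>\<tau>. W \<tau> \<bullet> W \<tau>" and u' = "\<lambda>\<tau>. 2 * (W \<tau> \<bullet> (A \<tau> ** W \<tau>))"
        and c = "2 * (a * K)" and r = r])
    fix \<tau>
    have "((\<lambda>\<tau>. W \<tau> \<bullet> W \<tau>) has_vector_derivative (W \<tau> \<bullet> (A \<tau> ** W \<tau>) + (A \<tau> ** W \<tau>) \<bullet> W \<tau>)) (at \<tau>)"
      by (rule bounded_bilinear.has_vector_derivative[OF bounded_bilinear_inner W W])
    then show "((\<lambda>\<tau>. W \<tau> \<bullet> W \<tau>) has_real_derivative (2 * (W \<tau> \<bullet> (A \<tau> ** W \<tau>)))) (at \<tau>)"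
      by (simp add: has_real_derivative_iff_has_vector_derivative inner_commute)
    have "\<bar>W \<tau> \<bullet> (A \<tau> ** W \<tau>)\<bar> \<le> norm (W \<tau>) * norm (A \<tau> ** W \<tau>)" by (rule Cauchy_Schwarz_ineq2)
    also have "\<dots> \<le> norm (W \<tau>) * (a * norm (W \<tau>) * K)"
      using K(1) by (intro mult_left_mono order_trans[OF K(2)] mult_right_mono a) auto
    finally show "\<bar>2 * (W \<tau> \<bullet> (A \<tau> ** W \<tau>))\<bar> \<le> 2 * (a * K) * (W \<tau> \<bullet> W \<tau>)"
      by (simp add: dot_square_norm power2_eq_square abs_mult mult_ac)
  qed (simp add: \<open>W r = 0\<close>)
  then show ?thesis by (metis inner_eq_zero_iff inner_ge_zero antisym)
qed

definition exp_decaying :: "real \<Rightarrow> (real \<Rightarrow> 'b::real_normed_vector) \<Rightarrow> bool" where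
  "exp_decaying t F \<longleftrightarrow> (\<exists>a>0. \<exists>c. \<forall>r\<le>t. norm (F r) \<le> c * exp (- a * (t - r)))"

lemma exp_decaying_imp_bounded:
  assumes "exp_decaying t F"
  shows "bounded (F ` {..t})"
proof -
  obtain a c where a: "0 < a" and c: "\<And>r. r \<le> t \<Longrightarrow> norm (F r) \<le> c * exp (- a * (t - r))"
    using assms by (auto simp: exp_decaying_def)
  have "norm (F r) \<le> \<bar>c\<bar>" if "r \<le> t" for r
  proof -
    have "norm (F r) \<le> \<bar>c\<bar> * exp (- a * (t - r))"
      using c[OF that] by (rule order_trans) (intro mult_right_mono abs_ge_self, simp)
    also have "\<dots> \<le> \<bar>c\<bar> * 1" using a that by (intro mult_left_mono) auto
    finally show ?thesis by simp
  qed
  then show ?thesis by (auto simp: bounded_iff)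
qed

lemma exp_decaying_bounded_linear:
  assumes T: "bounded_linear T" and "exp_decaying t F"
  shows "exp_decaying t (\<lambda>r. T (F r))"
proof -
  obtain a c where a: "0 < a" and c: "\<And>r. r \<le> t \<Longrightarrow> norm (F r) \<le> c * exp (- a * (t - r))"
    using assms(2) by (auto simp: exp_decaying_def)
  obtain K where K: "0 < K" "\<And>x. norm (T x) \<le> norm x * K"
    using bounded_linear.pos_bounded[OF T] by blast
  have "norm (T (F r)) \<le> c * K * exp (- a * (t - r))" if "r \<le> t" for r
    using order_trans[OF K(2) mult_right_mono[OF c[OF that], of K]] K(1) by (simp add: mult_ac)
  with a show ?thesis unfolding exp_decaying_def by blast
qed

lemma (in bounded_bilinear) exp_decaying_prod:
  assumes F: "exp_decaying t F" and G: "bounded (G ` {..t})"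
  shows "exp_decaying t (\<lambda>r. prod (F r) (G r))"
proof -
  obtain a c where a: "0 < a" and c: "\<And>r. r \<le> t \<Longrightarrow> norm (F r) \<le> c * exp (- a * (t - r))"
    using F by (auto simp: exp_decaying_def)
  obtain b where b: "\<And>r. r \<le> t \<Longrightarrow> norm (G r) \<le> b" using G by (auto simp: bounded_iff)
  obtain K where K: "0 < K" "\<And>x y. norm (prod x y) \<le> norm x * norm y * K"
    using pos_bounded by blast
  have "norm (prod (F r) (G r)) \<le> c * b * K * exp (- a * (t - r))" if "r \<le> t" for r
  proof -
    have "norm (prod (F r) (G r)) \<le> norm (F r) * norm (G r) * K" by (rule K)
    also have "\<dots> \<le> (c * exp (- a * (t - r))) * b * K"
      using c[OF that] b[OF that] K(1) order_trans[OF norm_ge_zero c[OF that]]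
      by (intro mult_right_mono mult_mono) auto
    finally show ?thesis by (simp add: mult_ac)
  qed
  with a show ?thesis unfolding exp_decaying_def by blast
qed

lemma integrable_on_exp_atMost:
  fixes a t :: real assumes "0 < a"
  shows "(\<lambda>r. exp (- a * (t - r))) integrable_on {..t}"
proof -
  have "(\<lambda>x. exp (- a * x)) absolutely_integrable_on {- t..}"
    using integrable_on_exp_minus_to_infinity[OF assms, of "- t"]
    by (intro nonnegative_absolutely_integrable_1) auto
  then have "(\<lambda>x. exp (- a * (- x))) integrable_on {..t}"
    using has_absolute_integral_reflect_real[of "{..t}" "{- t..}" "\<lambda>x. exp (- a * x)"]
    by (auto intro: set_lebesgue_integral_eq_integral(1))
  from integrable_cmul[OF this, of "exp (- a * t)"] show ?thesis
    by (simp add: exp_add[symmetric] algebra_simps)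
qed

lemma exp_decaying_imp_absolutely_integrable:
  fixes F :: "real \<Rightarrow> 'b::euclidean_space"
  assumes F: "continuous_on {..t} F" "exp_decaying t F"
  shows "F absolutely_integrable_on {..t}"
proof -
  obtain a c where a: "0 < a" and c: "\<And>r. r \<le> t \<Longrightarrow> norm (F r) \<le> c * exp (- a * (t - r))"
    using F(2) by (auto simp: exp_decaying_def)
  show ?thesis
  proof (rule measurable_bounded_by_integrable_imp_absolutely_integrable)
    show "F \<in> borel_measurable (lebesgue_on {..t})"
      using F(1) by (intro continuous_imp_measurable_on_sets_lebesgue) auto
    show "(\<lambda>r. c * exp (- a * (t - r))) integrable_on {..t}"
      using integrable_cmul[OF integrable_on_exp_atMost[OF a, of t], of c] by simp
  qed (use c in auto)
qed

lemma integral_atMost_split: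
  fixes f :: "real \<Rightarrow> 'b::euclidean_space"
  assumes f: "f absolutely_integrable_on {..t}" and st: "s \<le> t"
  shows "f integrable_on {..s}" "f integrable_on {s..t}"
    "integral {..t} f = integral {..s} f + integral {s..t} f"
proof -
  show int: "f integrable_on {..s}" "f integrable_on {s..t}"
    using set_integrable_subset[OF f] st by (auto intro!: set_lebesgue_integral_eq_integral(1))
  have "{..t} = {..s} \<union> {s..t}" "{..s} \<inter> {s..t} = {s}" using st by auto
  with integral_Un[OF int] show "integral {..t} f = integral {..s} f + integral {s..t} f" by simp
qed

locale stable_evolution =
  fixes A B :: "real \<Rightarrow> real^'n^'n" and f :: "real \<Rightarrow> real^'n"
    and U :: "real \<Rightarrow> real \<Rightarrow> real^'n^'n" and \<mu>0 :: real
  assumes bddA: "bounded (range A)"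
    and contB: "continuous_on UNIV B" and bddB: "bounded (range B)"
    and contf: "continuous_on UNIV f" and bddf: "bounded (range f)"
    and mu0: "\<mu>0 > 0" and Bbelow: "\<And>r x. norm (B r *v x) \<ge> \<mu>0 * norm x"
    and U_id: "\<And>r. U r r = mat 1"
    and U_deriv: "\<And>\<tau> r. ((\<lambda>\<tau>. U \<tau> r) has_vector_derivative (A \<tau> ** U \<tau> r)) (at \<tau>)"
    and stable: "\<exists>\<omega> M. \<omega> < 0 \<and> (\<forall>r \<tau>. r \<le> \<tau> \<longrightarrow> mat_opnorm (U \<tau> r) \<le> M * exp (\<omega> * (\<tau> - r)))"
begin

lemma cocycle: "U t r ** U r s = U t s"
proof -
  have "((\<lambda>\<tau>. U \<tau> r ** U r s) has_vector_derivative (A \<tau> ** U \<tau> r) ** U r s) (at \<tau>)" for \<tau>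
    by (rule bounded_linear.has_vector_derivative[OF matmul.bounded_linear_left U_deriv])
  then have "((\<lambda>\<tau>. U \<tau> s - U \<tau> r ** U r s) has_vector_derivative A \<tau> ** (U \<tau> s - U \<tau> r ** U r s)) (at \<tau>)" for \<tau>
    using has_vector_derivative_diff[OF U_deriv] by (simp add: matmul.diff_right matrix_mul_assoc)
  from linear_ode_zero[OF bddA this, of r t] show ?thesis by (simp add: U_id)
qed

lemma exp_decaying_U: "exp_decaying t (U t)"
proof -
  obtain \<omega> M where \<omega>: "\<omega> < 0" and M: "\<And>r. r \<le> t \<Longrightarrow> mat_opnorm (U t r) \<le> M * exp (\<omega> * (t - r))"
    using stable by auto
  let ?N = "real (CARD('n) * CARD('n))"
  have "norm (U t r) \<le> (?N * M) * exp (- (- \<omega>) * (t - r))" if "r \<le> t" for r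
    using order_trans[OF norm_le_mat_opnorm mult_left_mono[OF M[OF that], of ?N]] by simp
  moreover have "0 < - \<omega>" using \<omega> by simp
  ultimately show ?thesis unfolding exp_decaying_def by blast
qed

lemma continuous_on_U: "continuous_on {..t} (U t)"
  unfolding continuous_on_def
proof
  fix \<sigma> assume "\<sigma> \<in> {..t}"
  obtain c where c: "\<And>r. r \<le> t \<Longrightarrow> norm (U t r) \<le> c"
    using exp_decaying_imp_bounded[OF exp_decaying_U, of t] by (auto simp: bounded_iff)
  obtain K where K: "0 < K" "\<And>(M :: real^'n^'n) (N :: real^'n^'n). norm (M ** N) \<le> norm M * norm N * K"
    using matmul.pos_bounded by blast
  have "((\<lambda>r. U t r - U t \<sigma>) \<longlongrightarrow> 0) (at \<sigma> within {..t})"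
  proof (rule Lim_null_comparison)
    have "norm (U t r - U t \<sigma>) \<le> c * norm (mat 1 - U r \<sigma>) * K" if "r \<le> t" for r
    proof -
      have "U t r - U t \<sigma> = U t r ** (mat 1 - U r \<sigma>)" by (simp add: matmul.diff_right cocycle)
      also have "norm \<dots> \<le> norm (U t r) * norm (mat 1 - U r \<sigma>) * K" by (rule K)
      also have "\<dots> \<le> c * norm (mat 1 - U r \<sigma>) * K" using c[OF that] K(1) by (intro mult_right_mono) auto
      finally show ?thesis .
    qed
    then show "\<forall>\<^sub>F r in at \<sigma> within {..t}. norm (U t r - U t \<sigma>) \<le> c * norm (mat 1 - U r \<sigma>) * K"
      by (auto simp: eventually_at_filter)
    have "isCont (\<lambda>r. U r \<sigma>) \<sigma>"
      using has_vector_derivative_continuous[OF U_deriv] by blast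
    then have "((\<lambda>r. U r \<sigma>) \<longlongrightarrow> mat 1) (at \<sigma> within {..t})"
      using U_id[of \<sigma>] by (metis continuous_at_imp_continuous_at_within continuous_within)
    then have "((\<lambda>r. c * norm (mat 1 - U r \<sigma>) * K) \<longlongrightarrow> c * norm (mat 1 - mat 1 :: real^'n^'n) * K) (at \<sigma> within {..t})"
      by (intro tendsto_intros)
    then show "((\<lambda>r. c * norm (mat 1 - U r \<sigma>) * K) \<longlongrightarrow> 0) (at \<sigma> within {..t})" by simp
  qed
  then show "(U t \<longlongrightarrow> U t \<sigma>) (at \<sigma> within {..t})" by (simp add: LIM_zero_iff)
qed

abbreviation cov_density :: "real \<Rightarrow> real \<Rightarrow> real^'n^'n" where
  "cov_density t r \<equiv> U t r ** B r ** transpose (B r) ** transpose (U t r)"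

lemma continuous_on_cov_density: "continuous_on {..t} (cov_density t)"
  by (intro matmul.continuous_on bounded_linear.continuous_on[OF bounded_linear_transpose]
      continuous_on_U continuous_on_subset[OF contB] subset_UNIV)

lemma cov_density_eq: "cov_density t r = (U t r ** B r) ** transpose (U t r ** B r)"
  by (simp add: matrix_transpose_mul matrix_mul_assoc)

lemma quadratic_cov_density:
  "y \<bullet> (cov_density t r *v y) = (norm (transpose (B r) *v (transpose (U t r) *v y)))\<^sup>2"
proof -
  have "y \<bullet> (cov_density t r *v y) = (transpose (U t r ** B r) *v y) \<bullet> (transpose (U t r ** B r) *v y)"
    unfolding cov_density_eq by (simp only: inner_matrix_vector_left transpose_transpose matrix_vector_mul_assoc)
  then show ?thesis
    by (simp only: matrix_transpose_mul matrix_vector_mul_assoc power2_norm_eq_inner)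
qed

lemma absolutely_integrable_cov_density: "cov_density t absolutely_integrable_on {..t}"
proof -
  have UB: "exp_decaying t (\<lambda>r. U t r ** B r)"
    by (intro matmul.exp_decaying_prod exp_decaying_U bounded_subset[OF bddB]) auto
  then have "exp_decaying t (\<lambda>r. transpose (U t r ** B r))"
    by (rule exp_decaying_bounded_linear[OF bounded_linear_transpose])
  then have "exp_decaying t (cov_density t)"
    unfolding cov_density_eq by (intro matmul.exp_decaying_prod UB exp_decaying_imp_bounded)
  then show ?thesis
    by (rule exp_decaying_imp_absolutely_integrable[OF continuous_on_cov_density])
qed

lemma absolutely_integrable_mean: "(\<lambda>r. U t r *v f r) absolutely_integrable_on {..t}"
  by (intro exp_decaying_imp_absolutely_integrable matvec.continuous_on continuous_on_U
      continuous_on_subset[OF contf] matvec.exp_decaying_prod exp_decaying_U bounded_subset[OF bddf]) auto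

lemma covQinf_split:
  assumes "s \<le> t"
  shows "covQinf U B t = U t s ** covQinf U B s ** transpose (U t s) + covQ U B t s"
proof -
  have conj: "bounded_linear (\<lambda>M. U t s ** M ** transpose (U t s))"
    by (rule bounded_linear_compose[OF matmul.bounded_linear_left matmul.bounded_linear_right])
  have "cov_density t r = U t s ** cov_density s r ** transpose (U t s)" for r
    by (simp only: cocycle[of t s r, symmetric] matrix_transpose_mul matrix_mul_assoc)
  then have "integral {..s} (cov_density t) = integral {..s} ((\<lambda>M. U t s ** M ** transpose (U t s)) \<circ> cov_density s)"
    by (simp only: o_def)
  also have "\<dots> = U t s ** covQinf U B s ** transpose (U t s)"
    unfolding covQinf_def
    by (rule integral_linear[OF _ conj]) (rule set_lebesgue_integral_eq_integral(1)[OF absolutely_integrable_cov_density])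
  finally show ?thesis
    using integral_atMost_split(3)[OF absolutely_integrable_cov_density assms] by (simp add: covQinf_def covQ_def)
qed

lemma meanGinf_split:
  assumes "s \<le> t"
  shows "meanGinf U f t = U t s *v meanGinf U f s + meanG U f t s"
proof -
  have "U t r *v f r = U t s *v (U s r *v f r)" for r
    by (simp only: cocycle[of t s r, symmetric] matrix_vector_mul_assoc)
  then have "integral {..s} (\<lambda>r. U t r *v f r) = integral {..s} ((*v) (U t s) \<circ> (\<lambda>r. U s r *v f r))"
    by (simp only: o_def)
  also have "\<dots> = U t s *v meanGinf U f s"
    unfolding meanGinf_def
    by (rule integral_linear[OF _ matvec.bounded_linear_right])
      (rule set_lebesgue_integral_eq_integral(1)[OF absolutely_integrable_mean])
  finally show ?thesis
    using integral_atMost_split(3)[OF absolutely_integrable_mean assms] by (simp add: meanGinf_def meanG_def)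
qed

lemma quadratic_integral:
  assumes "cov_density t integrable_on S"
  shows "((\<lambda>r. y \<bullet> (cov_density t r *v y)) has_integral y \<bullet> (integral S (cov_density t) *v y)) S"
  using has_integral_linear[OF integrable_integral[OF assms]
      bounded_linear_compose[OF bounded_linear_inner_right[of y] matvec.bounded_linear_left[of y]]]
  by (simp add: o_def)

lemma transpose_integral:
  assumes "cov_density t integrable_on S"
  shows "transpose (integral S (cov_density t)) = integral S (cov_density t)"
proof -
  have "transpose (cov_density t r) = cov_density t r" for r
    by (simp add: matrix_transpose_mul matrix_mul_assoc)
  then show ?thesis
    using integral_linear[OF assms bounded_linear_transpose] by (simp add: o_def)
qed

lemma invertible_transpose_B: "invertible (transpose (B r))"
proof -
  have "x = 0" if "B r *v x = 0" for x
    using Bbelow[of x r] that mu0 by (simp add: mult_le_0_iff)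
  then show ?thesis by (intro transpose_invertible) (simp add: invertible_iff_ker)
qed

lemma pos_def_covQ:
  assumes "s < t"
  shows "pos_def (covQ U B t s)"
  unfolding pos_def_def
proof (intro conjI allI impI)
  have int: "cov_density t integrable_on {s..t}"
    using integral_atMost_split(2)[OF absolutely_integrable_cov_density] assms by simp
  show "transpose (covQ U B t s) = covQ U B t s" unfolding covQ_def by (rule transpose_integral[OF int])
  fix x :: "real^'n" assume x: "x \<noteq> 0"
  let ?g = "\<lambda>r. x \<bullet> (cov_density t r *v x)"
  have q: "x \<bullet> (covQ U B t s *v x) = integral {s..t} ?g"
    unfolding covQ_def by (rule integral_unique[OF quadratic_integral[OF int], symmetric])
  have g0: "0 \<le> ?g r" for r unfolding quadratic_cov_density by simp
  have cont: "continuous_on {s..t} ?g"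
    by (intro continuous_intros matvec.continuous_on continuous_on_subset[OF continuous_on_cov_density]) auto
  have "transpose (B t) *v x \<noteq> 0"
    using x invertible_transpose_B[of t] unfolding invertible_iff_ker by blast
  then have "?g t \<noteq> 0" unfolding quadratic_cov_density by (simp add: U_id transpose_mat)
  then have "integral {s..t} ?g \<noteq> 0"
    using integral_eq_0_iff[OF cont assms] g0 assms by auto
  moreover have "0 \<le> integral {s..t} ?g"
    by (rule integral_nonneg[OF integrable_continuous_real[OF cont]]) (rule g0)
  ultimately show "0 < x \<bullet> (covQ U B t s *v x)" using q by simp
qed

lemma pos_semidef_covQinf: "pos_semidef (covQinf U B t)"
  unfolding pos_semidef_def
proof (intro conjI allI)
  have int: "cov_density t integrable_on {..t}"
    by (rule set_lebesgue_integral_eq_integral(1)[OF absolutely_integrable_cov_density])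
  show "transpose (covQinf U B t) = covQinf U B t"
    unfolding covQinf_def by (rule transpose_integral[OF int])
  show "0 \<le> x \<bullet> (covQinf U B t *v x)" for x
    unfolding covQinf_def
    by (rule has_integral_nonneg[OF quadratic_integral[OF int]]) (simp add: quadratic_cov_density)
qed

lemma pos_def_covQinf: "pos_def (covQinf U B t)"
  using pos_def_conjugate_add[OF pos_semidef_covQinf pos_def_covQ, of "t - 1" t "U t (t - 1)" "t - 1"]
  by (simp add: covQinf_split[of "t - 1" t])

lemma quadratic_covQinf_split:
  assumes "s \<le> t"
  shows "y \<bullet> (covQinf U B t *v y) =
    (transpose (U t s) *v y) \<bullet> (covQinf U B s *v (transpose (U t s) *v y)) + y \<bullet> (covQ U B t s *v y)"
  unfolding covQinf_split[OF assms] matrix_vector_mult_add_rdistrib inner_add_right quadratic_form_conjugate ..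

end

lemma ode_solution_gt_one:
  fixes p :: "real \<Rightarrow> real"
  assumes q: "1 < p t"
    and ode: "\<And>r. r \<le> t \<Longrightarrow> (p has_real_derivative p' r) (at r within {..t})"
    and neg: "\<And>r. r \<le> t \<Longrightarrow> 1 < p r \<Longrightarrow> p' r \<le> 0"
    and r: "r \<le> t"
  shows "1 < p r"
proof (rule ccontr)
  assume "\<not> 1 < p r"
  define Z where "Z = {x \<in> {..t}. p x \<le> 1}"
  have cont: "continuous_on {..t} p"
    using ode by (auto simp: continuous_on_eq_continuous_within intro: DERIV_continuous)
  have "closed Z"
    unfolding Z_def by (rule continuous_on_closed_Collect_le[OF cont continuous_on_const]) auto
  moreover have "Z \<noteq> {}" "bdd_above Z" using r \<open>\<not> 1 < p r\<close> by (auto simp: Z_def)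
  ultimately have Sup: "Sup Z \<in> Z" by (simp add: closed_contains_Sup)
  define r0 where "r0 = Sup Z"
  have r0: "r0 < t" "p r0 \<le> 1" using Sup q by (auto simp: Z_def r0_def less_le)
  have gt: "1 < p x" if "r0 < x" "x \<le> t" for x
    using cSup_upper[OF _ \<open>bdd_above Z\<close>, of x] that by (force simp: Z_def r0_def)
  have "p t \<le> p r0"
  proof (rule DERIV_nonpos_imp_decreasing_open[OF less_imp_le[OF r0(1)]])
    fix x assume x: "r0 < x" "x < t"
    have "at x within {..t} = at x within UNIV"
      by (rule at_within_nhd[of x "{..<t}"]) (use x in auto)
    with ode[of x] neg[of x] gt[of x] x show "\<exists>y. (p has_real_derivative y) (at x) \<and> y \<le> 0" by auto
  next
    show "continuous_on {r0..t} p" by (rule continuous_on_subset[OF cont]) auto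
  qed
  then show False using r0 q by simp
qed

text \<open>\<open>k r = 0\<close> is allowed: division by zero then makes both differential inequalities trivial.\<close>

lemma exponent_product_nondecreasing:
  fixes v g p k :: "real \<Rightarrow> real"
  assumes st: "s \<le> t"
    and v: "\<And>r. r \<in> {s..t} \<Longrightarrow> (v has_real_derivative g r) (at r within {s..t})"
    and p: "\<And>r. r \<in> {s..t} \<Longrightarrow> (p has_real_derivative - ((p r - 1) / k r)) (at r within {s..t})"
    and p_gt: "\<And>r. r \<in> {s..t} \<Longrightarrow> 1 < p r" and "\<And>r. 0 \<le> k r" "\<And>r. 0 \<le> g r" "\<And>r. v r \<le> k r * g r"
  shows "(p s - 1) * v s \<le> (p t - 1) * v t"
proof (rule DERIV_nonneg_imp_increasing_open[OF st])
  have "continuous_on {s..t} v" "continuous_on {s..t} p"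
    unfolding continuous_on_eq_continuous_within
    using DERIV_continuous[OF v] DERIV_continuous[OF p] by blast+
  then show "continuous_on {s..t} (\<lambda>r. (p r - 1) * v r)" by (intro continuous_intros)
  fix r assume r: "s < r" "r < t"
  have at: "at r within {s..t} = at r" using r by (intro at_within_interior) simp
  have "((\<lambda>r. (p r - 1) * v r) has_real_derivative (p r - 1) * (g r - v r / k r)) (at r)"
    using DERIV_mult[OF DERIV_diff[OF p[of r] DERIV_const[of 1]] v[of r]] r by (simp add: at algebra_simps)
  moreover have "v r / k r \<le> g r"
    using assms(5-7)[of r] by (cases "k r = 0") (simp_all add: pos_divide_le_eq less_le mult.commute)
  then have "0 \<le> (p r - 1) * (g r - v r / k r)" using p_gt[of r] r by simp
  ultimately show "\<exists>d. ((\<lambda>r. (p r - 1) * v r) has_real_derivative d) (at r) \<and> 0 \<le> d" by blast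
qed

context stable_evolution
begin

abbreviation cov_ratio :: "real \<Rightarrow> real" where
  "cov_ratio r \<equiv> (mat_opnorm (msqrt (covQinf U B r) ** matrix_inv (transpose (B r))))\<^sup>2"

lemma quadratic_covQinf_le:
  "z \<bullet> (covQinf U B r *v z) \<le> cov_ratio r * (norm (transpose (B r) *v z))\<^sup>2"
proof -
  let ?S = "msqrt (covQinf U B r)" and ?B = "transpose (B r)"
  have "?S *v z = (?S ** matrix_inv ?B) *v (?B *v z)"
    by (simp only: matrix_vector_mul_assoc matrix_mul_assoc[symmetric] matrix_mul_rid
        matrix_inv_invertible(2)[OF invertible_transpose_B])
  then have "norm (?S *v z) \<le> mat_opnorm (?S ** matrix_inv ?B) * norm (?B *v z)"
    by (metis norm_matrix_vector_le_opnorm)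
  then have "(norm (?S *v z))\<^sup>2 \<le> (mat_opnorm (?S ** matrix_inv ?B) * norm (?B *v z))\<^sup>2"
    by (rule power_mono) simp
  then show ?thesis
    by (simp only: norm_msqrt_mult[OF pos_def_imp_pos_semidef[OF pos_def_covQinf]] power_mult_distrib)
qed

lemma cfun_quotient: "1 < x \<Longrightarrow> - x / cfun U B x r = - ((x - 1) / cov_ratio r)"
  by (simp add: cfun_def)

lemma exponent_gt_one:
  assumes q: "1 < p t"
    and ode: "\<And>r. r \<le> t \<Longrightarrow> (p has_real_derivative (- p r / cfun U B (p r) r)) (at r within {..t})"
    and "r \<le> t"
  shows "1 < p r"
proof (rule ode_solution_gt_one[OF q ode _ \<open>r \<le> t\<close>])
  fix r assume "1 < p r"
  then show "- p r / cfun U B (p r) r \<le> 0"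
    unfolding cfun_quotient[OF \<open>1 < p r\<close>] by simp
qed auto

lemma has_real_derivative_quadratic_covQinf:
  assumes "r \<in> {s..t}"
  shows "((\<lambda>r. (transpose (U t r) *v y) \<bullet> (covQinf U B r *v (transpose (U t r) *v y))) has_real_derivative
    (norm (transpose (B r) *v (transpose (U t r) *v y)))\<^sup>2) (at r within {s..t})"
proof -
  define g where "g r = (norm (transpose (B r) *v (transpose (U t r) *v y)))\<^sup>2" for r
  have "continuous_on {..t} g"
    unfolding g_def quadratic_cov_density[symmetric]
    by (intro continuous_intros matvec.continuous_on continuous_on_cov_density)
  then have "continuous_on {s..t} g" by (rule continuous_on_subset) auto
  then have "((\<lambda>r. y \<bullet> (covQinf U B t *v y) - integral {r..t} g) has_real_derivative g r) (at r within {s..t})"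
    using integral_has_real_derivative'[OF _ assms] by (auto intro!: derivative_eq_intros)
  moreover have "y \<bullet> (covQinf U B t *v y) - integral {r..t} g =
      (transpose (U t r) *v y) \<bullet> (covQinf U B r *v (transpose (U t r) *v y))" if "r \<le> t" for r
  proof -
    have "integral {r..t} g = y \<bullet> (covQ U B t r *v y)"
      unfolding covQ_def g_def quadratic_cov_density[symmetric]
      by (intro integral_unique quadratic_integral integral_atMost_split(2)[OF absolutely_integrable_cov_density that])
    then show ?thesis using quadratic_covQinf_split[OF that, of y] by simp
  qed
  ultimately show ?thesis
    unfolding g_def[symmetric]
    by (elim has_field_derivative_transform_within[of _ _ _ _ 1]) (use assms in auto)
qed

lemma covariance_decay:
  assumes st: "s \<le> t" and q: "1 < p t"
    and ode: "\<And>r. r \<le> t \<Longrightarrow> (p has_real_derivative (- p r / cfun U B (p r) r)) (at r within {..t})"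
  shows "(p s - 1) * ((transpose (U t s) *v y) \<bullet> (covQinf U B s *v (transpose (U t s) *v y)))
    \<le> (p t - 1) * (y \<bullet> (covQinf U B t *v y))"
proof -
  have p_gt: "1 < p r" if "r \<in> {s..t}" for r using exponent_gt_one[OF q ode] that by simp
  have "(p has_real_derivative - ((p r - 1) / cov_ratio r)) (at r within {s..t})" if "r \<in> {s..t}" for r
    using DERIV_subset[OF ode, of r "{s..t}"] that unfolding cfun_quotient[OF p_gt[OF that]] by auto
  from exponent_product_nondecreasing[OF st has_real_derivative_quadratic_covQinf this p_gt _ _ quadratic_covQinf_le]
  show ?thesis by (simp add: U_id transpose_mat)
qed

end

section \<open>Hypercontractivity of Gaussian transition kernels\<close>

lemma hoelder_exponents_correlation:
  fixes x y :: "'a::real_inner" and z :: "'b::real_inner"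
  assumes p: "1 < p" and q: "1 < q" and decay: "(p - 1) * (norm y)\<^sup>2 \<le> (q - 1) * (norm (y, z))\<^sup>2"
  shows "(norm ((1 - 1 / p) *\<^sub>R (x, 0) + (1 / q) *\<^sub>R (y, z)))\<^sup>2
    \<le> (1 - 1 / p) * (norm (x, 0 :: 'b))\<^sup>2 + 1 / q * (norm (y, z))\<^sup>2"
proof -
  define \<alpha> where "\<alpha> = 1 - 1 / p"
  define \<beta> where "\<beta> = 1 / q"
  define n where "n = (norm (y, z))\<^sup>2"
  have coeffs: "\<alpha> * \<beta> = (p - 1) * (1 / p * (1 / q))" "\<alpha> - \<alpha>\<^sup>2 = (p - 1) / p\<^sup>2" "\<beta> - \<beta>\<^sup>2 = (q - 1) / q\<^sup>2"
    using p q by (simp_all add: \<alpha>_def \<beta>_def power2_eq_square field_simps)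
  have "2 * (1 / p * (1 / q)) * (x \<bullet> y) \<le> 2 * (1 / p * (1 / q)) * (norm x * norm y)"
    using p q by (intro mult_left_mono norm_cauchy_schwarz) auto
  also have "\<dots> \<le> (norm x)\<^sup>2 / p\<^sup>2 + (norm y)\<^sup>2 / q\<^sup>2"
    using zero_le_power2[of "norm x / p - norm y / q"] by (simp add: power2_eq_square algebra_simps)
  finally have "(p - 1) * (2 * (1 / p * (1 / q)) * (x \<bullet> y)) \<le> (p - 1) * ((norm x)\<^sup>2 / p\<^sup>2 + (norm y)\<^sup>2 / q\<^sup>2)"
    using p by (intro mult_left_mono) auto
  also have "\<dots> = (p - 1) / p\<^sup>2 * (norm x)\<^sup>2 + (p - 1) * (norm y)\<^sup>2 / q\<^sup>2"
    by (simp add: distrib_left)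
  also have "\<dots> \<le> (p - 1) / p\<^sup>2 * (norm x)\<^sup>2 + (q - 1) * n / q\<^sup>2"
    using decay unfolding n_def by (intro add_left_mono divide_right_mono) auto
  finally have "2 * (\<alpha> * \<beta>) * (x \<bullet> y) \<le> (\<alpha> - \<alpha>\<^sup>2) * (norm x)\<^sup>2 + (\<beta> - \<beta>\<^sup>2) * n"
    unfolding coeffs by (simp only: mult_ac times_divide_eq_left times_divide_eq_right)
  moreover have "(norm (\<alpha> *\<^sub>R (x, 0) + \<beta> *\<^sub>R (y, z)))\<^sup>2 = \<alpha>\<^sup>2 * (norm x)\<^sup>2 + 2 * (\<alpha> * \<beta>) * (x \<bullet> y) + \<beta>\<^sup>2 * n"
    unfolding n_def power2_norm_eq_inner
    by (simp add: inner_prod_def inner_add_left inner_add_right inner_commute power2_eq_square algebra_simps)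
  ultimately show ?thesis
    unfolding \<alpha>_def[symmetric] \<beta>_def[symmetric] n_def[symmetric] by (simp add: algebra_simps)
qed

locale gauss_transition =
  fixes V Q R :: "real^'n^'n" and m g :: "real^'n" and p q :: real
  assumes Q: "pos_def Q" and R: "pos_def R" and p: "1 < p" and q: "1 < q"
    and decay: "\<And>y. (p - 1) * ((transpose V *v y) \<bullet> (Q *v (transpose V *v y)))
      \<le> (q - 1) * (y \<bullet> ((V ** Q ** transpose V + R) *v y))"
begin

abbreviation source :: "(real^'n) measure" where
  "source \<equiv> gaussian_measure m Q"

abbreviation target :: "(real^'n) measure" where
  "target \<equiv> gaussian_measure (V *v m + g) (V ** Q ** transpose V + R)"

definition kernel :: "real^'n \<Rightarrow> (real^'n) measure" where
  "kernel x = gaussian_measure (V *v x + g) R"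

definition X :: "(real^'n) \<times> (real^'n) \<Rightarrow> real^'n" where
  "X w = msqrt Q *v fst w"

definition Y :: "(real^'n) \<times> (real^'n) \<Rightarrow> real^'n" where
  "Y w = V *v X w + msqrt R *v snd w"

lemma pos_def_target: "pos_def (V ** Q ** transpose V + R)"
  by (rule pos_def_conjugate_add[OF pos_def_imp_pos_semidef[OF Q] R])

lemma linear_X: "linear X"
  unfolding X_def[abs_def] by (rule linearI) (simp_all add: matrix_vector_right_distrib matrix_vector_mult_scaleR)

lemma linear_Y: "linear Y"
  unfolding Y_def[abs_def] X_def
  by (rule linearI) (simp_all add: matrix_vector_right_distrib matrix_vector_mult_scaleR scaleR_add_right)

lemma adjoint_X: "adjoint X = (\<lambda>a. (msqrt Q *v a, 0))"
  by (rule adjoint_unique)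
    (simp add: X_def inner_prod_def inner_matrix_vector_left transpose_msqrt pos_def_imp_pos_semidef Q)

lemma adjoint_Y: "adjoint Y = (\<lambda>b. (msqrt Q *v (transpose V *v b), msqrt R *v b))"
  by (rule adjoint_unique)
    (simp only: Y_def X_def inner_prod_def inner_add_left inner_matrix_vector_left fst_conv snd_conv
      transpose_msqrt[OF pos_def_imp_pos_semidef[OF Q]] transpose_msqrt[OF pos_def_imp_pos_semidef[OF R]], simp)

lemma covariance_X: "X (adjoint X b) = Q *v b"
  by (simp add: adjoint_X X_def matrix_vector_mul_assoc msqrt_mult_self pos_def_imp_pos_semidef Q)

lemma covariance_Y: "Y (adjoint Y b) = (V ** Q ** transpose V + R) *v b"
proof -
  have "Y (adjoint Y b) = V *v ((msqrt Q ** msqrt Q) *v (transpose V *v b)) + (msqrt R ** msqrt R) *v b"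
    by (simp only: adjoint_Y Y_def X_def fst_conv snd_conv matrix_vector_mul_assoc[symmetric])
  then show ?thesis
    unfolding msqrt_mult_self[OF pos_def_imp_pos_semidef[OF Q]] msqrt_mult_self[OF pos_def_imp_pos_semidef[OF R]]
    by (simp only: matrix_vector_mul_assoc matrix_vector_mult_add_rdistrib matrix_mul_assoc)
qed

lemma norm_adjoint_Y: "(norm (adjoint Y b))\<^sup>2 = b \<bullet> ((V ** Q ** transpose V + R) *v b)"
  using adjoint_works[OF linear_Y, of "adjoint Y b" b]
  by (simp add: power2_norm_eq_inner covariance_Y inner_commute)

lemma source_law: "distr std_gauss borel (\<lambda>w. m + X w) = source"
  using Q linear_X covariance_X by (rule distr_std_gauss_eq_gaussian_measure)

lemma target_law: "distr std_gauss borel (\<lambda>w. (V *v m + g) + Y w) = target"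
  using pos_def_target linear_Y covariance_Y by (rule distr_std_gauss_eq_gaussian_measure)

sublocale gauss_pair X Y "1 - 1 / p" "1 / q"
proof (rule gauss_pair.intro)
  fix a b
  have "(p - 1) * (norm (msqrt Q *v (transpose V *v b)))\<^sup>2 \<le> (q - 1) * (norm (adjoint Y b))\<^sup>2"
    unfolding norm_adjoint_Y norm_msqrt_mult[OF pos_def_imp_pos_semidef[OF Q]] by (rule decay)
  then show "(norm ((1 - 1 / p) *\<^sub>R adjoint X a + (1 / q) *\<^sub>R adjoint Y b))\<^sup>2
      \<le> (1 - 1 / p) * (norm (adjoint X a))\<^sup>2 + 1 / q * (norm (adjoint Y b))\<^sup>2"
    unfolding adjoint_X adjoint_Y by (rule hoelder_exponents_correlation[OF p q])
qed (use p q linear_X linear_Y in simp_all)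

lemma sets_source [simp]: "sets source = sets borel"
  by (simp add: gaussian_measure_eq)

lemma measurable_kernel [measurable]: "kernel \<in> borel \<rightarrow>\<^sub>M prob_algebra borel"
  unfolding kernel_def[abs_def] gaussian_measure_eq
  by (rule measurable_distr_prob_space2[where M = borel])
    (auto simp: space_prob_algebra prob_space_std_gauss)

lemma kernel_eq: "kernel x = distr std_gauss borel (\<lambda>z. V *v x + g + msqrt R *v z)"
  by (simp add: kernel_def gaussian_measure_eq)

lemma sets_kernel [measurable_cong, simp]: "sets (kernel x) = sets borel"
  by (simp add: kernel_eq)

lemma transition_eq: "V *v (m + msqrt Q *v u) + g + msqrt R *v z = V *v m + g + Y (u, z)"
  by (simp add: Y_def X_def matrix_vector_right_distrib)

lemma bind_source_kernel: "source \<bind> kernel = target"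
proof (rule measure_eqI)
  have space: "space source \<noteq> {}" by (simp add: gaussian_measure_eq)
  show "sets (source \<bind> kernel) = sets target"
    using space by (subst sets_bind[where N = borel]) (simp_all add: gaussian_measure_eq)
  fix A assume "A \<in> sets (source \<bind> kernel)"
  then have [measurable]: "A \<in> sets borel" using space by (simp add: sets_bind[where N = borel])
  have "emeasure (source \<bind> kernel) A = (\<integral>\<^sup>+x. emeasure (kernel x) A \<partial>source)"
    using space by (rule emeasure_bind[where N = borel])
      (simp_all add: measurable_prob_algebraD[OF measurable_kernel] cong: measurable_cong_sets)
  also have "\<dots> = (\<integral>\<^sup>+x. (\<integral>\<^sup>+z. indicator A (V *v x + g + msqrt R *v z) \<partial>std_gauss) \<partial>source)"
    by (simp add: kernel_eq nn_integral_distr flip: nn_integral_indicator)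
  also have "\<dots> = (\<integral>\<^sup>+u. (\<integral>\<^sup>+z. indicator A (V *v m + g + Y (u, z)) \<partial>std_gauss) \<partial>std_gauss)"
    by (simp add: gaussian_measure_eq nn_integral_distr transition_eq)
  also have "\<dots> = (\<integral>\<^sup>+w. indicator A (V *v m + g + Y w) \<partial>std_gauss)"
    by (subst std_gauss.nn_integral_fst) (simp_all add: std_gauss_prod)
  also have "\<dots> = emeasure target A"
    by (simp add: nn_integral_distr flip: target_law nn_integral_indicator)
  finally show "emeasure (source \<bind> kernel) A = emeasure target A" .
qed

lemma integral_source_kernel:
  fixes H :: "(real^'n) \<times> (real^'n) \<Rightarrow> real"
  assumes H: "borel_between e M H"
  shows "(\<integral>x. (\<integral>y. H (x, y) \<partial>kernel x) \<partial>source) = (\<integral>w. H (m + X w, V *v m + g + Y w) \<partial>std_gauss)"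
proof -
  note [measurable] = borel_betweenD(1)[OF H]
  have "(\<integral>x. (\<integral>y. H (x, y) \<partial>kernel x) \<partial>source) =
      (\<integral>x. (\<integral>z. H (x, V *v x + g + msqrt R *v z) \<partial>std_gauss) \<partial>source)"
    by (simp add: kernel_eq integral_distr)
  also have "\<dots> = (\<integral>u. (\<integral>z. H (m + X (u, z), V *v m + g + Y (u, z)) \<partial>std_gauss) \<partial>std_gauss)"
    by (simp add: gaussian_measure_eq integral_distr transition_eq) (simp add: X_def)
  also have "\<dots> = (\<integral>w. H (m + X w, V *v m + g + Y w) \<partial>std_gauss)"
    using borel_betweenD(4)[OF H]
    by (intro std_gauss_pair.integral_fst'[where f = "\<lambda>w. H (m + X w, V *v m + g + Y w)", unfolded std_gauss_prod]
        integrable_std_gauss_bounded[where K = "\<bar>e\<bar> + \<bar>M\<bar>"]) auto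
  finally show ?thesis .
qed

sublocale hoelder_kernel source borel kernel p q
proof (intro hoelder_kernel.intro hoelder_kernel_axioms.intro p q)
  show "prob_space source"
    unfolding gaussian_measure_eq by (rule std_gauss.prob_space_distr) simp
  show "kernel \<in> source \<rightarrow>\<^sub>M prob_algebra borel"
    by (simp cong: measurable_cong_sets)
  fix F G :: "real^'n \<Rightarrow> real" and e M :: real
  assume "F \<in> borel_measurable source" "G \<in> borel_measurable borel" and e: "0 < e"
    and "F \<in> space source \<rightarrow> {e..M}" "G \<in> space borel \<rightarrow> {e..M}"
  then have F: "borel_between e M F" and G: "borel_between e M G"
    by (auto simp: borel_between_def gaussian_measure_eq)
  note [measurable] = borel_betweenD(1)[OF F] borel_betweenD(1)[OF G]
  have "(\<integral>x. F x powr (1 - 1 / p) * (\<integral>y. G y powr (1 / q) \<partial>kernel x) \<partial>source) =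
      FG_avg 1 F G (m, V *v m + g)"
    using integral_source_kernel[OF borel_between_powr_prod[OF F G e, of "1 - 1 / p" "1 / q"]] p q
    by (simp add: powr_prod_def gauss_avg_def XY_def)
  also have "\<dots> \<le> avg_FG 1 F G (m, V *v m + g)"
    using absolutely_continuous_gaussian_measure Q pos_def_target
    by (intro gauss_hoelder[OF e F G]) (simp_all add: source_law target_law)
  also have "\<dots> = (\<integral>x. F x \<partial>source) powr (1 - 1 / p) * (\<integral>y. G y \<partial>(source \<bind> kernel)) powr (1 / q)"
    unfolding bind_source_kernel
    by (simp add: powr_prod_def gauss_avg_def integral_distr flip: source_law target_law)
  finally show "(\<integral>x. F x powr (1 - 1 / p) * (\<integral>y. G y powr (1 / q) \<partial>kernel x) \<partial>source) \<le>
      (\<integral>x. F x \<partial>source) powr (1 - 1 / p) * (\<integral>y. G y \<partial>(source \<bind> kernel)) powr (1 / q)" .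
qed

end

theorem theorem3p3:
  fixes A B :: "real \<Rightarrow> real^'n^'n" and f :: "real \<Rightarrow> real^'n"
    and U :: "real \<Rightarrow> real \<Rightarrow> real^'n^'n"
    and p :: "real \<Rightarrow> real" and q t s :: real and \<mu>0 :: real
    and \<phi> :: "real^'n \<Rightarrow> real"
  assumes contA: "continuous_on UNIV A" and bddA: "bounded (range A)"
    and contB: "continuous_on UNIV B" and bddB: "bounded (range B)"
    and contf: "continuous_on UNIV f" and bddf: "bounded (range f)"
    and mu0: "\<mu>0 > 0" and Bbelow: "\<And>r x. norm (B r *v x) \<ge> \<mu>0 * norm x"
    and U_id: "\<And>r. U r r = mat 1"
    and U_deriv: "\<And>\<tau> r. ((\<lambda>\<tau>. U \<tau> r) has_vector_derivative (A \<tau> ** U \<tau> r)) (at \<tau>)"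
    and stable: "\<exists>\<omega> M. \<omega> < 0 \<and> (\<forall>r \<tau>. r \<le> \<tau> \<longrightarrow> mat_opnorm (U \<tau> r) \<le> M * exp (\<omega> * (\<tau> - r)))"
    and q: "1 < q"
    and p_init: "p t = q"
    and p_ode: "\<And>r. r \<le> t \<Longrightarrow>
        (p has_real_derivative (- p r / cfun U B (p r) r)) (at r within {..t})"
    and st: "s < t"
    and phi_meas: "\<phi> \<in> borel_measurable borel"
    and phi_Lq: "integrable (nu U B f t) (\<lambda>y. \<bar>\<phi> y\<bar> powr q)"
  shows "(AE x in nu U B f s.
            integrable (gaussian_measure (U t s *v x + meanG U f t s) (covQ U B t s)) \<phi>)
         \<and> Pst U B f s t \<phi> \<in> borel_measurable borel
         \<and> integrable (nu U B f s) (\<lambda>x. \<bar>Pst U B f s t \<phi> x\<bar> powr p s)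
         \<and> (\<integral>x. \<bar>Pst U B f s t \<phi> x\<bar> powr p s \<partial>nu U B f s) powr (1 / p s)
             \<le> (\<integral>y. \<bar>\<phi> y\<bar> powr q \<partial>nu U B f t) powr (1 / q)"
proof -
  interpret stable_evolution A B f U \<mu>0
    by (rule stable_evolution.intro) (fact bddA contB bddB contf bddf mu0 Bbelow U_id U_deriv stable)+
  have "s \<le> t" "1 < p t" using st q p_init by simp_all
  interpret T: gauss_transition "U t s" "covQinf U B s" "covQ U B t s" "meanGinf U f s" "meanG U f t s" "p s" q
    using pos_def_covQinf pos_def_covQ[OF st] exponent_gt_one[OF \<open>1 < p t\<close> p_ode \<open>s \<le> t\<close>] q
      covariance_decay[OF \<open>s \<le> t\<close> \<open>1 < p t\<close> p_ode]
    by (intro gauss_transition.intro) (simp_all add: p_init covQinf_split[OF \<open>s \<le> t\<close>])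
  have nu: "nu U B f s = T.source" "nu U B f t = T.\<nu>"
    by (simp_all add: nu_def T.bind_source_kernel meanGinf_split[OF \<open>s \<le> t\<close>] covQinf_split[OF \<open>s \<le> t\<close>])
  have "Pst U B f s t \<phi> = T.P \<phi>"
    by (simp add: fun_eq_iff Pst_def T.P_def T.kernel_def)
  then show ?thesis
    using T.AE_integrable_K[OF phi_meas] T.borel_measurable_P[OF phi_meas] T.hypercontractive[OF phi_meas] phi_Lq
    unfolding nu T.kernel_def by (simp cong: measurable_cong_sets)
qed

end
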